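(* Let $D\subset\mathbb{C}^n$ be an open invariant set, $f\in\mathcal{SR}(\Omega_D)$, and let $a=(a_1,\dots,a_n)\in\Omega_D$ and $r_1,\dots,r_n\ge0$ be such that $\overline{B_{r_1}(a_1)}\times\dots\times\overline{B_{r_n}(a_n)}\subset\Omega_D$. Let $H\in\mathcal{P}(n)$ and assume $a_h\in\mathbb{R}$ for every $h\in H$. Then $$f(a)=\sum_{K\subset H}(-1)^{|H\setminus K|}\,a_{H\setminus K}\int_{(\mathbb{S}^3)^{|H|}}\mathcal{S}^H_K(f)\Big(a+\sum_{h\in H}r_h\lambda_h\Big)\,d\sigma^{|H|}(\lambda),$$ where $\lambda=(\lambda_h)_{h\in H}$.
   Context: Sets and products. $\mathbb{H}\cong\mathbb{R}^4$ denotes the quaternions, $\mathbb{S}_\mathbb{H}=\{J\in\mathbb{H}: J^2=-1\}$, $\mathcal{P}(n)$ is the power set of $\{1,\dots,n\}$, and $H^c=\{1,\dots,n\}\setminus H$. For $K=\{k_1<\dots<k_p\}$ and quaternions $q_k$, $q_K:=q_{k_1}\cdots q_{k_p}$ (increasing order), $q_\emptyset:=1$. For $z\in\mathbb{C}^n$ write $z_h=\alpha_h+i\beta_h$ with $\alpha_h,\beta_h\in\mathbb{R}$, and let $\overline z^h$ be $z$ with $z_h$ replaced by $\overline{z_h}$. Stem and slice functions. $D\subset\mathbb{C}^n$ is invariant if $z\in D\iff\overline z^h\in D$ for all $h$. Let $\{e_K\}_{K\in\mathcal{P}(n)}$ be a basis of $\mathbb{R}^{2^n}$, $e_\emptyset=1$,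 $e_h:=e_{\{h\}}$. A stem function on $D$ is a continuous $F=\sum_{K\in\mathcal{P}(n)}e_KF_K:D\to\mathbb{H}\otimes\mathbb{R}^{2^n}$ ($F_K$ $\mathbb{H}$-valued) with $F_K(\overline z^h)=(-1)^{|K\cap\{h\}|}F_K(z)$ for all $K,h$. The circularization of $D$ is $\Omega_D=\{(\alpha_1+J_1\beta_1,\dots,\alpha_n+J_n\beta_n): (\alpha_1+i\beta_1,\dots,\alpha_n+i\beta_n)\in D,\ J_1,\dots,J_n\in\mathbb{S}_\mathbb{H}\}$. $F$ induces the slice function $f=\mathcal{I}(F):\Omega_D\to\mathbb{H}$, $f(x)=\sum_{K}J_KF_K(z)$ for $x=(\alpha_h+J_h\beta_h)_h$, $z=(\alpha_h+i\beta_h)_h$; the stem function $F$ is determined by $f$. $\mathcal{S}(\Omega_D)$ is the set of slice functions on $\Omega_D$. Product: $(F\otimes G)(z)=\sum_{H,K}(-1)^{|H\cap K|}e_{K\Delta H}F_K(z)G_H(z)$ ($\Delta$ = symmetric difference) and $\mathcal{I}(F)\odot\mathcal{I}(G):=\mathcal{I}(F\otimes G)$. The coordinate function $x_j$ is the slice function induced by $Z_j(z)=\alpha_j+e_j\beta_j$; $x_K$ is the ordered product of the $x_k$, $k\in K$. Regularity. $\mathcal{J}_h(q\otimes e_K)=(-1)^{|K\cap\{h\}|}q\otimes e_{K\Delta\{h\}}$ and $\overline\partial_h=\frac12(\partial/\partial\alpha_h+\mathcal{J}_h\,\partial/\partial\beta_h)$. A $C^1$ stem function $F$ is holomorphic if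 $\overline\partial_hF=0$ for every $h=1,\dots,n$; $f=\mathcal{I}(F)$ is slice regular if $F$ is holomorphic. $\mathcal{SR}(\Omega_D)$ is the set of slice regular functions. Spherical derivatives and components. For $H\in\mathcal{P}(n)$ let $D_H=\{z\in D:\beta_h\ne0\ \forall h\in H\}$, $\Omega_{D_H}$ its circularization, and for $f=\mathcal{I}(F)\in\mathcal{S}(\Omega_D)$ let $f'_{s,H}=\mathcal{I}(F'_H)\in\mathcal{S}(\Omega_{D_H})$, where $F'_H(z)=\big(\prod_{h\in H}\beta_h\big)^{-1}\sum_{K\subset H^c}e_KF_{K\cup H}(z)$. For $K\subset H$ define $\mathcal{S}^H_K(f):=(x_K\odot f)'_{s,H}$ on $\Omega_{D_H}$; $\mathcal{S}^\emptyset_\emptyset(f)=f$. When $f$ is slice regular, $\mathcal{S}^H_K(f)$ extends continuously (in a unique way) to $\Omega_D$ and the extension is denoted by the same symbol. Conventions. $\overline{B_r(q)}=\{x\in\mathbb{H}:|x-q|\le r\}$. $\mathbb{S}^3$ is the unit sphere of $\mathbb{H}\cong\mathbb{R}^4$, $\sigma$ its surface measure normalized by $\sigma(\mathbb{S}^3)=1$, $\sigma^l$ the $l$-fold product measure (for $l=0$ the integral is just evaluation of the integrand). For $a\in\mathbb{H}^n$ and quaternions $q_i$ ($i\in I\subset\{1,\dots,n\}$), $a+\sum_{i\in I}q_i$ denotes the point of $\mathbb{H}^n$ obtained from $a$ by replacing $a_i$ with $a_i+q_i$ for each $i\in I$. *)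

theory Defs
  imports "HOL-Analysis.Analysis"
begin

section \<open>Quaternions\<close>

datatype quat = Quat (qre: real) (qi: real) (qj: real) (qk: real)

lemma quat_eq_iff: "x = y \<longleftrightarrow> qre x = qre y \<and> qi x = qi y \<and> qj x = qj y \<and> qk x = qk y"
  by (cases x; cases y) simp

instantiation quat :: ab_group_add
begin

definition "0 = Quat 0 0 0 0"
definition "x + y = Quat (qre x + qre y) (qi x + qi y) (qj x + qj y) (qk x + qk y)"
definition "- x = Quat (- qre x) (- qi x) (- qj x) (- qk x)"
definition "x - y = Quat (qre x - qre y) (qi x - qi y) (qj x - qj y) (qk x - qk y)"

instance
  by standard
     (simp_all add: quat_eq_iff zero_quat_def plus_quat_def uminus_quat_def minus_quat_def)

end

lemma quat_sel_add_group [simp]: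
  "qre 0 = 0" "qi 0 = 0" "qj 0 = 0" "qk 0 = 0"
  "qre (x + y) = qre x + qre y" "qi (x + y) = qi x + qi y"
  "qj (x + y) = qj x + qj y" "qk (x + y) = qk x + qk y"
  "qre (- x) = - qre x" "qi (- x) = - qi x" "qj (- x) = - qj x" "qk (- x) = - qk x"
  "qre (x - y) = qre x - qre y" "qi (x - y) = qi x - qi y"
  "qj (x - y) = qj x - qj y" "qk (x - y) = qk x - qk y"
  by (simp_all add: zero_quat_def plus_quat_def uminus_quat_def minus_quat_def)

instantiation quat :: real_vector
begin

definition "scaleR c x = Quat (c * qre x) (c * qi x) (c * qj x) (c * qk x)"

instance
  by standard (simp_all add: quat_eq_iff scaleR_quat_def algebra_simps)

end

lemma quat_sel_scaleR [simp]:
  "qre (c *\<^sub>R x) = c * qre x" "qi (c *\<^sub>R x) = c * qi x"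
  "qj (c *\<^sub>R x) = c * qj x" "qk (c *\<^sub>R x) = c * qk x"
  by (simp_all add: scaleR_quat_def)

instantiation quat :: real_algebra_1
begin

definition "1 = Quat 1 0 0 0"
definition "x * y = Quat
  (qre x * qre y - qi x * qi y - qj x * qj y - qk x * qk y)
  (qre x * qi y + qi x * qre y + qj x * qk y - qk x * qj y)
  (qre x * qj y - qi x * qk y + qj x * qre y + qk x * qi y)
  (qre x * qk y + qi x * qj y - qj x * qi y + qk x * qre y)"

instance
  by standard (simp_all add: quat_eq_iff one_quat_def times_quat_def algebra_simps)

end

lemma quat_sel_one_times [simp]:
  "qre 1 = 1" "qi 1 = 0" "qj 1 = 0" "qk 1 = 0"
  "qre (x * y) = qre x * qre y - qi x * qi y - qj x * qj y - qk x * qk y"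
  "qi (x * y) = qre x * qi y + qi x * qre y + qj x * qk y - qk x * qj y"
  "qj (x * y) = qre x * qj y - qi x * qk y + qj x * qre y + qk x * qi y"
  "qk (x * y) = qre x * qk y + qi x * qj y - qj x * qi y + qk x * qre y"
  by (simp_all add: one_quat_def times_quat_def)

instantiation quat :: real_inner
begin

definition "inner x y = qre x * qre y + qi x * qi y + qj x * qj y + qk x * qk y"
definition "norm (x :: quat) = sqrt (inner x x)"
definition "sgn (x :: quat) = x /\<^sub>R norm x"
definition "dist (x :: quat) y = norm (x - y)"
definition [code del]:
  "(uniformity :: (quat \<times> quat) filter) = (INF e\<in>{0 <..}. principal {(x, y). dist x y < e})"
definition [code del]:
  "open (U :: quat set) \<longleftrightarrow> (\<forall>x\<in>U. eventually (\<lambda>(x', y). x' = x \<longrightarrow> y \<in> U) uniformity)"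

instance
proof
  fix x y z :: quat and c :: real
  show "dist x y = norm (x - y)" by (fact dist_quat_def)
  show "sgn x = x /\<^sub>R norm x" by (fact sgn_quat_def)
  show "(uniformity :: (quat \<times> quat) filter) = (INF e\<in>{0 <..}. principal {(x, y). dist x y < e})"
    by (fact uniformity_quat_def)
  show "open U \<longleftrightarrow> (\<forall>x\<in>U. eventually (\<lambda>(x', y). x' = x \<longrightarrow> y \<in> U) uniformity)"
    for U :: "quat set" by (fact open_quat_def)
  show "inner x y = inner y x" by (simp add: inner_quat_def algebra_simps)
  show "inner (x + y) z = inner x z + inner y z" by (simp add: inner_quat_def algebra_simps)
  show "inner (c *\<^sub>R x) y = c * inner x y" by (simp add: inner_quat_def algebra_simps)
  show "0 \<le> inner x x" by (simp add: inner_quat_def)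
  show "inner x x = 0 \<longleftrightarrow> x = 0"
    by (auto simp: inner_quat_def quat_eq_iff add_nonneg_eq_0_iff)
  show "norm x = sqrt (inner x x)" by (fact norm_quat_def)
qed

end

instantiation quat :: euclidean_space
begin

definition "Basis = {Quat 1 0 0 0, Quat 0 1 0 0, Quat 0 0 1 0, Quat 0 0 0 1}"

instance
proof
  fix u v x :: quat
  show "(Basis :: quat set) \<noteq> {}" "finite (Basis :: quat set)"
    by (simp_all add: Basis_quat_def)
  show "inner u v = (if u = v then 1 else 0)" if "u \<in> Basis" "v \<in> Basis"
    using that unfolding Basis_quat_def by (elim insertE emptyE) (simp_all add: inner_quat_def)
  show "(\<forall>u\<in>Basis. inner x u = 0) \<longleftrightarrow> x = 0"
    by (cases x) (simp add: Basis_quat_def inner_quat_def zero_quat_def)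
qed

end

lemma DIM_quat [simp]: "DIM(quat) = 4"
  by (simp add: Basis_quat_def)

instantiation quat :: real_normed_div_algebra
begin

definition "inverse x = Quat (qre x) (- qi x) (- qj x) (- qk x) /\<^sub>R inner x x"
definition "x div (y :: quat) = x * inverse y"

instance
proof
  fix x y :: quat
  show "inverse (0 :: quat) = 0" by (simp add: inverse_quat_def inner_quat_def)
  show "x div y = x * inverse y" by (fact divide_quat_def)
  show "inverse x * x = 1" if "x \<noteq> 0"
  proof -
    have "Quat (qre x) (- qi x) (- qj x) (- qk x) * x = inner x x *\<^sub>R 1"
      by (simp add: quat_eq_iff inner_quat_def)
    then show ?thesis using that by (simp add: inverse_quat_def)
  qed
  show "x * inverse x = 1" if "x \<noteq> 0"
  proof -
    have "x * Quat (qre x) (- qi x) (- qj x) (- qk x) = inner x x *\<^sub>R 1"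
      by (simp add: quat_eq_iff inner_quat_def)
    then show ?thesis using that by (simp add: inverse_quat_def)
  qed
  have "inner (x * y) (x * y) = inner x x * inner y y"
    by (simp add: inner_quat_def algebra_simps)
  then show "norm (x * y) = norm x * norm y"
    by (simp add: norm_quat_def real_sqrt_mult)
qed

end

definition imag_units :: "quat set"
  where "imag_units = {J. J\<^sup>2 = - 1}"

section \<open>Surface measure on the unit sphere\<close>

text \<open>The surface area of a Borel subset A of the unit sphere in dimension d is d times the
  Lebesgue measure of the cone of all t x with 0 < t < 1 and x in A
  (which is the preimage of A in the punctured unit ball under normalization).\<close>

definition surface_measure :: "'a::euclidean_space measure"
  where "surface_measure = scale_measure (of_nat DIM('a))
    (distr (restrict_space lborel (ball 0 1 - {0})) (restrict_space borel (sphere 0 1)) sgn)"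

definition sphere_prob :: "quat measure"
  where "sphere_prob = scale_measure (inverse (emeasure surface_measure (sphere (0::quat) 1)))
    surface_measure"

lemma space_surface_measure: "space (surface_measure :: 'a::euclidean_space measure) = sphere 0 1"
  and sets_surface_measure:
    "sets (surface_measure :: 'a measure) = sets (restrict_space borel (sphere 0 1))"
  by (simp_all add: surface_measure_def space_scale_measure space_restrict_space)

lemma emeasure_surface_measure:
  fixes A :: "'a::euclidean_space set"
  assumes "A \<in> sets borel" "A \<subseteq> sphere 0 1"
  shows "emeasure surface_measure A =
    of_nat DIM('a) * emeasure lborel {x \<in> ball 0 1 - {0}. sgn x \<in> A}"
proof -
  have sgn: "sgn \<in> restrict_space lborel (ball (0::'a) 1 - {0}) \<rightarrow>\<^sub>M restrict_space borel (sphere 0 1)"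
  proof (rule measurable_restrict_space3)
    have "(\<lambda>x::'a. x /\<^sub>R norm x) \<in> borel_measurable borel" by measurable
    then show "sgn \<in> lborel \<rightarrow>\<^sub>M (borel :: 'a measure)"
      by (simp add: sgn_div_norm[abs_def])
    show "sgn \<in> (ball (0::'a) 1 - {0}) \<rightarrow> sphere 0 1" by (auto simp: norm_sgn)
  qed
  have A: "A \<in> sets (restrict_space borel (sphere 0 1))"
    using assms by (auto simp: sets_restrict_space)
  have "emeasure (restrict_space lborel (ball 0 1 - {0})) {x \<in> ball 0 1 - {0}. sgn x \<in> A}
      = emeasure lborel {x \<in> ball 0 1 - {0}. sgn x \<in> A}"
    by (rule emeasure_restrict_space) auto
  moreover have "sgn -` A \<inter> (ball 0 1 - {0}) = {x \<in> ball 0 1 - {0}. sgn x \<in> A}" by auto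
  ultimately show ?thesis
    by (simp add: surface_measure_def emeasure_distr[OF sgn A] space_restrict_space)
qed

lemma emeasure_sphere_prob_sphere: "emeasure sphere_prob (sphere 0 1) = 1"
proof -
  have "{x \<in> ball 0 1 - {0}. sgn x \<in> sphere (0::quat) 1} = ball 0 1 - {0}"
    by (auto simp: norm_sgn)
  moreover have "emeasure lborel (ball 0 1 - {0::quat}) = emeasure lborel (ball (0::quat) 1)"
    by (rule emeasure_Diff_null_set) (simp_all add: countable_imp_null_set_lborel)
  ultimately have *: "emeasure surface_measure (sphere (0::quat) 1)
      = of_nat DIM(quat) * emeasure lborel (ball (0::quat) 1)"
    by (subst emeasure_surface_measure) simp_all
  have "emeasure lborel (ball (0::quat) 1) \<noteq> 0" "emeasure lborel (ball (0::quat) 1) \<noteq> top"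
    by (simp_all add: emeasure_ball ennreal_eq_0_iff not_le)
  then have "emeasure surface_measure (sphere (0::quat) 1) \<noteq> 0"
    "emeasure surface_measure (sphere (0::quat) 1) \<noteq> top"
    by (simp_all add: * ennreal_mult_eq_top_iff)
  then show ?thesis
    using ennreal_divide_self[of "emeasure surface_measure (sphere (0::quat) 1)"]
    by (simp add: sphere_prob_def divide_ennreal_def mult.commute less_top)
qed

section \<open>Stem functions and slice functions\<close>

text \<open>The coordinate indices {1..n} are modelled by a finite linearly ordered type. An element
  of the tensor product of the quaternions with the real span of the e_K is the vector of its
  coefficients, so the summand "e_K times q" is represented by "axis K q".\<close>

type_synonym 'n cspace = "(complex, 'n) vec"
type_synonym 'n qspace = "(quat, 'n) vec"
type_synonym 'n stem_val = "(quat, 'n set) vec"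

definition oprod :: "('n::{finite,linorder} \<Rightarrow> quat) \<Rightarrow> 'n set \<Rightarrow> quat"
  where "oprod q K = prod_list (map q (sorted_list_of_set K))"

definition conj_at :: "'n::finite \<Rightarrow> 'n cspace \<Rightarrow> 'n cspace"
  where "conj_at h z = (\<chi> i. if i = h then cnj (z $ i) else z $ i)"

definition invariant :: "'n::finite cspace set \<Rightarrow> bool"
  where "invariant D \<longleftrightarrow> (\<forall>z h. z \<in> D \<longleftrightarrow> conj_at h z \<in> D)"

definition stem_function ::
    "'n::finite cspace set \<Rightarrow> ('n cspace \<Rightarrow> 'n stem_val) \<Rightarrow> bool"
  where "stem_function D F \<longleftrightarrow> continuous_on D F \<and>
    (\<forall>z\<in>D. \<forall>h K. F (conj_at h z) $ K = (- 1) ^ card (K \<inter> {h}) * F z $ K)"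

definition slice_point :: "'n::finite qspace \<Rightarrow> 'n cspace \<Rightarrow> 'n qspace"
  where "slice_point J z = (\<chi> h. of_real (Re (z $ h)) + J $ h * of_real (Im (z $ h)))"

definition circularization :: "'n::finite cspace set \<Rightarrow> ('n qspace) set"
  where "circularization D = {slice_point J z |J z. z \<in> D \<and> (\<forall>h. J $ h \<in> imag_units)}"

text \<open>For a stem function on an invariant set, the value does not depend on the choice of the
  representation of x by z and J. Outside the circularization the value is irrelevant.\<close>

definition induced ::
    "'n::{finite,linorder} cspace set \<Rightarrow> ('n cspace \<Rightarrow> 'n stem_val) \<Rightarrow> 'n qspace \<Rightarrow> quat"
  where "induced D F x = (THE q. \<exists>z\<in>D. \<exists>J. (\<forall>h. J $ h \<in> imag_units) \<and> x = slice_point J z \<and>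
    q = (\<Sum>K\<in>UNIV. oprod (($) J) K * F z $ K))"

text \<open>Functions on the circularization are represented by total functions whose values elsewhere
  are arbitrary. The stem function of a slice function is unique as a function on D.\<close>

definition stem_of ::
    "'n::{finite,linorder} cspace set \<Rightarrow> ('n qspace \<Rightarrow> quat) \<Rightarrow> 'n cspace \<Rightarrow> 'n stem_val"
  where "stem_of D f =
    (SOME F. stem_function D F \<and> (\<forall>x\<in>circularization D. f x = induced D F x))"

definition stem_prod ::
    "('n::finite cspace \<Rightarrow> 'n stem_val) \<Rightarrow> ('n cspace \<Rightarrow> 'n stem_val) \<Rightarrow>
      'n cspace \<Rightarrow> 'n stem_val"
  where "stem_prod F G z =
    (\<Sum>H\<in>UNIV. \<Sum>K\<in>UNIV. axis (sym_diff K H) ((- 1) ^ card (H \<inter> K) * (F z $ K * G z $ H)))"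

definition slice_prod ::
    "'n::{finite,linorder} cspace set \<Rightarrow> ('n qspace \<Rightarrow> quat) \<Rightarrow> ('n qspace \<Rightarrow> quat) \<Rightarrow> 'n qspace \<Rightarrow> quat"
  where "slice_prod D f g = induced D (stem_prod (stem_of D f) (stem_of D g))"

definition coord :: "'n::{finite,linorder} cspace set \<Rightarrow> 'n \<Rightarrow> 'n qspace \<Rightarrow> quat"
  where "coord D j =
    induced D (\<lambda>z. axis {} (of_real (Re (z $ j))) + axis {j} (of_real (Im (z $ j))))"

definition coord_prod :: "'n::{finite,linorder} cspace set \<Rightarrow> 'n set \<Rightarrow> 'n qspace \<Rightarrow> quat"
  where "coord_prod D K =
    foldr (\<lambda>k g. slice_prod D (coord D k) g) (sorted_list_of_set K) (\<lambda>_. 1)"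

section \<open>Slice regularity\<close>

definition C1_on ::
    "'a::real_normed_vector set \<Rightarrow> ('a \<Rightarrow> 'b::real_normed_vector) \<Rightarrow> bool"
  where "C1_on D F \<longleftrightarrow> (\<exists>F' :: 'a \<Rightarrow> 'a \<Rightarrow>\<^sub>L 'b.
    (\<forall>z\<in>D. (F has_derivative blinfun_apply (F' z)) (at z)) \<and> continuous_on D F')"

definition stem_J :: "'n::finite \<Rightarrow> 'n stem_val \<Rightarrow> 'n stem_val"
  where "stem_J h w = (\<Sum>K\<in>UNIV. axis (sym_diff K {h}) ((- 1) ^ card (K \<inter> {h}) * w $ K))"

definition dbar ::
    "'n::finite \<Rightarrow> ('n cspace \<Rightarrow> 'n stem_val) \<Rightarrow> 'n cspace \<Rightarrow> 'n stem_val"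
  where "dbar h F z = (1 / 2) *\<^sub>R
    (vector_derivative (\<lambda>t. F (z + t *\<^sub>R axis h 1)) (at 0) +
     stem_J h (vector_derivative (\<lambda>t. F (z + t *\<^sub>R axis h \<i>)) (at 0)))"

definition stem_holomorphic ::
    "'n::finite cspace set \<Rightarrow> ('n cspace \<Rightarrow> 'n stem_val) \<Rightarrow> bool"
  where "stem_holomorphic D F \<longleftrightarrow>
    stem_function D F \<and> C1_on D F \<and> (\<forall>z\<in>D. \<forall>h. dbar h F z = 0)"

definition slice_regular ::
    "'n::{finite,linorder} cspace set \<Rightarrow> ('n qspace \<Rightarrow> quat) \<Rightarrow> bool"
  where "slice_regular D f \<longleftrightarrow>
    (\<exists>F. stem_holomorphic D F \<and> (\<forall>x\<in>circularization D. f x = induced D F x))"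

section \<open>Spherical derivatives and components\<close>

definition nonreal_part :: "'n::finite set \<Rightarrow> 'n cspace set \<Rightarrow> 'n cspace set"
  where "nonreal_part H D = {z \<in> D. \<forall>h\<in>H. Im (z $ h) \<noteq> 0}"

definition spherical_derivative ::
    "'n::{finite,linorder} cspace set \<Rightarrow> 'n set \<Rightarrow> ('n qspace \<Rightarrow> quat) \<Rightarrow> 'n qspace \<Rightarrow> quat"
  where "spherical_derivative D H f = induced (nonreal_part H D)
    (\<lambda>z. inverse (\<Prod>h\<in>H. Im (z $ h)) *\<^sub>R (\<Sum>K\<in>Pow (- H). axis K (stem_of D f z $ (K \<union> H))))"

text \<open>The unique continuous extension to the circularization of D; the extensionality condition
  only fixes the irrelevant values outside it.\<close>

definition spherical_component ::
    "'n::{finite,linorder} cspace set \<Rightarrow> 'n set \<Rightarrow> 'n set \<Rightarrow> ('n qspace \<Rightarrow> quat) \<Rightarrow> 'n qspace \<Rightarrow> quat"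
  where "spherical_component D H K f = (THE g.
    g \<in> extensional (circularization D) \<and> continuous_on (circularization D) g \<and>
    (\<forall>x\<in>circularization (nonreal_part H D).
      g x = spherical_derivative D H (slice_prod D (coord_prod D K) f) x))"

end

theory Submission
  imports Defs "HOL-Complex_Analysis.Complex_Analysis"
    "HOL-Probability.Infinite_Product_Measure" "HOL-Real_Asymp.Real_Asymp"
begin

text \<open>
  Let F be the stem function of f, with \<alpha>_h and \<beta>_h the real and imaginary parts of z_h.
  Multiplying by x_K and taking the spherical derivative in the variables of H turns F into the
  stem function whose coefficient at a set P disjoint from H is

    S_K(z) = \<Sum>_{L \<subseteq> K} (\<Prod>_{k \<in> K - L} \<alpha>_k) F_{P \<union> (H - L)}(z) / \<Prod>_{h \<in> H - L} \<beta>_h.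

  In the sum over K \<subseteq> H with the real weights \<Prod>_{h \<in> H - K} (- a_h) the products recombine to

    A(z) = \<Sum>_{Q \<subseteq> H} (\<Prod>_{h \<in> Q} (\<alpha>_h - a_h) / \<beta>_h) F_{P \<union> Q}(z).

  This is the result of passing, in each variable z_h with h \<in> H, from a function u + i v holomorphic
  in z_h to u + v (\<alpha>_h - a_h) / \<beta>_h.

  It suffices to average this in one variable. The map that keeps the real part of a quaternion and
  replaces its imaginary part by the norm carries the normalized measure on the sphere to
  (2/\<pi>) sin^2 \<theta> d\<theta> on the upper half of the unit circle (lemma has_integral_sphere_prob_upper).
  For z_h = a_h + r w with w = exp (i \<theta>) and \<phi>(w) = u + i v, the integrand is

    sin^2 \<theta> (u + v cot \<theta>) = sin \<theta> Im (w \<phi>(w)) = Re (\<phi>(w) (1 - w^2)) / 2,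

  and Cauchy's formula says that \<phi>(w) (1 - w^2) has mean value \<phi>(0) over the unit circle (lemma
  disc_mean_value_sin). Fubini's theorem extends this to any number of variables (lemma
  iterated_mean_value).

  The spherical components are extensions by continuity across the points with some \<beta>_h = 0, and the
  existence of these extensions has to be proved. The difference of Cauchy's formulas at z_h and at
  its conjugate represents v / \<beta>_h by an integral that stays continuous up to \<beta>_h = 0 (lemma
  divides_by_Im_exists). The extended quotient is again a stem function and remains holomorphic in
  the variables other than z_h (lemma holomorphic_in_divides_by_Im), so that one can go on and divide
  by the imaginary part of the next variable. Since the points with \<beta>_h \<noteq> 0 for all h \<in> H are dense,
  the extensions are unique, and the identity between A and the sum of the S_K holds everywhere.
\<close>

(* Reserves the dollar sign for components of vectors. *)
no_notation fps_nth (infixl "$" 75)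

section \<open>The uniform measure on the unit sphere of the quaternions\<close>

text \<open>The closed upper half plane parametrizes the spheres \<alpha> + \<beta> J, where J
  runs over the imaginary units and \<beta> \<ge> 0.\<close>

definition upper :: "quat \<Rightarrow> complex"
  where "upper q = Complex (qre q) (sqrt ((qi q)\<^sup>2 + (qj q)\<^sup>2 + (qk q)\<^sup>2))"

definition quat_of :: "real \<times> real \<times> real \<times> real \<Rightarrow> quat"
  where "quat_of = (\<lambda>(t, x, y, z). Quat t x y z)"

lemma quat_coord_inner:
  "qre q = q \<bullet> Quat 1 0 0 0" "qi q = q \<bullet> Quat 0 1 0 0"
  "qj q = q \<bullet> Quat 0 0 1 0" "qk q = q \<bullet> Quat 0 0 0 1"
  by (simp_all add: inner_quat_def)

lemma continuous_on_quat_coord [continuous_intros]: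
  assumes "continuous_on S f"
  shows "continuous_on S (\<lambda>x. qre (f x))" "continuous_on S (\<lambda>x. qi (f x))"
    "continuous_on S (\<lambda>x. qj (f x))" "continuous_on S (\<lambda>x. qk (f x))"
  unfolding quat_coord_inner using assms by (intro continuous_intros; simp)+

lemma norm_quat_eq: "norm q = sqrt ((qre q)\<^sup>2 + (qi q)\<^sup>2 + (qj q)\<^sup>2 + (qk q)\<^sup>2)"
  by (simp add: norm_quat_def inner_quat_def power2_eq_square)

lemma quat_of_eq:
  "quat_of p = fst p *\<^sub>R Quat 1 0 0 0 + fst (snd p) *\<^sub>R Quat 0 1 0 0
     + fst (snd (snd p)) *\<^sub>R Quat 0 0 1 0 + snd (snd (snd p)) *\<^sub>R Quat 0 0 0 1"
  by (cases p) (simp add: quat_of_def quat_eq_iff)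

lemma continuous_on_upper: "continuous_on S upper"
  unfolding upper_def[abs_def] Complex_eq by (intro continuous_intros)

lemma measurable_upper [measurable]: "upper \<in> borel_measurable borel"
  by (intro borel_measurable_continuous_onI continuous_on_upper)

lemma measurable_quat_of [measurable]: "quat_of \<in> borel_measurable borel"
  unfolding quat_of_eq[abs_def] by (intro borel_measurable_continuous_onI continuous_intros)

lemma emeasure_lborel_Times:
  fixes A :: "'a::euclidean_space set" and B :: "'b::euclidean_space set"
  assumes "A \<in> sets borel" "B \<in> sets borel"
  shows "emeasure lborel (A \<times> B) = emeasure lborel A * emeasure lborel B"
  using assms by (simp add: lborel_prod[symmetric] lborel.emeasure_pair_measure_Times)

text \<open>Quaternions form a datatype and not a product type; this identification makes
  Tonelli's theorem applicable to them.\<close>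

lemma lborel_quat_eq_distr: "lborel = distr lborel borel quat_of"
proof (rule lborel_eqI)
  fix l u :: quat
  assume le: "\<And>b. b \<in> Basis \<Longrightarrow> l \<bullet> b \<le> u \<bullet> b"
  have le': "qre l \<le> qre u" "qi l \<le> qi u" "qj l \<le> qj u" "qk l \<le> qk u"
    using le unfolding quat_coord_inner by (auto simp: Basis_quat_def)
  have "quat_of -` box l u \<inter> space lborel
      = {qre l<..<qre u} \<times> {qi l<..<qi u} \<times> {qj l<..<qj u} \<times> {qk l<..<qk u}"
    by (auto simp: quat_of_def mem_box Basis_quat_def inner_quat_def)
  then have "emeasure (distr lborel borel quat_of) (box l u)
      = emeasure lborel ({qre l<..<qre u} \<times> {qi l<..<qi u} \<times> {qj l<..<qj u} \<times> {qk l<..<qk u})"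
    by (simp add: emeasure_distr)
  also have "\<dots> = ennreal (qre u - qre l) * (ennreal (qi u - qi l) *
      (ennreal (qj u - qj l) * ennreal (qk u - qk l)))"
    using le' by (simp add: emeasure_lborel_Times borel_open open_Times)
  also have "\<dots> = ennreal (\<Prod>b\<in>Basis. (u - l) \<bullet> b)"
    using le' by (simp add: Basis_quat_def inner_quat_def ennreal_mult' mult.assoc)
  finally show "emeasure (distr lborel borel quat_of) (box l u) = ennreal (\<Prod>b\<in>Basis. (u - l) \<bullet> b)" .
qed simp

text \<open>The normalization of - u + i, which is the point of the upper unit circle with
  cotangent - u.\<close>

definition half_circle :: "real \<Rightarrow> complex"
  where "half_circle u = Complex (- u / sqrt (1 + u\<^sup>2)) (1 / sqrt (1 + u\<^sup>2))"

lemma continuous_on_half_circle: "continuous_on S half_circle"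
  unfolding half_circle_def[abs_def] Complex_eq
  by (intro continuous_intros) (auto simp: add_nonneg_eq_0_iff)

lemma measurable_half_circle [measurable]: "half_circle \<in> borel_measurable borel"
  by (intro borel_measurable_continuous_onI continuous_on_half_circle)

lemma nn_integral_norm_ball_scale:
  assumes s: "(s::real) > 0"
  shows "(\<integral>\<^sup>+ y. ennreal (norm y) * indicator (ball 0 (1 / s)) y \<partial>(lborel :: 'a::euclidean_space measure))
    = ennreal ((1 / s) ^ Suc DIM('a)) *
      (\<integral>\<^sup>+ y. ennreal (norm y) * indicator (ball 0 1) y \<partial>(lborel :: 'a measure))"
proof -
  note [measurable] = borel_open[OF open_ball]
  have m: "(\<lambda>y::'a. 0 + (1 / s) *\<^sub>R y) \<in> borel_measurable lborel" by measurable
  have "(\<integral>\<^sup>+ y. ennreal (norm (y::'a)) * indicator (ball 0 (1 / s)) y \<partial>lborel)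
     = (\<integral>\<^sup>+ y. ennreal (norm (y::'a)) * indicator (ball 0 (1 / s)) y
         \<partial>density (distr lborel borel (\<lambda>y. 0 + (1 / s) *\<^sub>R y)) (\<lambda>_. \<bar>1 / s\<bar> ^ DIM('a)))"
    using lborel_affine[of "1 / s" "0::'a"] s by simp
  also have "\<dots> = (\<integral>\<^sup>+ y. ennreal ((1 / s) ^ Suc DIM('a)) *
        (ennreal (norm y) * indicator (ball 0 1) (y::'a)) \<partial>lborel)"
    apply (subst nn_integral_density)
      apply simp
     apply measurable
    apply (subst nn_integral_distr)
      apply measurable
    apply (intro nn_integral_cong)
    using s apply (auto simp: indicator_def ennreal_mult'[symmetric] field_simps simp flip: ennreal_power)
    done
  also have "\<dots> = ennreal ((1 / s) ^ Suc DIM('a)) *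
      (\<integral>\<^sup>+ y. ennreal (norm y) * indicator (ball 0 1) (y::'a) \<partial>lborel)"
    by (rule nn_integral_cmult) measurable
  finally show ?thesis .
qed

text \<open>For a fixed nonzero imaginary part p, the direction of a quaternion depends only on
  the ratio of its real part to the norm of p. For a fixed ratio, the unit ball becomes a
  condition on the norm of p.\<close>

lemma upper_sgn_line:
  fixes p :: "real \<times> real \<times> real"
  assumes "p \<noteq> 0"
  shows "upper (sgn (quat_of (- norm p * u, p))) = half_circle u"
    "quat_of (- norm p * u, p) \<in> ball 0 1 - {0} \<longleftrightarrow> p \<in> ball 0 (1 / sqrt (1 + u\<^sup>2))"
proof -
  obtain x y z where p: "p = (x, y, z)" by (cases p)
  let ?n = "norm p"
  have n2: "?n\<^sup>2 = x\<^sup>2 + y\<^sup>2 + z\<^sup>2" by (simp add: p norm_Pair)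
  have n0: "?n > 0" using assms by simp
  have s0: "sqrt (1 + u\<^sup>2) > 0" by (simp add: add_pos_nonneg)
  have N: "norm (quat_of (- ?n * u, p)) = ?n * sqrt (1 + u\<^sup>2)"
  proof -
    have "norm (quat_of (- ?n * u, p)) = sqrt (?n\<^sup>2 * (1 + u\<^sup>2))"
      by (simp add: norm_quat_eq quat_of_def p, simp add: norm_Pair power_mult_distrib algebra_simps)
    then show ?thesis using n0 by (simp add: real_sqrt_mult)
  qed
  show "quat_of (- ?n * u, p) \<in> ball 0 1 - {0} \<longleftrightarrow> p \<in> ball 0 (1 / sqrt (1 + u\<^sup>2))"
  proof -
    have "quat_of (- ?n * u, p) \<noteq> 0" using N n0 s0 by (metis norm_zero mult_pos_pos less_irrefl)
    then show ?thesis using s0 unfolding Diff_iff mem_ball dist_0_norm N by (simp add: less_divide_eq)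
  qed
  let ?c = "1 / (?n * sqrt (1 + u\<^sup>2))"
  have "sgn (quat_of (- ?n * u, p)) = ?c *\<^sub>R quat_of (- ?n * u, p)"
    by (simp only: sgn_div_norm N inverse_eq_divide)
  also have "upper \<dots> = Complex (?c * (- ?n * u)) (sqrt (?c\<^sup>2 * (x\<^sup>2 + y\<^sup>2 + z\<^sup>2)))"
    unfolding upper_def by (simp add: p quat_of_def, simp add: algebra_simps power_mult_distrib power_divide add_divide_distrib)
  also have "sqrt (?c\<^sup>2 * (x\<^sup>2 + y\<^sup>2 + z\<^sup>2)) = ?c * ?n"
    using n0 s0 by (simp add: n2[symmetric] real_sqrt_mult)
  also have "Complex (?c * (- ?n * u)) (?c * ?n) = half_circle u"
    using n0 s0 by (simp add: half_circle_def)
  finally show "upper (sgn (quat_of (- ?n * u, p))) = half_circle u" .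
qed

text \<open>For a fixed imaginary part p, substitute - u \<bar>p\<bar> for the real part and
  exchange the two integrals. The integral over p then runs over a ball of radius 1 / sqrt (1 +
  u^2) in dimension three, and scaling produces the density.\<close>

lemma nn_integral_sgn_ball:
  fixes g :: "complex \<Rightarrow> ennreal"
  assumes [measurable]: "g \<in> borel_measurable borel"
  defines "W \<equiv> \<integral>\<^sup>+ y. ennreal (norm y) * indicator (ball 0 1) (y :: real \<times> real \<times> real) \<partial>lborel"
  shows "(\<integral>\<^sup>+ x. g (upper (sgn x)) * indicator (ball 0 1 - {0}) x \<partial>lborel)
    = W * (\<integral>\<^sup>+ u. g (half_circle u) * ennreal (1 / (1 + u\<^sup>2)\<^sup>2) \<partial>lborel)"
proof -
  note [measurable] = borel_open[OF open_ball] borel_singleton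
  let ?F = "\<lambda>x :: quat. g (upper (sgn x)) * indicator (ball 0 1 - {0}) x"
  let ?B = "\<lambda>u::real. ball (0 :: real \<times> real \<times> real) (1 / sqrt (1 + u\<^sup>2))"
  have [measurable]: "sgn \<in> borel_measurable (borel :: quat measure)"
    unfolding sgn_div_norm[abs_def] by measurable
  have [measurable]: "?F \<in> borel_measurable borel" by measurable
  have [measurable]: "(\<lambda>p. ?F (quat_of p)) \<in> borel_measurable borel"
    by measurable
  have "(\<integral>\<^sup>+ x. ?F x \<partial>lborel) = (\<integral>\<^sup>+ p. ?F (quat_of p) \<partial>lborel)"
    by (subst lborel_quat_eq_distr, subst nn_integral_distr) simp_all
  also have "\<dots> = (\<integral>\<^sup>+ p. ?F (quat_of p) \<partial>(lborel \<Otimes>\<^sub>M lborel))"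
    by (simp only: lborel_prod)
  also have "\<dots> = (\<integral>\<^sup>+ y. \<integral>\<^sup>+ t. ?F (quat_of (t, y)) \<partial>lborel \<partial>lborel)"
    by (rule lborel_pair.nn_integral_snd[where f = "\<lambda>p. ?F (quat_of p)", symmetric])
      (simp only: lborel_prod measurable_lborel1, measurable)
  also have "\<dots> = (\<integral>\<^sup>+ y. \<integral>\<^sup>+ u. ennreal (norm y) * (g (half_circle u) * indicator (?B u) y) \<partial>lborel \<partial>lborel)"
  proof (rule nn_integral_cong_AE)
    have eq: "(\<integral>\<^sup>+ t. ?F (quat_of (t, y)) \<partial>lborel)
        = (\<integral>\<^sup>+ u. ennreal (norm y) * (g (half_circle u) * indicator (?B u) y) \<partial>lborel)"
      if "y \<noteq> 0" for y
    proof -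
      have "(\<integral>\<^sup>+ t. ?F (quat_of (t, y)) \<partial>lborel)
          = ennreal \<bar>- norm y\<bar> * (\<integral>\<^sup>+ u. ?F (quat_of (0 + - norm y * u, y)) \<partial>lborel)"
        using that by (intro nn_integral_real_affine) measurable
      also have "\<dots> = (\<integral>\<^sup>+ u. ennreal (norm y) * ?F (quat_of (- norm y * u, y)) \<partial>lborel)"
        by (subst nn_integral_cmult) (simp_all del: mult_minus_left)
      also have "\<dots> = (\<integral>\<^sup>+ u. ennreal (norm y) * (g (half_circle u) * indicator (?B u) y) \<partial>lborel)"
        using upper_sgn_line[OF that]
        by (intro nn_integral_cong) (simp add: indicator_def del: mult_minus_left)
      finally show ?thesis .
    qed
    show "AE y in lborel. (\<integral>\<^sup>+ t. ?F (quat_of (t, y)) \<partial>lborel)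
        = (\<integral>\<^sup>+ u. ennreal (norm y) * (g (half_circle u) * indicator (?B u) y) \<partial>lborel)"
      using AE_lborel_singleton[of 0] by eventually_elim (rule eq)
  qed
  also have "\<dots> = (\<integral>\<^sup>+ u. \<integral>\<^sup>+ y. ennreal (norm y) * (g (half_circle u) * indicator (?B u) y) \<partial>lborel \<partial>lborel)"
  proof (rule lborel_pair.Fubini')
    have *: "(\<lambda>x. indicator (?B (fst x)) (snd x) :: ennreal)
        = indicator {x. norm (snd x) < 1 / sqrt (1 + (fst x)\<^sup>2)}"
      by (auto simp: indicator_def fun_eq_iff)
    have [measurable]: "(\<lambda>x. indicator (?B (fst x)) (snd x) :: ennreal)
        \<in> borel_measurable (lborel \<Otimes>\<^sub>M lborel)"
      unfolding * by measurable
    show "(\<lambda>(u, y). ennreal (norm y) * (g (half_circle u) * indicator (?B u) y))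
        \<in> borel_measurable (lborel \<Otimes>\<^sub>M lborel)"
      unfolding case_prod_beta by measurable
  qed
  also have "\<dots> = (\<integral>\<^sup>+ u. W * (g (half_circle u) * ennreal (1 / (1 + u\<^sup>2)\<^sup>2)) \<partial>lborel)"
  proof (intro nn_integral_cong)
    fix u :: real
    have s0: "sqrt (1 + u\<^sup>2) > 0" by (simp add: add_pos_nonneg)
    have "(\<integral>\<^sup>+ y. ennreal (norm y) * (g (half_circle u) * indicator (?B u) y) \<partial>lborel)
      = (\<integral>\<^sup>+ y. g (half_circle u) * (ennreal (norm y) * indicator (?B u) y) \<partial>lborel)"
      by (intro nn_integral_cong) (simp add: ac_simps)
    also have "\<dots> = g (half_circle u) * (\<integral>\<^sup>+ y. ennreal (norm y) * indicator (?B u) y \<partial>lborel)"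
      by (rule nn_integral_cmult) measurable
    also have "\<dots> = g (half_circle u) * (ennreal ((1 / sqrt (1 + u\<^sup>2)) ^ Suc DIM(real \<times> real \<times> real)) * W)"
      unfolding W_def by (subst nn_integral_norm_ball_scale[OF s0]) simp
    also have "(1 / sqrt (1 + u\<^sup>2)) ^ Suc DIM(real \<times> real \<times> real) = 1 / (1 + u\<^sup>2)\<^sup>2"
      by (simp add: power_divide eval_nat_numeral)
    finally show "(\<integral>\<^sup>+ y. ennreal (norm y) * (g (half_circle u) * indicator (?B u) y) \<partial>lborel)
      = W * (g (half_circle u) * ennreal (1 / (1 + u\<^sup>2)\<^sup>2))" by (simp add: ac_simps)
  qed
  also have "\<dots> = W * (\<integral>\<^sup>+ u. g (half_circle u) * ennreal (1 / (1 + u\<^sup>2)\<^sup>2) \<partial>lborel)"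
    by (rule nn_integral_cmult) measurable
  finally show ?thesis .
qed

lemma space_sphere_prob: "space sphere_prob = sphere 0 1"
  by (simp add: sphere_prob_def space_scale_measure space_surface_measure)

lemma sets_sphere_prob: "sets sphere_prob = sets (restrict_space borel (sphere 0 1))"
  by (simp add: sphere_prob_def sets_surface_measure)

lemma prob_space_sphere_prob: "prob_space sphere_prob"
  by (rule prob_spaceI) (simp add: space_sphere_prob emeasure_sphere_prob_sphere)

lemma measurable_sphere_prob: "f \<in> borel_measurable borel \<Longrightarrow> f \<in> borel_measurable sphere_prob"
  by (subst measurable_cong_sets[OF sets_sphere_prob refl]) (rule measurable_restrict_space1)

text \<open>The constant is determined later, from the fact that both sides come from
  probability measures.\<close>

lemma nn_integral_sphere_prob_upper:
  obtains C where "\<And>g :: complex \<Rightarrow> ennreal. g \<in> borel_measurable borel \<Longrightarrow>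
    (\<integral>\<^sup>+ l. g (upper l) \<partial>sphere_prob)
      = C * (\<integral>\<^sup>+ u. g (half_circle u) * ennreal (1 / (1 + u\<^sup>2)\<^sup>2) \<partial>lborel)"
proof -
  let ?N = "inverse (emeasure surface_measure (sphere (0::quat) 1))"
  define W where "W = (\<integral>\<^sup>+ y. ennreal (norm y) * indicator (ball 0 1) (y :: real \<times> real \<times> real) \<partial>lborel)"
  have sgn: "sgn \<in> restrict_space lborel (ball (0::quat) 1 - {0}) \<rightarrow>\<^sub>M restrict_space borel (sphere 0 1)"
  proof (rule measurable_restrict_space3)
    have "(\<lambda>x::quat. x /\<^sub>R norm x) \<in> borel_measurable borel" by measurable
    then show "sgn \<in> lborel \<rightarrow>\<^sub>M (borel :: quat measure)"
      by (simp add: sgn_div_norm[abs_def])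
    show "sgn \<in> (ball (0::quat) 1 - {0}) \<rightarrow> sphere 0 1" by (auto simp: norm_sgn)
  qed
  have "(\<integral>\<^sup>+ l. g (upper l) \<partial>sphere_prob)
      = ?N * 4 * W * (\<integral>\<^sup>+ u. g (half_circle u) * ennreal (1 / (1 + u\<^sup>2)\<^sup>2) \<partial>lborel)"
    if g [measurable]: "g \<in> borel_measurable borel" for g
  proof -
    have gu: "(\<lambda>l. g (upper l)) \<in> borel_measurable borel" by measurable
    then have gr: "(\<lambda>l. g (upper l)) \<in> borel_measurable (restrict_space borel (sphere 0 1))"
      by (rule measurable_restrict_space1)
    have "(\<integral>\<^sup>+ l. g (upper l) \<partial>sphere_prob) = ?N * (of_nat DIM(quat) *
       (\<integral>\<^sup>+ x. g (upper (sgn x)) \<partial>restrict_space lborel (ball 0 1 - {0})))"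
      unfolding sphere_prob_def
      apply (subst nn_integral_scale_measure)
       apply (subst measurable_cong_sets[OF sets_surface_measure refl], rule gr)
      unfolding surface_measure_def
      apply (subst nn_integral_scale_measure)
       apply (simp add: gr)
      apply (subst nn_integral_distr[OF sgn])
       apply (simp_all add: gr)
      done
    also have "(\<integral>\<^sup>+ x. g (upper (sgn x)) \<partial>restrict_space lborel (ball 0 1 - {0}))
      = (\<integral>\<^sup>+ x. g (upper (sgn x)) * indicator (ball 0 1 - {0}) x \<partial>lborel)"
      by (rule nn_integral_restrict_space) simp
    also note nn_integral_sgn_ball[OF g, folded W_def]
    finally show ?thesis by (simp add: mult.assoc)
  qed
  then show ?thesis by (rule that)
qed

lemma norm_half_circle: "norm (half_circle u) = 1"
proof -
  have nz: "1 + u\<^sup>2 \<noteq> 0" by (simp add: add_nonneg_eq_0_iff)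
  have "(- u / sqrt (1 + u\<^sup>2))\<^sup>2 + (1 / sqrt (1 + u\<^sup>2))\<^sup>2 = u\<^sup>2 / (1 + u\<^sup>2) + 1 / (1 + u\<^sup>2)"
    by (simp add: power_divide)
  also have "\<dots> = 1" using nz by (simp add: add_divide_distrib[symmetric] add.commute)
  finally show ?thesis by (simp add: half_circle_def cmod_def)
qed

lemma norm_upper: "norm (upper q) = norm q"
  by (simp add: upper_def cmod_def norm_quat_eq add.assoc)

text \<open>With the shift by \<pi> / 2 the tangent increases from -\<infinity> to \<infinity>
  on the range of the angle.\<close>

lemma half_circle_tan:
  assumes "0 < \<theta>" "\<theta> < pi"
  shows "half_circle (tan (\<theta> - pi / 2)) = cis \<theta>"
    "1 + (tan (\<theta> - pi / 2))\<^sup>2 = 1 / (sin \<theta>)\<^sup>2"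
proof -
  have s: "sin \<theta> > 0" using assms by (rule sin_gt_zero)
  have t: "tan (\<theta> - pi / 2) = - cos \<theta> / sin \<theta>"
    by (simp add: tan_def sin_diff cos_diff)
  have "(sin \<theta>)\<^sup>2 + (cos \<theta>)\<^sup>2 = 1" by simp
  then show *: "1 + (tan (\<theta> - pi / 2))\<^sup>2 = 1 / (sin \<theta>)\<^sup>2"
    using s unfolding t by (simp add: power_divide field_simps)
  have "sqrt (1 + (tan (\<theta> - pi / 2))\<^sup>2) = 1 / sin \<theta>"
    using s unfolding * by (simp add: real_sqrt_divide)
  then show "half_circle (tan (\<theta> - pi / 2)) = cis \<theta>"
    using s unfolding half_circle_def t by (simp add: complex_eq_iff)
qed

lemma integral_tan_substitution:
  fixes g :: "complex \<Rightarrow> 'b::euclidean_space"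
  assumes g: "continuous_on (sphere 0 1) g"
    and int: "integrable lborel (\<lambda>u. (1 / (1 + u\<^sup>2)\<^sup>2) *\<^sub>R g (half_circle u))"
  shows "((\<lambda>\<theta>. (sin \<theta>)\<^sup>2 *\<^sub>R g (cis \<theta>)) has_integral
    (LINT u|lborel. (1 / (1 + u\<^sup>2)\<^sup>2) *\<^sub>R g (half_circle u))) {0..pi}"
proof -
  let ?f = "\<lambda>u. (1 / (1 + u\<^sup>2)\<^sup>2) *\<^sub>R g (half_circle u)"
  let ?t = "\<lambda>\<theta>. tan (\<theta> - pi / 2)"
  let ?h = "\<lambda>\<theta>. (sin \<theta>)\<^sup>2 *\<^sub>R g (cis \<theta>)"
  have cf: "continuous_on UNIV ?f"
    by (intro continuous_intros continuous_on_compose2[OF g] continuous_on_half_circle)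
       (auto simp: norm_half_circle add_nonneg_eq_0_iff)
  have ch: "continuous_on {0..pi} ?h"
    by (intro continuous_intros continuous_on_compose2[OF g]) auto
  then have ih: "set_integrable lborel {0..pi} ?h"
    by (rule borel_integrable_atLeastAtMost')
  have eq: "(1 + (?t x)\<^sup>2) *\<^sub>R ?f (?t x) = ?h x" if "0 < x" "x < pi" for x
  proof -
    have "sin x > 0" using that by (rule sin_gt_zero)
    then show ?thesis unfolding half_circle_tan[OF that] by (simp add: power2_eq_square)
  qed
  have "(LBINT x=-\<infinity>..\<infinity>. ?f x) = (LBINT x=ereal 0..ereal pi. (1 + (?t x)\<^sup>2) *\<^sub>R ?f (?t x))"
  proof (rule interval_integral_substitution_integrable)
    show "(?t has_real_derivative 1 + (?t x)\<^sup>2) (at x)" if "ereal 0 < ereal x" "ereal x < ereal pi" for x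
    proof -
      have c: "cos (x - pi / 2) \<noteq> 0" using that sin_gt_zero[of x] by (simp add: cos_diff)
      have "(sin (x - pi / 2))\<^sup>2 + (cos (x - pi / 2))\<^sup>2 = 1" by simp
      then have "inverse ((cos (x - pi / 2))\<^sup>2) = 1 + (?t x)\<^sup>2"
        using c by (simp add: tan_def power_divide field_simps)
      with c show ?thesis by (auto intro!: derivative_eq_intros)
    qed
    show "isCont ?f (?t x)" for x
      using cf by (simp add: continuous_on_eq_continuous_at)
    show "isCont (\<lambda>x. 1 + (?t x)\<^sup>2) x" if "ereal 0 < ereal x" "ereal x < ereal pi" for x
    proof -
      have c: "cos (x - pi / 2) \<noteq> 0" using that sin_gt_zero[of x] by (simp add: cos_diff)
      then show ?thesis by (intro continuous_intros) auto
    qed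
    show "((ereal \<circ> ?t \<circ> real_of_ereal) \<longlongrightarrow> -\<infinity>) (at_right (ereal 0))"
    proof -
      have "filterlim ?t at_bot (at_right 0)"
        by real_asymp
      then show ?thesis by (simp only: ereal_tendsto_simps1 ereal_tendsto_simps2)
    qed
    show "((ereal \<circ> ?t \<circ> real_of_ereal) \<longlongrightarrow> \<infinity>) (at_left (ereal pi))"
    proof -
      have "filterlim ?t at_top (at_left pi)"
        by real_asymp
      then show ?thesis by (simp only: ereal_tendsto_simps1 ereal_tendsto_simps2)
    qed
    show "set_integrable lborel (einterval (ereal 0) (ereal pi)) (\<lambda>x. (1 + (?t x)\<^sup>2) *\<^sub>R ?f (?t x))"
    proof -
      have "set_integrable lborel {0<..<pi} ?h"
        by (rule set_integrable_subset[OF ih]) auto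
      also have "set_integrable lborel {0<..<pi} ?h \<longleftrightarrow>
          set_integrable lborel {0<..<pi} (\<lambda>x. (1 + (?t x)\<^sup>2) *\<^sub>R ?f (?t x))"
        by (intro set_integrable_cong) (use eq in auto)
      finally show ?thesis by simp
    qed
    show "set_integrable lborel (einterval (-\<infinity>) \<infinity>) ?f"
      using int by (simp add: set_integrable_def einterval_def)
  qed auto
  also have "\<dots> = (LBINT x=ereal 0..ereal pi. ?h x)"
    by (intro interval_integral_cong) (use eq in \<open>auto simp: einterval_def min_def max_def split: if_splits\<close>)
  also have "\<dots> = integral {0..pi} ?h"
    using ih by (intro interval_integral_eq_integral) auto
  finally have "integral {0..pi} ?h = (LINT u|lborel. ?f u)"
    by (simp add: einterval_def set_lebesgue_integral_def interval_lebesgue_integral_def)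
  moreover have "?h integrable_on {0..pi}"
    by (rule integrable_continuous_real[OF ch])
  ultimately show ?thesis by (metis integrable_integral)
qed

lemma has_integral_sin_square: "((\<lambda>\<theta>. (sin \<theta>)\<^sup>2) has_integral pi / 2) {0..pi}"
proof -
  have "((\<lambda>\<theta>. (sin \<theta>)\<^sup>2) has_integral ((pi - sin pi * cos pi) / 2 - (0 - sin 0 * cos 0) / 2)) {0..pi}"
  proof (rule fundamental_theorem_of_calculus)
    show "((\<lambda>\<theta>. (\<theta> - sin \<theta> * cos \<theta>) / 2) has_vector_derivative (sin x)\<^sup>2) (at x within {0..pi})" for x :: real
    proof -
      have "(sin x)\<^sup>2 + (cos x)\<^sup>2 = 1" by simp
      then have e: "(1 - (cos x * cos x - sin x * sin x)) / 2 = (sin x)\<^sup>2"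
        by (simp add: power2_eq_square)
      show ?thesis
        unfolding has_real_derivative_iff_has_vector_derivative[symmetric]
        by (subst e[symmetric]) (auto intro!: derivative_eq_intros)
    qed
  qed simp
  then show ?thesis by simp
qed

text \<open>In the variable u = tan (\<theta> - \<pi> / 2) the image of the uniform distribution
  has a density proportional to 1 / (1 + u^2)^2. The substitution makes it proportional to sin^2
  \<theta>, and the constant function 1 fixes the factor.\<close>

lemma has_integral_sphere_prob_upper:
  fixes g :: "complex \<Rightarrow> 'b::euclidean_space"
  assumes g: "continuous_on (cball 0 1) g"
  shows "((\<lambda>\<theta>. (sin \<theta>)\<^sup>2 *\<^sub>R g (cis \<theta>)) has_integral
    (pi / 2) *\<^sub>R (LINT l|sphere_prob. g (upper l))) {0..pi}"
proof -
  obtain C where C: "\<And>g :: complex \<Rightarrow> ennreal. g \<in> borel_measurable borel \<Longrightarrow>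
    (\<integral>\<^sup>+ l. g (upper l) \<partial>sphere_prob)
      = C * (\<integral>\<^sup>+ u. g (half_circle u) * ennreal (1 / (1 + u\<^sup>2)\<^sup>2) \<partial>lborel)"
    by (rule nn_integral_sphere_prob_upper) blast
  interpret sphere_prob: prob_space sphere_prob by (rule prob_space_sphere_prob)
  have one: "1 = C * (\<integral>\<^sup>+ u. ennreal (1 / (1 + u\<^sup>2)\<^sup>2) \<partial>lborel)"
    using C[of "\<lambda>_. 1"] by (simp add: sphere_prob.emeasure_space_1)
  have "C \<noteq> top"
  proof
    assume "C = top"
    with one show False
      by (cases "(\<integral>\<^sup>+ u. ennreal (1 / (1 + u\<^sup>2)\<^sup>2) \<partial>lborel) = 0") (simp_all add: ennreal_top_mult)
  qed
  then obtain c where c: "C = ennreal c" "c \<ge> 0" by (cases C) auto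
  let ?m = "density lborel (\<lambda>u. ennreal (c * (1 / (1 + u\<^sup>2)\<^sup>2)))"
  have mu: "upper \<in> sphere_prob \<rightarrow>\<^sub>M borel" by (intro measurable_sphere_prob measurable_upper)
  have meq: "distr sphere_prob borel upper = distr ?m borel half_circle"
  proof (rule measure_eqI)
    fix A assume "A \<in> sets (distr sphere_prob borel upper)"
    then have A [measurable]: "A \<in> sets borel" by simp
    have "emeasure (distr sphere_prob borel upper) A = (\<integral>\<^sup>+ l. indicator A (upper l) \<partial>sphere_prob)"
      using mu by (simp add: nn_integral_distr[symmetric])
    also have "\<dots> = (\<integral>\<^sup>+ u. ennreal (c * (1 / (1 + u\<^sup>2)\<^sup>2)) * indicator A (half_circle u) \<partial>lborel)"
      unfolding C[OF borel_measurable_indicator[OF A]] c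
      by (subst nn_integral_cmult[symmetric], measurable, intro nn_integral_cong)
        (simp add: ennreal_mult'[OF c(2)] ac_simps del: times_divide_eq_right)
    also have "\<dots> = emeasure (distr ?m borel half_circle) A"
      by (subst nn_integral_density[symmetric], measurable)
        (subst nn_integral_distr[of half_circle ?m borel "indicator A", symmetric], auto)
    finally show "emeasure (distr sphere_prob borel upper) A = emeasure (distr ?m borel half_circle) A" .
  qed simp
  have key: "((\<lambda>\<theta>. (sin \<theta>)\<^sup>2 *\<^sub>R (c *\<^sub>R h (cis \<theta>))) has_integral (LINT l|sphere_prob. h (upper l))) {0..pi}"
    if h: "continuous_on (cball 0 1) h" for h :: "complex \<Rightarrow> 'c::euclidean_space"
  proof -
    define h' where "h' = (\<lambda>w. indicator (cball 0 1) w *\<^sub>R h w)"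
    have h' [measurable]: "h' \<in> borel_measurable borel"
      unfolding h'_def by (rule borel_measurable_continuous_on_indicator) (use h in auto)
    have "bounded (h ` cball 0 1)"
      by (intro compact_imp_bounded compact_continuous_image h) auto
    then obtain B where B: "norm (h w) \<le> B" if "w \<in> cball 0 1" for w
      unfolding bounded_iff by blast
    have bd: "norm (h' w) \<le> max B 0" for w
      using B[of w] by (cases "w \<in> cball 0 1") (simp_all add: h'_def le_max_iff_disj)
    have on: "h' (half_circle u) = h (half_circle u)" for u
      by (simp add: h'_def norm_half_circle)
    have int: "integrable sphere_prob (\<lambda>l. h' (upper l))"
      by (rule sphere_prob.integrable_const_bound[where B = "max B 0"])
         (auto intro!: bd measurable_sphere_prob)
    then have "integrable (distr sphere_prob borel upper) h'"
      by (subst integrable_distr_eq[OF mu]) auto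
    then have int': "integrable lborel (\<lambda>u. (c * (1 / (1 + u\<^sup>2)\<^sup>2)) *\<^sub>R h' (half_circle u))"
      unfolding meq by (subst (asm) integrable_distr_eq, simp, simp, subst (asm) integrable_density)
         (auto simp: c(2))
    then have "((\<lambda>\<theta>. (sin \<theta>)\<^sup>2 *\<^sub>R (c *\<^sub>R h (cis \<theta>))) has_integral
      (LINT u|lborel. (1 / (1 + u\<^sup>2)\<^sup>2) *\<^sub>R (c *\<^sub>R h (half_circle u)))) {0..pi}"
      using h unfolding on
      by (intro integral_tan_substitution[where g = "\<lambda>w. c *\<^sub>R h w"] continuous_intros)
         (auto intro: continuous_on_subset simp: ac_simps)
    also have "(LINT u|lborel. (1 / (1 + u\<^sup>2)\<^sup>2) *\<^sub>R (c *\<^sub>R h (half_circle u)))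
        = (LINT u|lborel. (c * (1 / (1 + u\<^sup>2)\<^sup>2)) *\<^sub>R h' (half_circle u))"
      unfolding on by (simp add: ac_simps)
    also have "\<dots> = (LINT w|distr ?m borel half_circle. h' w)"
      by (subst integral_distr, simp, simp, subst integral_density) (auto simp: c(2))
    also have "\<dots> = (LINT l|sphere_prob. h' (upper l))"
      unfolding meq[symmetric] by (rule integral_distr[OF mu h'])
    also have "\<dots> = (LINT l|sphere_prob. h (upper l))"
      by (intro Bochner_Integration.integral_cong) (auto simp: h'_def space_sphere_prob norm_upper)
    finally show ?thesis .
  qed
  have "((\<lambda>\<theta>. (sin \<theta>)\<^sup>2 * c) has_integral 1) {0..pi}"
    using key[of "\<lambda>_. 1 :: real"] by (simp add: sphere_prob.prob_space)
  moreover have "((\<lambda>\<theta>. (sin \<theta>)\<^sup>2 * c) has_integral pi / 2 * c) {0..pi}"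
    using has_integral_mult_left[OF has_integral_sin_square, of c] by simp
  ultimately have c1: "pi / 2 * c = 1" by (rule has_integral_unique[rotated])
  have "((\<lambda>\<theta>. (pi / 2) *\<^sub>R (sin \<theta>)\<^sup>2 *\<^sub>R (c *\<^sub>R g (cis \<theta>))) has_integral
    (pi / 2) *\<^sub>R (LINT l|sphere_prob. g (upper l))) {0..pi}"
    by (intro has_integral_cmul key g)
  moreover have "(pi / 2) *\<^sub>R (sin \<theta>)\<^sup>2 *\<^sub>R (c *\<^sub>R g (cis \<theta>)) = (sin \<theta>)\<^sup>2 *\<^sub>R g (cis \<theta>)" for \<theta>
  proof -
    have "(pi / 2) *\<^sub>R (sin \<theta>)\<^sup>2 *\<^sub>R (c *\<^sub>R g (cis \<theta>)) = (pi / 2 * c) *\<^sub>R (sin \<theta>)\<^sup>2 *\<^sub>R g (cis \<theta>)"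
      by (simp add: ac_simps)
    then show ?thesis by (simp only: c1 scaleR_one)
  qed
  ultimately show ?thesis by (simp only:)
qed

section \<open>Holomorphic functions of one variable with real symmetry\<close>

text \<open>Cauchy's formula for \<Phi>(w) (1 - w^2) at 0. On the unit circle the real part of
  this function is twice the integrand, and by symmetry the two half circles contribute
  equally.\<close>

lemma disc_mean_value_sin:
  fixes \<Phi> :: "complex \<Rightarrow> complex"
  assumes S: "open S" "cball 0 1 \<subseteq> S" and hol: "\<Phi> holomorphic_on S"
    and sym: "\<And>w. norm w = 1 \<Longrightarrow> \<Phi> (cnj w) = cnj (\<Phi> w)"
  shows "((\<lambda>\<theta>. sin \<theta> * Im (cis \<theta> * \<Phi> (cis \<theta>))) has_integral pi / 2 * Re (\<Phi> 0)) {0..pi}"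
proof -
  define k where "k = (\<lambda>\<theta>. sin \<theta> * Im (cis \<theta> * \<Phi> (cis \<theta>)))"
  have "((\<lambda>u. (\<Phi> u * (1 - u\<^sup>2)) / (u - 0)) has_contour_integral
      (2 * of_real pi * \<i>) * (\<Phi> 0 * (1 - 0\<^sup>2))) (circlepath 0 1)"
    by (rule Cauchy_integral_circlepath_simple)
       (use holomorphic_on_subset[OF hol S(2)] in \<open>auto intro!: holomorphic_intros\<close>)
  then have "((\<lambda>t. (\<Phi> (cis t) * (1 - (cis t)\<^sup>2)) / cis t * \<i> * cis t) has_integral
      (2 * of_real pi * \<i>) * \<Phi> 0) {0..2*pi}"
    by (simp add: circlepath_def has_contour_integral_part_circlepath_iff)
  then have "((\<lambda>t. Im ((\<Phi> (cis t) * (1 - (cis t)\<^sup>2)) / cis t * \<i> * cis t)) has_integral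
      Im ((2 * of_real pi * \<i>) * \<Phi> 0)) {0..2*pi}"
    by (rule has_integral_linear[OF _ bounded_linear_Im, unfolded comp_def])
  moreover have "Im ((\<Phi> (cis t) * (1 - (cis t)\<^sup>2)) / cis t * \<i> * cis t) = 2 * k t" for t
  proof -
    \<comment> \<open>Factor out the point itself, using that its product with its conjugate is 1.\<close>
    have "1 - (cis t)\<^sup>2 = cis t * (cnj (cis t) - cis t)"
      by (simp add: algebra_simps power2_eq_square cis_cnj cis_mult)
    also have "cnj (cis t) - cis t = - 2 * \<i> * of_real (sin t)"
      by (simp add: complex_eq_iff)
    finally have "1 - (cis t)\<^sup>2 = cis t * (- 2 * \<i> * of_real (sin t))" .
    then have "(\<Phi> (cis t) * (1 - (cis t)\<^sup>2)) / cis t * \<i> * cis t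
        = of_real (2 * sin t) * (cis t * \<Phi> (cis t))"
      by (simp add: mult_ac)
    then show ?thesis by (simp only: k_def Im_complex_of_real Re_complex_of_real times_complex.sel)
  qed
  ultimately have "((\<lambda>t. 2 * k t) has_integral 2 * pi * Re (\<Phi> 0)) {0..2*pi}"
    by simp
  then have full: "(k has_integral pi * Re (\<Phi> 0)) {0..2*pi}"
    by (drule_tac has_integral_mult_right[where c = "1/2"]) simp
  have "continuous_on {0..pi} k"
    unfolding k_def
    by (intro continuous_intros continuous_on_compose2[OF holomorphic_on_imp_continuous_on[OF hol]])
       (use S(2) in auto)
  then have half: "(k has_integral integral {0..pi} k) {0..pi}"
    using integrable_continuous_real integrable_integral by blast
  have refl: "k (- x + 2 * pi) = k x" for x
  proof -
    have c: "cis (- x + 2 * pi) = cnj (cis x)"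
      by (simp add: complex_eq_iff)
    have "\<Phi> (cis (- x + 2 * pi)) = cnj (\<Phi> (cis x))"
      unfolding c by (rule sym) simp
    moreover have "sin (- x + 2 * pi) = - sin x" by simp
    ultimately show ?thesis unfolding k_def c by (simp del: sin_2pi_minus add: algebra_simps)
  qed
  have "((\<lambda>x. k (- 1 *\<^sub>R x + 2 * pi)) has_integral (1 / \<bar>-1\<bar> ^ DIM(real)) *\<^sub>R integral {0..pi} k)
     ((\<lambda>x. (1 / -1) *\<^sub>R x + - ((1 / -1) *\<^sub>R (2 * pi))) ` cbox 0 pi)"
    by (rule has_integral_affinity) (use half in auto)
  moreover have "(\<lambda>x. (1 / -1) *\<^sub>R x + - ((1 / -1) *\<^sub>R (2 * pi))) ` cbox 0 pi = {pi..2*pi}"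
  proof -
    have "(\<lambda>x. (1 / -1) *\<^sub>R x + - ((1 / -1) *\<^sub>R (2 * pi))) ` cbox 0 pi = (\<lambda>x. 2 * pi - x) ` {0..pi}"
      by (intro image_cong) auto
    then show ?thesis by (simp add: image_diff_atLeastAtMost)
  qed
  ultimately have "(k has_integral integral {0..pi} k) {pi..2*pi}"
    using refl by simp
  with half have "(k has_integral integral {0..pi} k + integral {0..pi} k) {0..2*pi}"
    by (intro has_integral_combine[of 0 pi]) auto
  with full have "integral {0..pi} k + integral {0..pi} k = pi * Re (\<Phi> 0)"
    by (rule has_integral_unique[rotated])
  then have hv: "integral {0..pi} k = pi / 2 * Re (\<Phi> 0)" by simp
  show ?thesis using half[unfolded hv] unfolding k_def .
qed

text \<open>Up to a constant factor, the difference of the Cauchy kernels at w and at its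
  conjugate, divided by the imaginary part of w and pulled back to the angle on the circle with
  centre c and radius \<rho>. It stays finite when w becomes real.\<close>

definition cauchy_kernel :: "real \<Rightarrow> real \<Rightarrow> real \<Rightarrow> complex \<Rightarrow> complex"
  where "cauchy_kernel c \<rho> t w = of_real \<rho> * cis t /
    ((of_real c + of_real \<rho> * cis t - w) * (of_real c + of_real \<rho> * cis t - cnj w))"

lemma circle_minus_nonzero:
  assumes "w \<in> ball (of_real c) \<rho>"
  shows "of_real c + of_real \<rho> * cis t - w \<noteq> 0" "of_real c + of_real \<rho> * cis t - cnj w \<noteq> 0"
proof -
  have *: "of_real c + of_real \<rho> * cis t - v \<noteq> 0" if "v \<in> ball (of_real c) \<rho>" for v
  proof
    assume "of_real c + of_real \<rho> * cis t - v = 0"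
    then have "v - of_real c = of_real \<rho> * cis t" by (simp add: algebra_simps)
    then have "norm (v - of_real c) = \<bar>\<rho>\<bar>" by (simp add: norm_mult)
    with that show False by (simp add: dist_norm norm_minus_commute)
  qed
  show "of_real c + of_real \<rho> * cis t - w \<noteq> 0" using * assms by blast
  have "norm (cnj (of_real c - w)) = norm (of_real c - w)" by (rule complex_mod_cnj)
  with assms have "cnj w \<in> ball (of_real c) \<rho>" by (simp add: dist_norm)
  then show "of_real c + of_real \<rho> * cis t - cnj w \<noteq> 0" by (rule *)
qed

text \<open>The difference of Cauchy's formulas at w and at its conjugate. The integral still
  makes sense for real w, which is what extends the quotient.\<close>

lemma Im_div_Im_eq_kernel_integral:
  assumes hol: "\<phi> holomorphic_on cball (of_real c) \<rho>" and w: "w \<in> ball (of_real c) \<rho>"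
    and sym: "\<phi> (cnj w) = cnj (\<phi> w)" and im: "Im w \<noteq> 0"
  shows "((\<lambda>t. Re (\<phi> (of_real c + of_real \<rho> * cis t) * cauchy_kernel c \<rho> t w)) has_integral
    2 * pi * (Im (\<phi> w) / Im w)) {0..2*pi}"
proof -
  let ?\<zeta> = "\<lambda>t. of_real c + of_real \<rho> * cis t :: complex"
  have "norm (cnj (of_real c - w)) = norm (of_real c - w)" by (rule complex_mod_cnj)
  with w have cw: "cnj w \<in> ball (of_real c) \<rho>" by (simp add: dist_norm)
  have "((\<lambda>u. \<phi> u / (u - w) - \<phi> u / (u - cnj w)) has_contour_integral
      (2 * of_real pi * \<i>) * \<phi> w - (2 * of_real pi * \<i>) * \<phi> (cnj w)) (circlepath (of_real c) \<rho>)"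
    by (intro has_contour_integral_diff Cauchy_integral_circlepath_simple hol)
       (use w cw in \<open>simp_all add: dist_norm norm_minus_commute\<close>)
  then have "((\<lambda>t. (\<phi> (?\<zeta> t) / (?\<zeta> t - w) - \<phi> (?\<zeta> t) / (?\<zeta> t - cnj w)) * \<rho> * \<i> * cis t) has_integral
      (2 * of_real pi * \<i>) * \<phi> w - (2 * of_real pi * \<i>) * \<phi> (cnj w)) {0..2*pi}"
    by (simp add: circlepath_def has_contour_integral_part_circlepath_iff)
  moreover have "(\<phi> (?\<zeta> t) / (?\<zeta> t - w) - \<phi> (?\<zeta> t) / (?\<zeta> t - cnj w)) * \<rho> * \<i> * cis t
      = of_real (- 2 * Im w) * (\<phi> (?\<zeta> t) * cauchy_kernel c \<rho> t w)" for t
  proof -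
    note nz = circle_minus_nonzero[OF w, of t]
    have "\<phi> (?\<zeta> t) / (?\<zeta> t - w) - \<phi> (?\<zeta> t) / (?\<zeta> t - cnj w)
        = \<phi> (?\<zeta> t) * (w - cnj w) / ((?\<zeta> t - w) * (?\<zeta> t - cnj w))"
      by (subst diff_frac_eq[OF nz]) (simp add: algebra_simps)
    also have "w - cnj w = 2 * \<i> * of_real (Im w)" by (simp add: complex_eq_iff)
    finally show ?thesis by (simp add: cauchy_kernel_def mult_ac)
  qed
  moreover have "(2 * of_real pi * \<i>) * \<phi> w - (2 * of_real pi * \<i>) * \<phi> (cnj w)
      = of_real (- 4 * pi * Im (\<phi> w))"
    unfolding sym by (simp add: complex_eq_iff)
  ultimately have "((\<lambda>t. of_real (- 2 * Im w) * (\<phi> (?\<zeta> t) * cauchy_kernel c \<rho> t w)) has_integral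
      of_real (- 4 * pi * Im (\<phi> w))) {0..2*pi}"
    by simp
  then have "((\<lambda>t. of_real (- 1 / (2 * Im w)) * (of_real (- 2 * Im w) * (\<phi> (?\<zeta> t) * cauchy_kernel c \<rho> t w)))
     has_integral of_real (- 1 / (2 * Im w)) * of_real (- 4 * pi * Im (\<phi> w))) {0..2*pi}"
    by (rule has_integral_mult_right)
  moreover have "of_real (- 1 / (2 * Im w)) * (of_real (- 2 * Im w) * x) = x" for x :: complex
    using im by (simp add: field_simps)
  moreover have "of_real (- 1 / (2 * Im w)) * of_real (- 4 * pi * Im (\<phi> w))
      = (of_real (2 * pi * (Im (\<phi> w) / Im w)) :: complex)"
    using im by (simp add: field_simps)
  ultimately have "((\<lambda>t. \<phi> (?\<zeta> t) * cauchy_kernel c \<rho> t w) has_integral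
      of_real (2 * pi * (Im (\<phi> w) / Im w))) {0..2*pi}"
    by (simp only:)
  from has_integral_linear[OF this bounded_linear_Re] show ?thesis
    by (simp add: comp_def)
qed

text \<open>Each local extension is the limit of f along S, hence the local extensions agree on
  overlaps and glue.\<close>

lemma continuous_extension_local:
  fixes f :: "'a::t2_space \<Rightarrow> 'b::t2_space"
  assumes S: "S \<subseteq> D" "\<And>x. x \<in> D \<Longrightarrow> x islimpt S"
    and loc: "\<And>x. x \<in> D \<Longrightarrow> \<exists>U E. open U \<and> x \<in> U \<and> continuous_on U E \<and> (\<forall>y\<in>U \<inter> S. E y = f y)"
  obtains g where "continuous_on D g" "\<And>x. x \<in> S \<Longrightarrow> g x = f x"
proof -
  define g where "g = (\<lambda>x. Lim (at x within S) f)"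
  have eq: "g y = E y" if U: "open U" "y \<in> U" "y \<in> D" "continuous_on U E" "\<forall>y\<in>U \<inter> S. E y = f y" for U E y
  proof -
    have "isCont E y" using U by (simp add: continuous_on_eq_continuous_at)
    then have "(E \<longlongrightarrow> E y) (at y within S)"
      unfolding isCont_def by (rule tendsto_within_subset) simp
    moreover have "eventually (\<lambda>x. E x = f x) (at y within S)"
      unfolding eventually_at_topological using U by blast
    ultimately have "(f \<longlongrightarrow> E y) (at y within S)"
      by (rule Lim_transform_eventually)
    moreover have "\<not> trivial_limit (at y within S)"
      using S(2)[OF U(3)] trivial_limit_within by blast
    ultimately show ?thesis unfolding g_def by (rule tendsto_Lim[rotated])
  qed
  have "continuous_on D g"
    unfolding continuous_on_eq_continuous_within
  proof
    fix x assume x: "x \<in> D"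
    obtain U E where U: "open U" "x \<in> U" "continuous_on U E" "\<forall>y\<in>U \<inter> S. E y = f y"
      using loc[OF x] by (elim exE conjE) (rule that)
    have "isCont E x" using U by (simp add: continuous_on_eq_continuous_at)
    then have "continuous (at x within D) E" by (rule continuous_at_imp_continuous_at_within)
    moreover have "E x = g x" using eq[of U x E] U x by simp
    ultimately have "(E \<longlongrightarrow> g x) (at x within D)" by (simp add: continuous_within)
    moreover have "eventually (\<lambda>y. E y = g y) (at x within D)"
      unfolding eventually_at_topological
      by (intro exI[of _ U] conjI ballI impI) (use U eq[of U _ E] in simp_all)
    ultimately show "continuous (at x within D) g"
      unfolding continuous_within by (rule Lim_transform_eventually)
  qed
  moreover have "g x = f x" if "x \<in> S" for x
  proof -
    have x: "x \<in> D" using that S by blast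
    obtain U E where U: "open U" "x \<in> U" "continuous_on U E" "\<forall>y\<in>U \<inter> S. E y = f y"
      using loc[OF x] by (elim exE conjE) (rule that)
    then show ?thesis using eq[of U x E] that x by simp
  qed
  ultimately show ?thesis by (rule that)
qed

lemma continuous_eq_on_dense:
  fixes f g :: "'a::t2_space \<Rightarrow> 'b::t2_space"
  assumes "continuous_on D f" "continuous_on D g" "S \<subseteq> D" "D \<subseteq> closure S"
    and eq: "\<And>x. x \<in> S \<Longrightarrow> f x = g x" and x: "x \<in> D"
  shows "f x = g x"
proof (cases "x \<in> S")
  case False
  with assms have lim: "\<not> trivial_limit (at x within S)"
    by (auto simp: trivial_limit_within closure_def)
  have "(f \<longlongrightarrow> f x) (at x within S)" "(g \<longlongrightarrow> g x) (at x within S)"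
    using assms tendsto_within_subset unfolding continuous_on_def by blast+
  moreover have "eventually (\<lambda>y. f y = g y) (at x within S)"
    using eq by (auto simp: eventually_at_topological)
  ultimately have "(g \<longlongrightarrow> f x) (at x within S)" "(g \<longlongrightarrow> g x) (at x within S)"
    by (blast intro: Lim_transform_eventually)+
  with lim show ?thesis using tendsto_unique by blast
qed (rule eq)

section \<open>Stem functions that are holomorphic in one of several variables\<close>

definition upd :: "'n::finite cspace \<Rightarrow> 'n \<Rightarrow> complex \<Rightarrow> 'n cspace"
  where "upd z h w = (\<chi> i. if i = h then w else z $ i)"

lemma upd_nth [simp]: "upd z h w $ i = (if i = h then w else z $ i)"
  by (simp add: upd_def)

lemma upd_same [simp]: "upd z h (z $ h) = z"
  by (simp add: vec_eq_iff)

lemma upd_upd [simp]: "upd (upd z h v) h w = upd z h w"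
  by (simp add: vec_eq_iff)

lemma conj_at_nth [simp]: "conj_at h z $ i = (if i = h then cnj (z $ i) else z $ i)"
  by (simp add: conj_at_def)

lemma conj_at_upd: "conj_at h (upd z h w) = upd z h (cnj w)"
  by (simp add: vec_eq_iff)

lemma continuous_on_upd [continuous_intros]:
  assumes "continuous_on S f" "continuous_on S g"
  shows "continuous_on S (\<lambda>x. upd (f x) h (g x))"
  unfolding upd_def
proof (intro continuous_on_vec_lambda)
  show "continuous_on S (\<lambda>x. if i = h then g x else f x $ i)" for i
    using assms by (cases "i = h") (auto intro: continuous_intros)
qed

lemma continuous_on_conj_at: "continuous_on S (conj_at h)"
  unfolding conj_at_def
proof (intro continuous_on_vec_lambda)
  show "continuous_on S (\<lambda>z. if i = h then cnj (z $ i) else z $ i)" for i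
    by (cases "i = h") (auto intro!: continuous_intros)
qed

lemma nonreal_part_subset: "nonreal_part H D \<subseteq> D"
  by (auto simp: nonreal_part_def)

lemma open_nonreal_part:
  assumes "open D" shows "open (nonreal_part H D)"
proof -
  have "nonreal_part H D = D \<inter> (\<Inter>h\<in>H. {z. Im (z $ h) \<noteq> 0})"
    by (auto simp: nonreal_part_def)
  moreover have "open {z :: 'a cspace. Im (z $ h) \<noteq> 0}" for h
    by (rule open_Collect_neq) (intro continuous_intros)+
  ultimately show ?thesis using assms by (auto intro!: open_Int open_INT)
qed

lemma closure_nonreal_part:
  fixes D :: "'n::finite cspace set"
  assumes D: "open D"
  shows "D \<subseteq> closure (nonreal_part H D)"
proof
  fix z assume z: "z \<in> D"
  \<comment> \<open>For small t > 0 this shift makes all coordinates nonreal at the same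
    time.\<close>
  let ?p = "\<lambda>t. (\<chi> i. z $ i + Complex 0 t) :: 'n cspace"
  have lim: "(?p \<longlongrightarrow> ?p 0) (at_right 0)"
    unfolding Complex_eq by (intro tendsto_intros)
  have p0: "?p 0 = z" by (simp add: vec_eq_iff complex_eq_iff)
  have "eventually (\<lambda>t. ?p t \<in> D) (at_right 0)"
    using topological_tendstoD[OF lim[unfolded p0] D z] .
  moreover have "eventually (\<lambda>t. \<forall>i. Im (?p t $ i) \<noteq> 0) (at_right 0)"
  proof (rule eventually_all_finite)
    fix i
    have "eventually (\<lambda>t. t \<noteq> - Im (z $ i)) (at_right (0::real))"
      by (rule eventually_neq_at_within)
    then show "eventually (\<lambda>t. Im (?p t $ i) \<noteq> 0) (at_right 0)"
      by eventually_elim auto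
  qed
  ultimately have "eventually (\<lambda>t. ?p t \<in> nonreal_part H D) (at_right 0)"
    by eventually_elim (auto simp: nonreal_part_def)
  then have "eventually (\<lambda>t. ?p t \<in> closure (nonreal_part H D)) (at_right 0)"
    by eventually_elim (use closure_subset in auto)
  with lim[unfolded p0] show "z \<in> closure (nonreal_part H D)"
    by (intro Lim_in_closed_set[of _ ?p "at_right 0"]) auto
qed

lemma islimpt_nonreal_part:
  fixes D :: "'n::finite cspace set"
  assumes "open D" "z \<in> D"
  shows "z islimpt nonreal_part H D"
proof (cases "z \<in> nonreal_part H D")
  case True
  then show ?thesis using open_nonreal_part[OF assms(1)] by (simp add: interior_limit_point interior_open)
next
  case False
  then show ?thesis using closure_nonreal_part[OF assms(1), of H] assms(2) by (auto simp: closure_def)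
qed

lemma stem_function_conj_at:
  assumes "stem_function D F" "z \<in> D"
  shows "F (conj_at h z) $ K = (if h \<in> K then - F z $ K else F z $ K)"
proof -
  have "F (conj_at h z) $ K = (- 1) ^ card (K \<inter> {h}) * F z $ K"
    using assms by (auto simp: stem_function_def)
  then show ?thesis by simp
qed

lemma stem_functionI:
  assumes "\<And>K. continuous_on D (\<lambda>z. F z $ K)"
    and "\<And>z h K. z \<in> D \<Longrightarrow> F (conj_at h z) $ K = (if h \<in> K then - F z $ K else F z $ K)"
  shows "stem_function D F"
proof -
  have "continuous_on D (\<lambda>z. \<chi> K. F z $ K)"
    by (intro continuous_on_vec_lambda assms)
  moreover have "F (conj_at h z) $ K = (- 1) ^ card (K \<inter> {h}) * F z $ K" if "z \<in> D" for z h K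
    using assms(2)[OF that, of h K] by simp
  ultimately show ?thesis by (simp add: stem_function_def)
qed

lemma stem_function_continuous:
  "stem_function D F \<Longrightarrow> continuous_on D (\<lambda>z. F z $ K)"
  by (auto simp: stem_function_def intro: continuous_intros)

text \<open>A coefficient that is odd in a variable vanishes where that variable is
  real.\<close>

lemma stem_function_real_zero:
  assumes "stem_function D F" "z \<in> D" "h \<in> K" "Im (z $ h) = 0"
  shows "F z $ K = 0"
proof -
  have "conj_at h z = z" using assms(4) by (simp add: vec_eq_iff complex_eq_iff)
  then have "F z $ K = - F z $ K"
    using stem_function_conj_at[OF assms(1,2), of h K] assms(3) by simp
  then show ?thesis
    by (metis add.right_inverse real_vector.scale_eq_0_iff scaleR_2 zero_neq_numeral)
qed

text \<open>Testing against a fixed quaternion b makes the coefficients at K and at K \<union>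
  {j} the real and imaginary part of one complex function of the variable z_j, which brings in
  one-variable complex analysis.\<close>

definition complex_slice :: "('n::finite cspace \<Rightarrow> 'n stem_val) \<Rightarrow> 'n cspace \<Rightarrow> 'n \<Rightarrow> 'n set \<Rightarrow> quat \<Rightarrow> complex \<Rightarrow> complex"
  where "complex_slice F z j K b w = Complex (F (upd z j w) $ K \<bullet> b) (F (upd z j w) $ insert j K \<bullet> b)"

definition holomorphic_in :: "'n::finite cspace set \<Rightarrow> 'n \<Rightarrow> ('n cspace \<Rightarrow> 'n stem_val) \<Rightarrow> bool"
  where "holomorphic_in D j F \<longleftrightarrow>
    (\<forall>z K b. j \<notin> K \<longrightarrow> complex_slice F z j K b holomorphic_on {w. upd z j w \<in> D})"

lemma complex_slice_cnj:
  assumes "stem_function D F" "upd z j w \<in> D" "j \<notin> K"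
  shows "complex_slice F z j K b (cnj w) = cnj (complex_slice F z j K b w)"
  unfolding complex_slice_def conj_at_upd[symmetric] stem_function_conj_at[OF assms(1,2)]
  using assms(3) by (simp add: complex_eq_iff)

text \<open>At a point with real z_h the extension integrates the pair of coefficients at K and
  K \<union> {h} against the kernel, over a small circle with real centre in the z_h-plane; the
  other variables enter as parameters.\<close>

lemma local_division_by_Im:
  fixes F :: "'n::finite cspace \<Rightarrow> 'n stem_val"
  assumes D: "open D" and F: "stem_function D F" and hol: "holomorphic_in D h F"
    and K: "h \<notin> K" and z0: "z0 \<in> D"
  obtains U E where "open U" "z0 \<in> U" "continuous_on U E"
    "\<And>z. z \<in> U \<Longrightarrow> z \<in> D \<Longrightarrow> Im (z $ h) \<noteq> 0 \<Longrightarrow> E z = (1 / Im (z $ h)) *\<^sub>R F z $ insert h K"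
proof (cases "Im (z0 $ h) = 0")
  case False
  have *: "open (nonreal_part {h} D)" by (rule open_nonreal_part[OF D])
  show ?thesis
  proof (rule that[OF *])
    show "z0 \<in> nonreal_part {h} D" using False z0 by (simp add: nonreal_part_def)
    show "continuous_on (nonreal_part {h} D) (\<lambda>z. (1 / Im (z $ h)) *\<^sub>R F z $ insert h K)"
      by (intro continuous_intros continuous_on_subset[OF stem_function_continuous[OF F] nonreal_part_subset])
         (auto simp: nonreal_part_def)
  qed simp
next
  case True
  define c where "c = Re (z0 $ h)"
  have c: "z0 $ h = of_real c" using True by (simp add: c_def complex_eq_iff)
  obtain A where A: "\<And>i. open (A i)" "\<And>i. z0 $ i \<in> A i" "\<And>y. (\<And>i. y $ i \<in> A i) \<Longrightarrow> y \<in> D"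
    using D z0 unfolding open_vec_def by metis
  have "\<exists>e>0. cball (z0 $ i) e \<subseteq> A i" for i
    using open_contains_cball A(1,2) by blast
  then obtain e where e: "\<And>i. e i > 0" "\<And>i. cball (z0 $ i) (e i) \<subseteq> A i" by metis
  define \<rho> where "\<rho> = Min (range e)"
  have \<rho>: "\<rho> > 0" "\<And>i. \<rho> \<le> e i" using e(1) by (auto simp: \<rho>_def)
  have inD: "y \<in> D" if "\<And>i. dist (z0 $ i) (y $ i) \<le> \<rho>" for y
  proof (rule A(3))
    fix i
    have "dist (z0 $ i) (y $ i) \<le> e i" using that[of i] \<rho>(2)[of i] by linarith
    then show "y $ i \<in> A i" using e(2)[of i] by auto
  qed
  have near: "dist (z0 $ i) (z $ i) < \<rho>" if "z \<in> ball z0 \<rho>" for z i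
    using that dist_vec_nth_le[of z0 i z] by simp
  have upd_in: "upd z h w \<in> D" if "z \<in> ball z0 \<rho>" "w \<in> cball (of_real c) \<rho>" for z w
    using near[OF that(1)] that(2) by (intro inD) (auto simp: c less_imp_le)
  let ?\<zeta> = "\<lambda>t. of_real c + of_real \<rho> * cis t :: complex"
  have \<zeta>: "?\<zeta> t \<in> cball (of_real c) \<rho>" for t
    using \<rho> by (simp add: dist_norm norm_mult)
  define k where "k = (\<lambda>z::'n cspace. \<lambda>t. cauchy_kernel c \<rho> t (z $ h))"
  define f where "f = (\<lambda>z t. Re (k z t) *\<^sub>R F (upd z h (?\<zeta> t)) $ K
      - Im (k z t) *\<^sub>R F (upd z h (?\<zeta> t)) $ insert h K)"
  define E where "E = (\<lambda>z. (1 / (2 * pi)) *\<^sub>R integral (cbox 0 (2 * pi)) (f z))"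
  have zh: "z $ h \<in> ball (of_real c) \<rho>" if "z \<in> ball z0 \<rho>" for z
    using near[OF that, of h] by (simp add: c)
  have ck: "continuous_on (ball z0 \<rho> \<times> cbox 0 (2 * pi)) (\<lambda>p. k (fst p) (snd p))"
    unfolding k_def cauchy_kernel_def
    by (intro continuous_intros) (use circle_minus_nonzero[OF zh] in auto)
  have cF: "continuous_on (ball z0 \<rho> \<times> cbox 0 (2 * pi)) (\<lambda>p. F (upd (fst p) h (?\<zeta> (snd p))) $ L)" for L
    by (rule continuous_on_compose2[OF stem_function_continuous[OF F]])
       (use upd_in \<zeta> in \<open>auto intro!: continuous_intros\<close>)
  have cf: "continuous_on (ball z0 \<rho> \<times> cbox 0 (2 * pi)) (\<lambda>(z, t). f z t)"
    unfolding f_def case_prod_beta by (intro continuous_intros ck cF)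
  show ?thesis
  proof (rule that)
    show "open (ball z0 \<rho>)" "z0 \<in> ball z0 \<rho>" using \<rho> by auto
    show "continuous_on (ball z0 \<rho>) E"
      unfolding E_def by (intro continuous_intros integral_continuous_on_param cf)
    fix z assume z: "z \<in> ball z0 \<rho>" "z \<in> D" "Im (z $ h) \<noteq> 0"
    have "continuous_on (cbox 0 (2 * pi)) (f z)"
    proof -
      have "continuous_on (cbox 0 (2 * pi)) (\<lambda>t. (\<lambda>(z, t). f z t) (z, t))"
        by (rule continuous_on_compose2[OF cf]) (use z(1) in \<open>auto intro!: continuous_intros\<close>)
      then show ?thesis by simp
    qed
    then have fi: "f z integrable_on cbox 0 (2 * pi)" by (rule integrable_continuous)
    show "E z = (1 / Im (z $ h)) *\<^sub>R F z $ insert h K"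
    proof (rule euclidean_eqI)
      fix b :: quat assume "b \<in> Basis"
      have "complex_slice F z h K b holomorphic_on cball (of_real c) \<rho>"
        using hol K upd_in[OF z(1)] unfolding holomorphic_in_def
        by (blast intro: holomorphic_on_subset)
      then have "((\<lambda>t. Re (complex_slice F z h K b (?\<zeta> t) * cauchy_kernel c \<rho> t (z $ h))) has_integral
          2 * pi * (Im (complex_slice F z h K b (z $ h)) / Im (z $ h))) {0..2*pi}"
        using z(2,3) complex_slice_cnj[OF F _ K, of z "z $ h"] zh[OF z(1)]
        by (intro Im_div_Im_eq_kernel_integral) auto
      moreover have "Re (complex_slice F z h K b (?\<zeta> t) * cauchy_kernel c \<rho> t (z $ h)) = f z t \<bullet> b" for t
        by (simp add: complex_slice_def f_def k_def inner_diff_left)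
      ultimately have "integral (cbox 0 (2 * pi)) (\<lambda>t. f z t \<bullet> b) = 2 * pi * (F z $ insert h K \<bullet> b / Im (z $ h))"
        by (simp add: complex_slice_def integral_unique)
      then show "E z \<bullet> b = ((1 / Im (z $ h)) *\<^sub>R F z $ insert h K) \<bullet> b"
        using fi by (simp add: E_def)
    qed
  qed
qed

text \<open>G is the continuous extension to D of the spherical derivative of F with respect to
  z_h alone.\<close>

definition divides_by_Im :: "'n::finite cspace set \<Rightarrow> 'n \<Rightarrow> ('n cspace \<Rightarrow> 'n stem_val) \<Rightarrow> ('n cspace \<Rightarrow> 'n stem_val) \<Rightarrow> bool"
  where "divides_by_Im D h F G \<longleftrightarrow> stem_function D G \<and>
    (\<forall>z K. h \<in> K \<longrightarrow> G z $ K = 0) \<and>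
    (\<forall>z\<in>D. \<forall>K. h \<notin> K \<longrightarrow> Im (z $ h) *\<^sub>R G z $ K = F z $ insert h K)"

lemma divides_by_Im_exists:
  fixes F :: "'n::finite cspace \<Rightarrow> 'n stem_val"
  assumes D: "open D" "invariant D" and F: "stem_function D F" and hol: "holomorphic_in D h F"
  obtains G where "divides_by_Im D h F G"
proof -
  let ?S = "nonreal_part {h} D"
  have "\<exists>g. continuous_on D g \<and> (\<forall>z\<in>?S. g z = (1 / Im (z $ h)) *\<^sub>R F z $ insert h K)" if K: "h \<notin> K" for K
  proof -
    have loc: "\<exists>U E. open U \<and> z0 \<in> U \<and> continuous_on U E \<and>
        (\<forall>z\<in>U \<inter> ?S. E z = (1 / Im (z $ h)) *\<^sub>R F z $ insert h K)" if z0: "z0 \<in> D" for z0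
    proof -
      obtain U E where "open U" "z0 \<in> U" "continuous_on U E"
        "\<And>z. z \<in> U \<Longrightarrow> z \<in> D \<Longrightarrow> Im (z $ h) \<noteq> 0 \<Longrightarrow> E z = (1 / Im (z $ h)) *\<^sub>R F z $ insert h K"
        by (rule local_division_by_Im[OF D(1) F hol K z0]) blast
      then show ?thesis by (intro exI[of _ U] exI[of _ E]) (simp add: nonreal_part_def)
    qed
    obtain g where "continuous_on D g" "\<And>z. z \<in> ?S \<Longrightarrow> g z = (1 / Im (z $ h)) *\<^sub>R F z $ insert h K"
      by (rule continuous_extension_local[OF nonreal_part_subset islimpt_nonreal_part[OF D(1)] loc]) simp_all
    then show ?thesis by blast
  qed
  then obtain g where g: "\<And>K. h \<notin> K \<Longrightarrow> continuous_on D (g K)"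
    "\<And>K z. h \<notin> K \<Longrightarrow> z \<in> ?S \<Longrightarrow> g K z = (1 / Im (z $ h)) *\<^sub>R F z $ insert h K"
    by metis
  define G where "G = (\<lambda>z. \<chi> K. if h \<in> K then 0 else g K z)"
  have G: "G z $ K = (if h \<in> K then 0 else g K z)" for z K by (simp add: G_def)
  have cG: "continuous_on D (\<lambda>z. G z $ K)" for K
    unfolding G using g(1) by (cases "h \<in> K") auto
  have inv: "conj_at j z \<in> D" if "z \<in> D" for j :: 'n and z
    using D(2) that by (auto simp: invariant_def)
  have "stem_function D G"
  proof (rule stem_functionI[OF cG])
    fix z and j :: 'n and K assume z: "z \<in> D"
    let ?s = "(if j \<in> K then - 1 else 1) :: real"
    have "G (conj_at j z) $ K = ?s *\<^sub>R G z $ K"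
    proof (rule continuous_eq_on_dense[OF _ _ nonreal_part_subset closure_nonreal_part[OF D(1), of "{h}"] _ z])
      show "continuous_on D (\<lambda>z. G (conj_at j z) $ K)"
        by (rule continuous_on_compose2[OF cG]) (use inv in \<open>auto intro: continuous_on_conj_at\<close>)
      show "continuous_on D (\<lambda>z. ?s *\<^sub>R G z $ K)"
        by (intro continuous_intros cG)
      fix z assume z: "z \<in> ?S"
      then have zD: "z \<in> D" and im: "Im (z $ h) \<noteq> 0" by (auto simp: nonreal_part_def)
      from z have "conj_at j z \<in> ?S" using inv by (auto simp: nonreal_part_def)
      then show "G (conj_at j z) $ K = ?s *\<^sub>R G z $ K"
        using z im by (auto simp: G g(2) stem_function_conj_at[OF F zD])
    qed
    then show "G (conj_at j z) $ K = (if j \<in> K then - G z $ K else G z $ K)" by simp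
  qed
  moreover have "Im (z $ h) *\<^sub>R G z $ K = F z $ insert h K" if "z \<in> D" "h \<notin> K" for z K
  proof (cases "Im (z $ h) = 0")
    case True
    then show ?thesis using stem_function_real_zero[OF F that(1), of h "insert h K"] by simp
  next
    case False
    then show ?thesis using that g(2)[of K z] by (simp add: G nonreal_part_def)
  qed
  ultimately have "divides_by_Im D h F G" by (simp add: divides_by_Im_def G)
  then show ?thesis by (rule that)
qed

text \<open>Where z_h is not real, the slices of G in the variable z_j are constant multiples of
  slices of F. A point with real z_h is a limit of such points, and the slices converge locally
  uniformly because G is continuous.\<close>

lemma holomorphic_in_divides_by_Im:
  fixes F :: "'n::finite cspace \<Rightarrow> 'n stem_val"
  assumes D: "open D" and dG: "divides_by_Im D h F G"
    and hol: "holomorphic_in D j F" and jh: "j \<noteq> h"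
  shows "holomorphic_in D j G"
  unfolding holomorphic_in_def
proof (intro allI impI)
  fix z K b assume jK: "j \<notin> K"
  have G: "stem_function D G" "\<And>z K. h \<in> K \<Longrightarrow> G z $ K = 0"
    "\<And>z K. z \<in> D \<Longrightarrow> h \<notin> K \<Longrightarrow> Im (z $ h) *\<^sub>R G z $ K = F z $ insert h K"
    using dG by (auto simp: divides_by_Im_def)
  have nonreal: "complex_slice G z j K b holomorphic_on {w. upd z j w \<in> D}"
    if hK: "h \<notin> K" and im: "Im (z $ h) \<noteq> 0" for z
  proof -
    have "(\<lambda>w. of_real (1 / Im (z $ h)) * complex_slice F z j (insert h K) b w) holomorphic_on {w. upd z j w \<in> D}"
      using hol jK jh unfolding holomorphic_in_def by (intro holomorphic_intros) auto
    moreover have "of_real (1 / Im (z $ h)) * complex_slice F z j (insert h K) b w = complex_slice G z j K b w"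
      if "w \<in> {w. upd z j w \<in> D}" for w
    proof -
      have zh: "upd z j w $ h = z $ h" using jh by simp
      have 1: "F (upd z j w) $ insert h L = Im (z $ h) *\<^sub>R G (upd z j w) $ L" if "h \<notin> L" for L
        using G(3)[of "upd z j w" L] that \<open>w \<in> _\<close> unfolding zh by simp
      have 2: "insert j (insert h K) = insert h (insert j K)" by blast
      show ?thesis
        unfolding complex_slice_def 2 using 1[of K] 1[of "insert j K"] hK jh im by (simp add: complex_eq_iff)
    qed
    ultimately show ?thesis by (rule holomorphic_transform)
  qed
  show "complex_slice G z j K b holomorphic_on {w. upd z j w \<in> D}"
  proof (cases "h \<in> K")
    case True
    then have "complex_slice G z j K b = (\<lambda>_. 0)" by (simp add: complex_slice_def fun_eq_iff G(2) complex_eq_iff)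
    then show ?thesis by simp
  next
    case hK: False
    show ?thesis
    proof (cases "Im (z $ h) = 0")
      case False
      then show ?thesis by (rule nonreal[OF hK])
    next
      case True
      \<comment> \<open>approaches the real point from above in the z_h-plane\<close>
      define q where "q = (\<lambda>t::real. upd z h (z $ h + \<i> * of_real t))"
      have "complex_slice G z j K b field_differentiable at w0" if w0: "w0 \<in> {w. upd z j w \<in> D}" for w0
      proof -
        have "open ((\<lambda>p. upd (q (fst p)) j (snd p)) -` D)"
          unfolding q_def by (rule open_vimage[OF D]) (intro continuous_intros)
        moreover have "(0, w0) \<in> (\<lambda>p. upd (q (fst p)) j (snd p)) -` D"
          using w0 by (simp add: q_def)
        ultimately obtain A B where AB: "open A" "open B" "0 \<in> A" "w0 \<in> B"
          "A \<times> B \<subseteq> (\<lambda>p. upd (q (fst p)) j (snd p)) -` D"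
          by (rule open_prod_elim) auto
        obtain a where a: "a > 0" "cball 0 a \<subseteq> A" using AB open_contains_cball by blast
        obtain d where d: "d > 0" "cball w0 d \<subseteq> B" using AB open_contains_cball by blast
        have inD: "upd (q t) j w \<in> D" if "t \<in> {0..a}" "w \<in> cball w0 d" for t w
        proof -
          have "t \<in> A" "w \<in> B" using that a d by (auto simp: dist_norm)
          then show ?thesis using AB(5) by auto
        qed
        define \<psi> where "\<psi> = (\<lambda>p. complex_slice G (q (fst p)) j K b (snd p))"
        have c\<psi>: "continuous_on ({0..a} \<times> cball w0 d) \<psi>"
          unfolding \<psi>_def complex_slice_def Complex_eq
          by (intro continuous_intros continuous_on_compose2[OF stem_function_continuous[OF G(1)]])
             (use inD in \<open>auto simp: q_def intro!: continuous_intros\<close>)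
        define t where "t = (\<lambda>n. a / real (Suc n))"
        have t: "t n \<in> {0..a}" "t n \<noteq> 0" for n
          using a by (auto simp: t_def field_simps)
        have t0: "t \<longlonglongrightarrow> 0" unfolding t_def
          using tendsto_mult[OF tendsto_const[of a] LIMSEQ_inverse_real_of_nat] by (simp add: divide_inverse)
        have "(\<lambda>w. \<psi> (0, w)) holomorphic_on ball w0 d"
        proof (rule holomorphic_uniform_sequence)
          show "(\<lambda>w. \<psi> (t n, w)) holomorphic_on ball w0 d" for n
          proof -
            have "Im (q (t n) $ h) \<noteq> 0" using t(2) True by (simp add: q_def)
            from nonreal[OF hK this] show ?thesis unfolding \<psi>_def fst_conv snd_conv
              by (rule holomorphic_on_subset) (use inD[OF t(1)] in auto)
          qed
          fix x assume "x \<in> ball w0 d"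
          then obtain e where e: "e > 0" "cball x e \<subseteq> ball w0 d"
            using open_contains_cball open_ball by blast
          have "uniform_limit (cball w0 d) (\<lambda>n w. \<psi> (t n, w)) (\<lambda>w. \<psi> (0, w)) sequentially"
          proof (rule uniform_limitI)
            fix \<epsilon> :: real assume \<epsilon>: "\<epsilon> > 0"
            have "0 \<in> {0..a}" "\<epsilon> / 2 > 0" using a \<epsilon> by auto
            from continuous_on_prod_compactE[OF c\<psi> compact_cball this]
            obtain X0 where X0: "0 \<in> X0" "open X0"
              "\<forall>x\<in>X0 \<inter> {0..a}. \<forall>w\<in>cball w0 d. dist (\<psi> (x, w)) (\<psi> (0, w)) \<le> \<epsilon> / 2" .
            have "eventually (\<lambda>n. t n \<in> X0) sequentially"
              using topological_tendstoD[OF t0 X0(2,1)] .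
            then show "\<forall>\<^sub>F n in sequentially. \<forall>w\<in>cball w0 d. dist (\<psi> (t n, w)) (\<psi> (0, w)) < \<epsilon>"
            proof eventually_elim
              case (elim n)
              have "dist (\<psi> (t n, w)) (\<psi> (0, w)) \<le> \<epsilon> / 2" if "w \<in> cball w0 d" for w
                using X0(3) elim t(1)[of n] that by blast
              then show ?case using \<epsilon> by fastforce
            qed
          qed
          then have "uniform_limit (cball x e) (\<lambda>n w. \<psi> (t n, w)) (\<lambda>w. \<psi> (0, w)) sequentially"
            by (rule uniform_limit_on_subset) (use e in auto)
          with e show "\<exists>d'>0. cball x d' \<subseteq> ball w0 d \<and>
              uniform_limit (cball x d') (\<lambda>n w. \<psi> (t n, w)) (\<lambda>w. \<psi> (0, w)) sequentially"
            by blast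
        qed simp
        moreover have "(\<lambda>w. \<psi> (0, w)) = complex_slice G z j K b" by (simp add: \<psi>_def q_def)
        ultimately have "complex_slice G z j K b holomorphic_on ball w0 d" by simp
        then show ?thesis using d(1) by (auto simp: holomorphic_on_open field_differentiable_def)
      qed
      then show ?thesis
        unfolding holomorphic_on_def by (blast intro: field_differentiable_at_within)
    qed
  qed
qed

text \<open>The coefficients F_K + (\<alpha>_h - a) F_{K \<union> {h}} / \<beta>_h. They are
  even in z_h; the value 0 at the sets containing h, where oddness is required, completes them to
  a stem function.\<close>

definition mean_combination ::
    "real \<Rightarrow> 'n::finite \<Rightarrow> ('n cspace \<Rightarrow> 'n stem_val) \<Rightarrow> ('n cspace \<Rightarrow> 'n stem_val) \<Rightarrow> 'n cspace \<Rightarrow> 'n stem_val"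
  where "mean_combination a h F G =
    (\<lambda>z. \<chi> K. if h \<in> K then 0 else F z $ K + (Re (z $ h) - a) *\<^sub>R G z $ K)"

lemma mean_combination_nth:
  "mean_combination a h F G z $ K = (if h \<in> K then 0 else F z $ K + (Re (z $ h) - a) *\<^sub>R G z $ K)"
  by (simp add: mean_combination_def)

lemma stem_function_mean_combination:
  assumes "stem_function D F" "stem_function D G"
  shows "stem_function D (mean_combination a h F G)"
proof (rule stem_functionI)
  show "continuous_on D (\<lambda>z. mean_combination a h F G z $ K)" for K
    unfolding mean_combination_nth
    by (cases "h \<in> K") (auto intro!: continuous_intros stem_function_continuous assms)
  fix z j K assume "z \<in> D"
  then show "mean_combination a h F G (conj_at j z) $ K
      = (if j \<in> K then - mean_combination a h F G z $ K else mean_combination a h F G z $ K)"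
    by (auto simp: mean_combination_nth stem_function_conj_at[OF assms(1)] stem_function_conj_at[OF assms(2)])
qed

lemma holomorphic_in_mean_combination:
  assumes F: "holomorphic_in D j F" and G: "holomorphic_in D j G" and jh: "j \<noteq> h"
  shows "holomorphic_in D j (mean_combination a h F G)"
  unfolding holomorphic_in_def
proof (intro allI impI)
  fix z K b assume jK: "j \<notin> K"
  have "complex_slice (mean_combination a h F G) z j K b =
      (if h \<in> K then (\<lambda>_. 0) else (\<lambda>w. complex_slice F z j K b w + of_real (Re (z $ h) - a) * complex_slice G z j K b w))"
    using jh by (auto simp: complex_slice_def fun_eq_iff mean_combination_nth complex_eq_iff inner_add_left)
  moreover have "(\<lambda>w. complex_slice F z j K b w + of_real (Re (z $ h) - a) * complex_slice G z j K b w)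
      holomorphic_on {w. upd z j w \<in> D}"
    using F G jK unfolding holomorphic_in_def by (intro holomorphic_intros) auto
  ultimately show "complex_slice (mean_combination a h F G) z j K b holomorphic_on {w. upd z j w \<in> D}"
    by simp
qed

text \<open>On the circle, r sin \<theta> times G_K is the coefficient of F at K \<union> {h}.
  After multiplication by sin^2 \<theta> the integrand therefore becomes sin \<theta> Im (w
  \<phi>(w)), where \<phi> is the slice of F on the disc and w = exp (i \<theta>); this form is
  also valid for r = 0.\<close>

lemma mean_value_one_variable:
  fixes F :: "'n::finite cspace \<Rightarrow> 'n stem_val"
  assumes D: "open D" and F: "stem_function D F" and hol: "holomorphic_in D h F"
    and dG: "divides_by_Im D h F G" and K: "h \<notin> K"
    and disc: "\<And>w. norm (w - of_real a) \<le> r \<Longrightarrow> upd z h w \<in> D" and r: "r \<ge> 0"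
  shows "(LINT l|sphere_prob. mean_combination a h F G (upd z h (of_real a + of_real r * upper l)) $ K)
    = F (upd z h (of_real a)) $ K"
proof -
  let ?A = "mean_combination a h F G"
  let ?p = "\<lambda>w. upd z h (of_real a + of_real r * w)"
  have pD: "?p w \<in> D" if "w \<in> cball 0 1" for w
    using that r by (intro disc) (simp add: norm_mult mult_left_le)
  have G: "stem_function D G" "\<And>z K. z \<in> D \<Longrightarrow> h \<notin> K \<Longrightarrow> Im (z $ h) *\<^sub>R G z $ K = F z $ insert h K"
    using dG by (auto simp: divides_by_Im_def)
  let ?I = "LINT l|sphere_prob. ?A (?p (upper l)) $ K"
  have "continuous_on (cball 0 1) (\<lambda>w. ?A (?p w) $ K)"
    by (rule continuous_on_compose2[OF stem_function_continuous[OF stem_function_mean_combination[OF F G(1)]]])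
       (use pD in \<open>auto intro!: continuous_intros\<close>)
  from has_integral_sphere_prob_upper[OF this]
  have I: "((\<lambda>\<theta>. (sin \<theta>)\<^sup>2 *\<^sub>R ?A (?p (cis \<theta>)) $ K) has_integral (pi / 2) *\<^sub>R ?I) {0..pi}" .
  show ?thesis
  proof (rule euclidean_eqI)
    fix b :: quat assume "b \<in> Basis"
    let ?\<Phi> = "\<lambda>w. complex_slice F z h K b (of_real a + of_real r * w)"
    let ?S = "{w. ?p w \<in> D}"
    have "open ?S"
    proof -
      have "open (?p -` D)" by (rule open_vimage[OF D]) (intro continuous_intros)
      then show ?thesis by (simp add: vimage_def)
    qed
    moreover have "cball 0 1 \<subseteq> ?S" using pD by auto
    moreover have "?\<Phi> holomorphic_on ?S"
    proof -
      have "complex_slice F z h K b holomorphic_on {w. upd z h w \<in> D}"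
        using hol K unfolding holomorphic_in_def by blast
      then have "complex_slice F z h K b \<circ> (\<lambda>w. of_real a + of_real r * w) holomorphic_on ?S"
        by (rule holomorphic_on_compose_gen[rotated]) (auto intro!: holomorphic_intros)
      then show ?thesis by (simp add: comp_def)
    qed
    moreover have "?\<Phi> (cnj w) = cnj (?\<Phi> w)" if "norm w = 1" for w
      using complex_slice_cnj[OF F pD K, of w b] that by simp
    ultimately have "((\<lambda>\<theta>. sin \<theta> * Im (cis \<theta> * ?\<Phi> (cis \<theta>))) has_integral pi / 2 * Re (?\<Phi> 0)) {0..pi}"
      by (rule disc_mean_value_sin)
    moreover have "sin \<theta> * Im (cis \<theta> * ?\<Phi> (cis \<theta>)) = ((sin \<theta>)\<^sup>2 *\<^sub>R ?A (?p (cis \<theta>)) $ K) \<bullet> b" for \<theta>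
    proof -
      have "F (?p (cis \<theta>)) $ insert h K = (r * sin \<theta>) *\<^sub>R G (?p (cis \<theta>)) $ K"
        using G(2)[OF pD K, of "cis \<theta>"] by simp
      then have "Im (cis \<theta> * ?\<Phi> (cis \<theta>)) = (sin \<theta> *\<^sub>R ?A (?p (cis \<theta>)) $ K) \<bullet> b"
        using K by (simp add: complex_slice_def mean_combination_nth inner_add_left algebra_simps)
      then show ?thesis by (simp add: power2_eq_square)
    qed
    ultimately have "((\<lambda>\<theta>. ((sin \<theta>)\<^sup>2 *\<^sub>R ?A (?p (cis \<theta>)) $ K) \<bullet> b) has_integral
        pi / 2 * (F (upd z h (of_real a)) $ K \<bullet> b)) {0..pi}"
      by (simp add: complex_slice_def)
    moreover have "((\<lambda>\<theta>. ((sin \<theta>)\<^sup>2 *\<^sub>R ?A (?p (cis \<theta>)) $ K) \<bullet> b) has_integral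
        ((pi / 2) *\<^sub>R ?I) \<bullet> b) {0..pi}"
      using has_integral_linear[OF I bounded_linear_inner_left[of b]] by (simp add: comp_def)
    ultimately have "pi / 2 * (F (upd z h (of_real a)) $ K \<bullet> b) = ((pi / 2) *\<^sub>R ?I) \<bullet> b"
      by (rule has_integral_unique)
    then show "?I \<bullet> b = F (upd z h (of_real a)) $ K \<bullet> b" by simp
  qed
qed

section \<open>Iteration over several variables\<close>

text \<open>The set R keeps track of the variables in which the quotient is still holomorphic,
  as the next division requires.\<close>

lemma iterated_division:
  fixes F :: "'n::finite cspace \<Rightarrow> 'n stem_val"
  assumes D: "open D" "invariant D"
    and "finite Q" "stem_function D F" "\<forall>j\<in>Q \<union> R. holomorphic_in D j F" "Q \<inter> R = {}"
  shows "\<exists>G. stem_function D G \<and> (\<forall>j\<in>R. holomorphic_in D j G) \<and>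
    (\<forall>z\<in>D. \<forall>K. K \<inter> Q = {} \<longrightarrow> (\<Prod>h\<in>Q. Im (z $ h)) *\<^sub>R G z $ K = F z $ (K \<union> Q))"
  using assms(3-)
proof (induction Q arbitrary: R rule: finite_induct)
  case empty
  then show ?case by (intro exI[of _ F]) auto
next
  case (insert h Q)
  have "\<exists>G. stem_function D G \<and> (\<forall>j\<in>insert h R. holomorphic_in D j G) \<and>
    (\<forall>z\<in>D. \<forall>K. K \<inter> Q = {} \<longrightarrow> (\<Prod>h\<in>Q. Im (z $ h)) *\<^sub>R G z $ K = F z $ (K \<union> Q))"
    by (rule insert.IH) (use insert in auto)
  then obtain G where G: "stem_function D G" "\<And>j. j \<in> insert h R \<Longrightarrow> holomorphic_in D j G"
    "\<And>z K. z \<in> D \<Longrightarrow> K \<inter> Q = {} \<Longrightarrow> (\<Prod>h\<in>Q. Im (z $ h)) *\<^sub>R G z $ K = F z $ (K \<union> Q)"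
    by blast
  obtain G' where G': "divides_by_Im D h G G'"
    using divides_by_Im_exists[OF D G(1) G(2)] by blast
  show ?case
  proof (intro exI conjI ballI allI impI)
    show "stem_function D G'" using G' by (simp add: divides_by_Im_def)
    show "holomorphic_in D j G'" if "j \<in> R" for j
      using that insert.prems by (intro holomorphic_in_divides_by_Im[OF D(1) G'] G(2)) auto
    fix z K assume z: "z \<in> D" and K: "K \<inter> insert h Q = {}"
    have "(\<Prod>h\<in>insert h Q. Im (z $ h)) *\<^sub>R G' z $ K
        = (\<Prod>h\<in>Q. Im (z $ h)) *\<^sub>R (Im (z $ h) *\<^sub>R G' z $ K)"
      using insert.hyps by (simp add: mult.commute)
    also have "Im (z $ h) *\<^sub>R G' z $ K = G z $ insert h K"
      using G' z K by (auto simp: divides_by_Im_def)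
    also have "(\<Prod>h\<in>Q. Im (z $ h)) *\<^sub>R G z $ insert h K = F z $ (insert h K \<union> Q)"
      using z K insert.hyps by (intro G(3)) auto
    finally show "(\<Prod>h\<in>insert h Q. Im (z $ h)) *\<^sub>R G' z $ K = F z $ (K \<union> insert h Q)"
      by simp
  qed
qed

lemma borel_measurable_vec_lambda:
  fixes f :: "'n::finite \<Rightarrow> 'a \<Rightarrow> 'b::euclidean_space"
  assumes "\<And>i. f i \<in> borel_measurable M"
  shows "(\<lambda>x. \<chi> i. f i x) \<in> borel_measurable M"
proof (subst borel_measurable_euclidean_space, intro ballI)
  fix b :: "'b ^ 'n" assume "b \<in> Basis"
  then obtain i c where "b = axis i c" by (auto simp: Basis_vec_def)
  then show "(\<lambda>x. (\<chi> i. f i x) \<bullet> b) \<in> borel_measurable M"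
    using assms[of i] by (simp add: inner_axis)
qed

lemma integrable_continuous_on_compact_image:
  fixes f :: "'a::euclidean_space \<Rightarrow> 'b::euclidean_space"
  assumes M: "finite_measure M" and p: "p \<in> borel_measurable M" "\<And>l. l \<in> space M \<Longrightarrow> p l \<in> C"
    and C: "compact C" "continuous_on C f"
  shows "integrable M (\<lambda>l. f (p l))"
proof -
  have m: "(\<lambda>x. indicator C x *\<^sub>R f x) \<in> borel_measurable borel"
    using C by (intro borel_measurable_continuous_on_indicator) (auto intro: borel_compact)
  have "bounded (f ` C)" using C by (intro compact_imp_bounded compact_continuous_image)
  then obtain B where B: "\<forall>x\<in>f ` C. norm x \<le> B" unfolding bounded_iff by blast
  have "integrable M (\<lambda>l. indicator C (p l) *\<^sub>R f (p l))"
  proof (rule finite_measure.integrable_const_bound[OF M, of _ B])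
    show "AE l in M. norm (indicator C (p l) *\<^sub>R f (p l)) \<le> B"
      using B p(2) by (intro AE_I2) auto
    show "(\<lambda>l. indicator C (p l) *\<^sub>R f (p l)) \<in> borel_measurable M"
      using measurable_compose[OF p(1) m] .
  qed
  then show ?thesis
    by (rule Bochner_Integration.integrable_cong[THEN iffD1, rotated -1]) (use p(2) in auto)
qed

definition on_spheres ::
    "('n \<Rightarrow> real) \<Rightarrow> ('n \<Rightarrow> real) \<Rightarrow> 'n set \<Rightarrow> 'n::finite cspace \<Rightarrow> ('n \<Rightarrow> quat) \<Rightarrow> 'n cspace"
  where "on_spheres a r H z l =
    (\<chi> i. if i \<in> H then of_real (a i) + of_real (r i) * upper (l i) else z $ i)"

text \<open>The coordinates outside H are frozen at those of z.\<close>

definition polydisc :: "('n \<Rightarrow> real) \<Rightarrow> ('n \<Rightarrow> real) \<Rightarrow> 'n set \<Rightarrow> 'n::finite cspace \<Rightarrow> 'n cspace set"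
  where "polydisc a r H z =
    {z'. \<forall>i. z' $ i \<in> (if i \<in> H then cball (of_real (a i)) (r i) else {z $ i})}"

definition centre :: "('n \<Rightarrow> real) \<Rightarrow> 'n set \<Rightarrow> 'n::finite cspace \<Rightarrow> 'n cspace"
  where "centre a H z = (\<chi> i. if i \<in> H then of_real (a i) else z $ i)"

lemma compact_vec_product:
  fixes A :: "'n::finite \<Rightarrow> 'b::euclidean_space set"
  assumes "\<And>i. compact (A i)"
  shows "compact {x. \<forall>i. x $ i \<in> A i}"
proof -
  have "closed {x. \<forall>i. x $ i \<in> A i}"
  proof -
    have "{x. \<forall>i. x $ i \<in> A i} = (\<Inter>i. (\<lambda>x. x $ i) -` A i)" by auto
    moreover have "closed ((\<lambda>x. x $ i) -` A i)" for i
      using assms by (intro closed_vimage) (auto intro: compact_imp_closed continuous_intros)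
    ultimately show ?thesis by auto
  qed
  moreover have "bounded {x. \<forall>i. x $ i \<in> A i}"
  proof -
    have "\<exists>B. \<forall>x\<in>A i. norm x \<le> B" for i
      using compact_imp_bounded[OF assms] unfolding bounded_iff by blast
    then obtain B where B: "\<And>i x. x \<in> A i \<Longrightarrow> norm x \<le> B i" by metis
    have "norm x \<le> (\<Sum>i\<in>UNIV. B i)" if "\<forall>i. x $ i \<in> A i" for x
    proof -
      have "norm x \<le> (\<Sum>i\<in>UNIV. norm (x $ i))"
        unfolding norm_vec_def by (rule L2_set_le_sum) simp
      also have "\<dots> \<le> (\<Sum>i\<in>UNIV. B i)" using that B by (intro sum_mono) auto
      finally show ?thesis .
    qed
    then show ?thesis unfolding bounded_iff by blast
  qed
  ultimately show ?thesis by (simp add: compact_eq_bounded_closed)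
qed

lemma compact_polydisc: "compact (polydisc a r H z)"
  unfolding polydisc_def by (rule compact_vec_product) simp

lemma on_spheres_in_polydisc:
  assumes "\<And>i. r i \<ge> 0" "l \<in> space (PiM H (\<lambda>_. sphere_prob))"
  shows "on_spheres a r H z l \<in> polydisc a r H z"
proof -
  have "norm (l i) = 1" if "i \<in> H" for i
    using assms(2) that by (auto simp: space_PiM PiE_iff space_sphere_prob)
  then show ?thesis using assms(1)
    by (auto simp: polydisc_def on_spheres_def dist_norm norm_mult norm_upper)
qed

lemma measurable_sphere_component:
  assumes "i \<in> H" "f \<in> borel_measurable borel"
  shows "(\<lambda>l. f (l i)) \<in> borel_measurable (PiM H (\<lambda>_. sphere_prob))"
  using measurable_compose[OF measurable_component_singleton[OF assms(1)] measurable_sphere_prob[OF assms(2)]] .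

lemma measurable_on_spheres:
  "on_spheres a r H z \<in> borel_measurable (PiM H (\<lambda>_. sphere_prob))"
  unfolding on_spheres_def
proof (rule borel_measurable_vec_lambda)
  show "(\<lambda>l. if i \<in> H then of_real (a i) + of_real (r i) * upper (l i) else z $ i)
      \<in> borel_measurable (PiM H (\<lambda>_. sphere_prob))" for i
    by (cases "i \<in> H") (auto intro!: borel_measurable_add borel_measurable_times measurable_sphere_component)
qed

lemma prob_space_PiM_sphere: "prob_space (PiM H (\<lambda>_. sphere_prob))"
  by (rule prob_space_PiM) (rule prob_space_sphere_prob)

lemma integrable_on_spheres:
  fixes f :: "'n::finite cspace \<Rightarrow> quat"
  assumes "continuous_on D f" "polydisc a r H z \<subseteq> D" "\<And>i. r i \<ge> 0"
  shows "integrable (PiM H (\<lambda>_. sphere_prob)) (\<lambda>l. f (on_spheres a r H z l))"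
  using assms prob_space_PiM_sphere
  by (intro integrable_continuous_on_compact_image[OF _ measurable_on_spheres _ compact_polydisc])
     (auto intro: on_spheres_in_polydisc continuous_on_subset prob_space.finite_measure)

lemma sum_Pow_insert:
  assumes "finite H" "h \<notin> H"
  shows "sum f (Pow (insert h H)) = (\<Sum>Q\<in>Pow H. f Q + f (insert h Q))"
proof -
  have "sum f (Pow (insert h H)) = sum f (Pow H) + sum f (insert h ` Pow H)"
    unfolding Pow_insert using assms by (intro sum.union_disjoint) auto
  also have "sum f (insert h ` Pow H) = (\<Sum>Q\<in>Pow H. f (insert h Q))"
    using assms by (subst sum.reindex) (auto simp: inj_on_def)
  finally show ?thesis by (simp add: sum.distrib)
qed

text \<open>Each step applies mean_combination in one more variable, which is integrated
  innermost: the mean value formula in that variable moves it to the centre for any fixed values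
  of the others, and the induction hypothesis applies to the point obtained.\<close>

lemma iterated_mean_value:
  fixes F :: "'n::finite cspace \<Rightarrow> 'n stem_val" and a r :: "'n \<Rightarrow> real"
  assumes D: "open D" "invariant D" and r: "\<And>i. r i \<ge> 0"
    and "finite H" "stem_function D F" "\<forall>j\<in>H \<union> R. holomorphic_in D j F" "H \<inter> R = {}"
  shows "\<exists>A. stem_function D A \<and> (\<forall>j\<in>R. holomorphic_in D j A) \<and>
    (\<forall>z\<in>nonreal_part H D. \<forall>K. K \<inter> H = {} \<longrightarrow> A z $ K =
      (\<Sum>Q\<in>Pow H. (\<Prod>h\<in>Q. (Re (z $ h) - a h) / Im (z $ h)) *\<^sub>R F z $ (K \<union> Q))) \<and>
    (\<forall>z K. K \<inter> H = {} \<longrightarrow> polydisc a r H z \<subseteq> D \<longrightarrow>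
      (LINT l|PiM H (\<lambda>_. sphere_prob). A (on_spheres a r H z l) $ K) = F (centre a H z) $ K)"
  using assms(4-)
proof (induction H arbitrary: R rule: finite_induct)
  case empty
  interpret prob_space "PiM {} (\<lambda>_::'n. sphere_prob)" by (rule prob_space_PiM_sphere)
  have "on_spheres a r {} z l = z" "centre a {} z = z" for z l
    by (simp_all add: on_spheres_def centre_def vec_eq_iff)
  then show ?case using empty by (intro exI[of _ F]) (auto simp: prob_space)
next
  case (insert h H)
  have "\<exists>A. stem_function D A \<and> (\<forall>j\<in>insert h R. holomorphic_in D j A) \<and>
    (\<forall>z\<in>nonreal_part H D. \<forall>K. K \<inter> H = {} \<longrightarrow> A z $ K =
      (\<Sum>Q\<in>Pow H. (\<Prod>h\<in>Q. (Re (z $ h) - a h) / Im (z $ h)) *\<^sub>R F z $ (K \<union> Q))) \<and>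
    (\<forall>z K. K \<inter> H = {} \<longrightarrow> polydisc a r H z \<subseteq> D \<longrightarrow>
      (LINT l|PiM H (\<lambda>_. sphere_prob). A (on_spheres a r H z l) $ K) = F (centre a H z) $ K)"
    by (rule insert.IH) (use insert in auto)
  then obtain A where A: "stem_function D A" and "\<forall>j\<in>insert h R. holomorphic_in D j A"
    and "\<forall>z\<in>nonreal_part H D. \<forall>K. K \<inter> H = {} \<longrightarrow> A z $ K =
      (\<Sum>Q\<in>Pow H. (\<Prod>h\<in>Q. (Re (z $ h) - a h) / Im (z $ h)) *\<^sub>R F z $ (K \<union> Q))"
    and "\<forall>z K. K \<inter> H = {} \<longrightarrow> polydisc a r H z \<subseteq> D \<longrightarrow>
      (LINT l|PiM H (\<lambda>_. sphere_prob). A (on_spheres a r H z l) $ K) = F (centre a H z) $ K"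
    by (elim exE conjE) (rule that)
  note A = A this(2-)[rule_format]
  obtain G where dG: "divides_by_Im D h A G"
    using divides_by_Im_exists[OF D A(1) A(2)] by blast
  then have G: "stem_function D G" "\<And>z K. z \<in> D \<Longrightarrow> h \<notin> K \<Longrightarrow> Im (z $ h) *\<^sub>R G z $ K = A z $ insert h K"
    by (auto simp: divides_by_Im_def)
  let ?A = "mean_combination (a h) h A G"
  have sA: "stem_function D ?A" by (rule stem_function_mean_combination[OF A(1) G(1)])
  show ?case
  proof (intro exI conjI ballI allI impI)
    show "stem_function D ?A" by (rule sA)
    show "holomorphic_in D j ?A" if "j \<in> R" for j
      using that insert.prems
      by (intro holomorphic_in_mean_combination holomorphic_in_divides_by_Im[OF D(1) dG] A(2)) auto
  next
    fix z K assume z: "z \<in> nonreal_part (insert h H) D" and K: "K \<inter> insert h H = {}"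
    let ?c = "\<lambda>Q. \<Prod>h\<in>Q. (Re (z $ h) - a h) / Im (z $ h)"
    have z': "z \<in> D" "z \<in> nonreal_part H D" "Im (z $ h) \<noteq> 0" using z by (auto simp: nonreal_part_def)
    have "G z $ K = (1 / Im (z $ h)) *\<^sub>R (Im (z $ h) *\<^sub>R G z $ K)" using z' by simp
    also have "\<dots> = (1 / Im (z $ h)) *\<^sub>R A z $ insert h K" using G(2)[OF z'(1), of K] K by simp
    finally have "?A z $ K = A z $ K + ((Re (z $ h) - a h) / Im (z $ h)) *\<^sub>R A z $ insert h K"
      using K by (simp add: mean_combination_nth)
    also have "\<dots> = (\<Sum>Q\<in>Pow H. ?c Q *\<^sub>R F z $ (K \<union> Q)) +
        ((Re (z $ h) - a h) / Im (z $ h)) *\<^sub>R (\<Sum>Q\<in>Pow H. ?c Q *\<^sub>R F z $ (insert h K \<union> Q))"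
      using K insert.hyps by (subst (1 2) A(3)[OF z'(2)]) auto
    also have "\<dots> = (\<Sum>Q\<in>Pow H. ?c Q *\<^sub>R F z $ (K \<union> Q) + ?c (insert h Q) *\<^sub>R F z $ (K \<union> insert h Q))"
    proof -
      have "?c (insert h Q) = (Re (z $ h) - a h) / Im (z $ h) * ?c Q" if "Q \<in> Pow H" for Q
        using that insert.hyps by (intro prod.insert) (auto intro: finite_subset)
      then show ?thesis
        unfolding scaleR_sum_right sum.distrib by (intro arg_cong2[where f = "(+)"] sum.cong refl) simp
    qed
    also have "\<dots> = (\<Sum>Q\<in>Pow (insert h H). ?c Q *\<^sub>R F z $ (K \<union> Q))"
      using insert.hyps by (rule sum_Pow_insert[symmetric])
    finally show "?A z $ K = (\<Sum>Q\<in>Pow (insert h H). ?c Q *\<^sub>R F z $ (K \<union> Q))" .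
  next
    fix z K assume K: "K \<inter> insert h H = {}" and P: "polydisc a r (insert h H) z \<subseteq> D"
    interpret product_sigma_finite "\<lambda>_::'n. sphere_prob"
      unfolding product_sigma_finite_def using prob_space_imp_sigma_finite[OF prob_space_sphere_prob] by blast
    let ?M = "PiM H (\<lambda>_. sphere_prob)"
    have "(LINT l|PiM (insert h H) (\<lambda>_. sphere_prob). ?A (on_spheres a r (insert h H) z l) $ K)
       = (LINT x|?M. LINT y|sphere_prob. ?A (on_spheres a r (insert h H) z (x(h := y))) $ K)"
      by (intro product_integral_insert integrable_on_spheres[OF stem_function_continuous[OF sA] P r] insert.hyps)
    also have "\<dots> = (LINT x|?M. A (on_spheres a r H (upd z h (of_real (a h))) x) $ K)"
    proof (intro Bochner_Integration.integral_cong refl)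
      fix x assume x: "x \<in> space ?M"
      have *: "on_spheres a r (insert h H) z (x(h := y))
          = upd (on_spheres a r H z x) h (of_real (a h) + of_real (r h) * upper y)" for y
        using insert.hyps(2) by (auto simp: vec_eq_iff on_spheres_def)
      have "upd (on_spheres a r H z x) h w \<in> D" if "norm (w - of_real (a h)) \<le> r h" for w
      proof -
        have "upd (on_spheres a r H z x) h w \<in> polydisc a r (insert h H) z"
          unfolding polydisc_def mem_Collect_eq
        proof
          fix i
          have "on_spheres a r H z x \<in> polydisc a r H z" by (rule on_spheres_in_polydisc[OF r x])
          then have "on_spheres a r H z x $ i \<in> (if i \<in> H then cball (of_real (a i)) (r i) else {z $ i})"
            unfolding polydisc_def by blast
          then show "upd (on_spheres a r H z x) h w $ i
              \<in> (if i \<in> insert h H then cball (of_real (a i)) (r i) else {z $ i})"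
            using that by (auto simp: dist_norm norm_minus_commute)
        qed
        then show ?thesis using P by blast
      qed
      then have "(LINT y|sphere_prob. ?A (on_spheres a r (insert h H) z (x(h := y))) $ K)
          = A (upd (on_spheres a r H z x) h (of_real (a h))) $ K"
        unfolding * using K r by (intro mean_value_one_variable[OF D(1) A(1) A(2) dG]) auto
      also have "upd (on_spheres a r H z x) h (of_real (a h)) = on_spheres a r H (upd z h (of_real (a h))) x"
        using insert.hyps(2) by (auto simp: vec_eq_iff on_spheres_def)
      finally show "(LINT y|sphere_prob. ?A (on_spheres a r (insert h H) z (x(h := y))) $ K)
          = A (on_spheres a r H (upd z h (of_real (a h))) x) $ K" .
    qed
    also have "\<dots> = F (centre a H (upd z h (of_real (a h)))) $ K"
    proof (rule A(4))
      show "polydisc a r H (upd z h (of_real (a h))) \<subseteq> D"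
      proof (rule subset_trans[OF _ P], rule subsetI)
        fix z' assume "z' \<in> polydisc a r H (upd z h (of_real (a h)))"
        then show "z' \<in> polydisc a r (insert h H) z"
          using insert.hyps(2) r[of h] unfolding polydisc_def by (auto split: if_splits)
      qed
    qed (use K in auto)
    also have "centre a H (upd z h (of_real (a h))) = centre a (insert h H) z"
      by (auto simp: vec_eq_iff centre_def)
    finally show "(LINT l|PiM (insert h H) (\<lambda>_. sphere_prob). ?A (on_spheres a r (insert h H) z l) $ K)
       = F (centre a (insert h H) z) $ K" .
  qed
qed

section \<open>Slice functions and their stem functions\<close>

lemma imag_units_iff: "J \<in> imag_units \<longleftrightarrow> qre J = 0 \<and> norm J = 1"
proof
  assume "J \<in> imag_units"
  then have J: "J * J = - 1" by (simp add: imag_units_def power2_eq_square)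
  have n: "norm J = 1"
  proof -
    have "norm (J * J) = 1" unfolding J by simp
    then have "(norm J)\<^sup>2 = 1" by (simp only: norm_mult power2_eq_square)
    then have "norm J = 1 \<or> norm J = - 1" by (simp only: power2_eq_1_iff)
    then show ?thesis using norm_ge_zero[of J] by linarith
  qed
  have re: "qre J * qre J - qi J * qi J - qj J * qj J - qk J * qk J = - 1"
    using J by (simp add: quat_eq_iff)
  have "qre J * qre J + qi J * qi J + qj J * qj J + qk J * qk J = 1"
    using n by (simp add: norm_quat_eq power2_eq_square)
  with re have "qre J * qre J = 0" by linarith
  with n show "qre J = 0 \<and> norm J = 1" by simp
next
  assume J: "qre J = 0 \<and> norm J = 1"
  then have "qi J * qi J + qj J * qj J + qk J * qk J = 1"
    by (auto simp: norm_quat_eq power2_eq_square)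
  with J show "J \<in> imag_units" by (simp add: imag_units_def power2_eq_square quat_eq_iff)
qed

text \<open>The decomposition is unique up to a simultaneous change of sign of the unit and its
  coefficient, except that the unit is arbitrary when the quaternion is real.\<close>

lemma imag_unit_decomposition_unique:
  assumes J: "J \<in> imag_units" "J' \<in> imag_units"
    and eq: "of_real \<alpha> + J * of_real \<beta> = of_real \<alpha>' + J' * of_real \<beta>'"
  shows "\<alpha>' = \<alpha>" "(\<beta>' = \<beta> \<and> (\<beta> \<noteq> 0 \<longrightarrow> J' = J)) \<or> (\<beta>' = - \<beta> \<and> \<beta> \<noteq> 0 \<and> J' = - J)"
proof -
  have "qre (of_real \<alpha> + J * of_real \<beta>) = qre (of_real \<alpha>' + J' * of_real \<beta>')" by (simp only: eq)
  then show a: "\<alpha>' = \<alpha>" using J by (simp add: imag_units_iff of_real_def)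
  with eq have b: "\<beta> *\<^sub>R J = \<beta>' *\<^sub>R J'" by (simp add: of_real_def)
  then have "norm (\<beta> *\<^sub>R J) = norm (\<beta>' *\<^sub>R J')" by simp
  then have "\<bar>\<beta>\<bar> = \<bar>\<beta>'\<bar>" using J by (simp add: imag_units_iff)
  then consider "\<beta>' = \<beta>" | "\<beta>' = - \<beta>" "\<beta> \<noteq> 0"
    by (cases "\<beta>' = \<beta>") (auto simp: abs_if split: if_splits)
  then show "(\<beta>' = \<beta> \<and> (\<beta> \<noteq> 0 \<longrightarrow> J' = J)) \<or> (\<beta>' = - \<beta> \<and> \<beta> \<noteq> 0 \<and> J' = - J)"
  proof cases
    case 1 then show ?thesis using b by auto
  next
    case 2
    then have "\<beta> *\<^sub>R (J + J') = 0" using b by (simp add: algebra_simps)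
    with 2 have "J + J' = 0" by simp
    with 2 show ?thesis by (simp add: eq_neg_iff_add_eq_0 add.commute)
  qed
qed

lemma prod_list_scaleR:
  fixes q :: "'a \<Rightarrow> quat"
  shows "prod_list (map (\<lambda>h. c h *\<^sub>R q h) xs) = prod_list (map c xs) *\<^sub>R prod_list (map q xs)"
  by (induction xs) (simp_all add: mult.commute)

lemma oprod_scaleR:
  fixes q :: "'n::{finite,linorder} \<Rightarrow> quat"
  shows "oprod (\<lambda>h. c h *\<^sub>R q h) K = (\<Prod>k\<in>K. c k) *\<^sub>R oprod q K"
  unfolding oprod_def prod_list_scaleR by (simp add: prod.distinct_set_conv_list[symmetric])

lemma oprod_cong:
  fixes q :: "'n::{finite,linorder} \<Rightarrow> quat"
  assumes "\<And>k. k \<in> K \<Longrightarrow> q k = q' k"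
  shows "oprod q K = oprod q' K"
  unfolding oprod_def using assms by (intro arg_cong[where f = prod_list] map_cong) auto

lemma oprod_one [simp]: "oprod (\<lambda>_. 1) K = (1 :: quat)"
proof -
  have "prod_list (map (\<lambda>_. 1 :: quat) xs) = 1" for xs :: "'a list" by (induction xs) auto
  then show ?thesis by (simp add: oprod_def)
qed

lemma oprod_of_real:
  fixes c :: "'n::{finite,linorder} \<Rightarrow> real"
  shows "oprod (\<lambda>h. of_real (c h)) K = of_real (\<Prod>k\<in>K. c k)"
  using oprod_scaleR[of c "\<lambda>_. 1" K] by (simp add: of_real_def)

lemma norm_oprod_le_1:
  fixes q :: "'n::{finite,linorder} \<Rightarrow> quat"
  assumes "\<And>h. norm (q h) \<le> 1"
  shows "norm (oprod q K) \<le> 1"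
proof -
  have "norm (prod_list (map q xs)) \<le> 1" for xs
    by (induction xs) (auto simp: norm_mult intro: mult_le_one assms)
  then show ?thesis by (simp add: oprod_def)
qed

lemma oprod_nonzero:
  fixes q :: "'n::{finite,linorder} \<Rightarrow> quat"
  assumes "\<And>h. q h \<noteq> 0" shows "oprod q K \<noteq> 0"
  unfolding oprod_def using assms by (auto simp: prod_list_zero_iff)

lemma tendsto_oprod:
  fixes q :: "'b \<Rightarrow> 'n::{finite,linorder} \<Rightarrow> quat"
  assumes "\<And>h. h \<in> K \<Longrightarrow> ((\<lambda>x. q x h) \<longlongrightarrow> l h) F"
  shows "((\<lambda>x. oprod (q x) K) \<longlongrightarrow> oprod l K) F"
proof -
  have "((\<lambda>x. prod_list (map (q x) xs)) \<longlongrightarrow> prod_list (map l xs)) F" if "set xs \<subseteq> K" for xs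
    using that by (induction xs) (auto intro!: tendsto_mult assms)
  then show ?thesis by (simp add: oprod_def)
qed

text \<open>The factor by which the coefficient at K of a stem function changes when the
  variables in C are conjugated. In either argument it is a character of the group of subsets
  under symmetric difference.\<close>

definition parity_sign :: "'n set \<Rightarrow> 'n set \<Rightarrow> real"
  where "parity_sign C K = (\<Prod>i\<in>K. if i \<in> C then - 1 else 1)"

lemma parity_sign_commute:
  fixes C K :: "'n::finite set"
  shows "parity_sign C K = parity_sign K C"
  by (simp add: parity_sign_def prod.If_cases Int_commute)

lemma parity_sign_square [simp]:
  fixes C K :: "'n::finite set"
  shows "parity_sign C K * parity_sign C K = 1"
  unfolding parity_sign_def prod.distrib[symmetric] by (rule prod.neutral) auto

lemma parity_sign_orthogonal:
  fixes K M :: "'n::finite set"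
  shows "(\<Sum>C\<in>UNIV. parity_sign C M * parity_sign C K) = (if K = M then 2 ^ CARD('n) else 0)"
proof -
  let ?e = "\<lambda>i. (if i \<in> M then - 1 else 1) * (if i \<in> K then - 1 else 1) :: real"
  have "(\<Sum>C\<in>UNIV. parity_sign C M * parity_sign C K) = (\<Sum>C\<in>Pow UNIV. (\<Prod>i\<in>C. ?e i) * (\<Prod>i\<in>UNIV - C. 1))"
    unfolding parity_sign_commute[of _ M] parity_sign_commute[of _ K] unfolding parity_sign_def by (simp add: prod.distrib)
  also have "\<dots> = (\<Prod>i\<in>UNIV. ?e i + 1)"
    by (rule prod_add[symmetric]) simp
  also have "\<dots> = (if K = M then 2 ^ CARD('n) else 0)"
  proof (cases "K = M")
    case True
    then have "?e i + 1 = 2" for i by simp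
    then show ?thesis using True by simp
  next
    case False
    then obtain i where "i \<in> K \<longleftrightarrow> i \<notin> M" by blast
    then have "?e i + 1 = 0" by simp
    then show ?thesis using False by (simp only: if_False) (rule prod_zero, auto)
  qed
  finally show ?thesis .
qed

text \<open>Fourier inversion on the group of subsets.\<close>

lemma parity_sign_transform_injective:
  fixes c :: "'n::finite set \<Rightarrow> quat"
  assumes "\<And>C. (\<Sum>K\<in>UNIV. parity_sign C K *\<^sub>R c K) = 0"
  shows "c M = 0"
proof -
  have "0 = (\<Sum>C\<in>UNIV. parity_sign C M *\<^sub>R (\<Sum>K\<in>UNIV. parity_sign C K *\<^sub>R c K))" by (simp add: assms)
  also have "\<dots> = (\<Sum>C\<in>UNIV. \<Sum>K\<in>UNIV. (parity_sign C M * parity_sign C K) *\<^sub>R c K)"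
    by (simp add: scaleR_sum_right)
  also have "\<dots> = (\<Sum>K\<in>UNIV. \<Sum>C\<in>UNIV. (parity_sign C M * parity_sign C K) *\<^sub>R c K)" by (rule sum.swap)
  also have "\<dots> = (\<Sum>K\<in>UNIV. (if K = M then 2 ^ CARD('n) else 0) *\<^sub>R c K)"
    by (simp only: scaleR_sum_left[symmetric] parity_sign_orthogonal)
  also have "\<dots> = (\<Sum>K\<in>UNIV. if K = M then 2 ^ CARD('n) *\<^sub>R c K else 0)"
    by (rule sum.cong) auto
  also have "\<dots> = 2 ^ CARD('n) *\<^sub>R c M" by simp
  finally show ?thesis by simp
qed

definition conj_set :: "'n::finite set \<Rightarrow> 'n cspace \<Rightarrow> 'n cspace"
  where "conj_set C z = (\<chi> i. if i \<in> C then cnj (z $ i) else z $ i)"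

lemma conj_set_insert: "h \<notin> C \<Longrightarrow> conj_set (insert h C) z = conj_at h (conj_set C z)"
  by (auto simp: conj_set_def vec_eq_iff)

lemma conj_set_in_invariant:
  assumes "invariant D" "z \<in> D"
  shows "conj_set C z \<in> D"
  using finite[of C]
proof (induction C rule: finite_induct)
  case empty
  then show ?case using assms by (simp add: conj_set_def)
next
  case (insert h C)
  then show ?case using assms(1) by (simp add: conj_set_insert invariant_def)
qed

lemma stem_function_conj_set:
  assumes "invariant D" "stem_function D F" "z \<in> D"
  shows "F (conj_set C z) $ K = parity_sign C K *\<^sub>R F z $ K"
  using finite[of C]
proof (induction C rule: finite_induct)
  case empty
  then show ?case by (simp add: conj_set_def parity_sign_def)
next
  case (insert h C)
  have "F (conj_set (insert h C) z) $ K = (if h \<in> K then - F (conj_set C z) $ K else F (conj_set C z) $ K)"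
    unfolding conj_set_insert[OF insert.hyps(2)]
    by (rule stem_function_conj_at[OF assms(2) conj_set_in_invariant[OF assms(1,3)]])
  moreover have "parity_sign (insert h C) K = (if h \<in> K then - parity_sign C K else parity_sign C K)"
    unfolding parity_sign_commute[of _ K] unfolding parity_sign_def using insert.hyps by simp
  ultimately show ?case using insert.IH by auto
qed

lemma slice_point_eq_cases:
  assumes J: "\<And>h. J $ h \<in> imag_units" "\<And>h. J' $ h \<in> imag_units"
    and eq: "slice_point J z = slice_point J' z'"
  obtains C where "z' = conj_set C z"
    "\<And>h. Im (z $ h) \<noteq> 0 \<Longrightarrow> J' $ h = (if h \<in> C then - 1 else 1) *\<^sub>R J $ h"
proof -
  have e: "of_real (Re (z $ h)) + J $ h * of_real (Im (z $ h))
      = of_real (Re (z' $ h)) + J' $ h * of_real (Im (z' $ h))" for h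
    using eq by (simp add: slice_point_def vec_eq_iff)
  note u = imag_unit_decomposition_unique[OF J(1) J(2) e]
  let ?C = "{h. z' $ h \<noteq> z $ h}"
  show ?thesis
  proof (rule that)
    show "z' = conj_set ?C z"
      using u by (auto simp: conj_set_def vec_eq_iff complex_eq_iff)
    fix h assume "Im (z $ h) \<noteq> 0"
    then show "J' $ h = (if h \<in> ?C then - 1 else 1) *\<^sub>R J $ h"
      using u[of h] by (auto simp: complex_eq_iff)
  qed
qed

text \<open>Two representations of a point differ by conjugating some variables and changing the
  sign of the corresponding units, so both factors acquire the same sign. At a real coordinate,
  where the units are unrelated, the coefficient vanishes.\<close>

lemma slice_term_unique:
  fixes F :: "'n::{finite,linorder} cspace \<Rightarrow> 'n stem_val"
  assumes D: "invariant D" and F: "stem_function D F" and z: "z \<in> D"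
    and J: "\<And>h. J $ h \<in> imag_units" "\<And>h. J' $ h \<in> imag_units"
    and eq: "slice_point J z = slice_point J' z'"
  shows "oprod (($) J') K * F z' $ K = oprod (($) J) K * F z $ K"
proof -
  obtain C where C: "z' = conj_set C z"
    "\<And>h. Im (z $ h) \<noteq> 0 \<Longrightarrow> J' $ h = (if h \<in> C then - 1 else 1) *\<^sub>R J $ h"
    using slice_point_eq_cases[OF J eq] by blast
  have F': "F z' $ K = parity_sign C K *\<^sub>R F z $ K"
    unfolding C(1) by (rule stem_function_conj_set[OF D F z])
  show ?thesis
  proof (cases "\<exists>h\<in>K. Im (z $ h) = 0")
    case True
    then have "F z $ K = 0" using stem_function_real_zero[OF F z] by blast
    then show ?thesis by (simp add: F')
  next
    case False
    then have "oprod (($) J') K = oprod (\<lambda>h. (if h \<in> C then - 1 else 1) *\<^sub>R J $ h) K"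
      using C(2) by (intro oprod_cong) blast
    then have "oprod (($) J') K = parity_sign C K *\<^sub>R oprod (($) J) K"
      by (simp only: oprod_scaleR parity_sign_def)
    then show ?thesis by (simp add: F')
  qed
qed

lemma induced_slice_point:
  fixes F :: "'n::{finite,linorder} cspace \<Rightarrow> 'n stem_val"
  assumes D: "invariant D" and F: "stem_function D F" and z: "z \<in> D"
    and J: "\<And>h. J $ h \<in> imag_units"
  shows "induced D F (slice_point J z) = (\<Sum>K\<in>UNIV. oprod (($) J) K * F z $ K)"
  unfolding induced_def
proof (rule the_equality)
  show "\<exists>z'\<in>D. \<exists>J'. (\<forall>h. J' $ h \<in> imag_units) \<and> slice_point J z = slice_point J' z' \<and>
      (\<Sum>K\<in>UNIV. oprod (($) J) K * F z $ K) = (\<Sum>K\<in>UNIV. oprod (($) J') K * F z' $ K)"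
    using z J by blast
next
  fix q assume "\<exists>z'\<in>D. \<exists>J'. (\<forall>h. J' $ h \<in> imag_units) \<and> slice_point J z = slice_point J' z' \<and>
      q = (\<Sum>K\<in>UNIV. oprod (($) J') K * F z' $ K)"
  then obtain z' J' where "\<And>h. J' $ h \<in> imag_units" "slice_point J z = slice_point J' z'"
      and q: "q = (\<Sum>K\<in>UNIV. oprod (($) J') K * F z' $ K)" by blast
  then show "q = (\<Sum>K\<in>UNIV. oprod (($) J) K * F z $ K)"
    unfolding q by (intro sum.cong refl slice_term_unique[OF D F z J]) auto
qed

lemma induced_cong:
  assumes "\<And>z. z \<in> D \<Longrightarrow> F z = G z"
  shows "induced D F = induced D G"
  unfolding induced_def using assms by (intro ext arg_cong[where f = The]) auto

definition unit_i :: "'n::finite qspace" where "unit_i = (\<chi> h. Quat 0 1 0 0)"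

lemma unit_i: "unit_i $ h \<in> imag_units" "unit_i $ h \<noteq> 0"
  by (simp_all add: unit_i_def imag_units_iff norm_quat_eq quat_eq_iff)

lemma slice_point_in_circularization:
  "z \<in> D \<Longrightarrow> (\<And>h. J $ h \<in> imag_units) \<Longrightarrow> slice_point J z \<in> circularization D"
  by (auto simp: circularization_def)

text \<open>With the units fixed, replacing z by its partial conjugates gives all character sums
  of the terms J_K F_K(z). They determine each term, and J_K is invertible.\<close>

lemma stem_unique:
  fixes F G :: "'n::{finite,linorder} cspace \<Rightarrow> 'n stem_val"
  assumes D: "invariant D" and F: "stem_function D F" and G: "stem_function D G"
    and eq: "\<And>x. x \<in> circularization D \<Longrightarrow> induced D F x = induced D G x" and z: "z \<in> D"
  shows "F z = G z"
proof -
  let ?o = "oprod (($) (unit_i :: 'n qspace))"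
  have "?o M * (F z $ M - G z $ M) = 0" for M
  proof (rule parity_sign_transform_injective[where c = "\<lambda>M. ?o M * (F z $ M - G z $ M)"])
    fix C
    have zC: "conj_set C z \<in> D" by (rule conj_set_in_invariant[OF D z])
    have "(\<Sum>K\<in>UNIV. ?o K * F (conj_set C z) $ K) = (\<Sum>K\<in>UNIV. ?o K * G (conj_set C z) $ K)"
      using eq[OF slice_point_in_circularization[OF zC unit_i(1)]]
      unfolding induced_slice_point[OF D F zC unit_i(1)] induced_slice_point[OF D G zC unit_i(1)] .
    then show "(\<Sum>K\<in>UNIV. parity_sign C K *\<^sub>R (?o K * (F z $ K - G z $ K))) = 0"
      unfolding stem_function_conj_set[OF D F z] stem_function_conj_set[OF D G z]
      by (simp add: algebra_simps sum_subtractf)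
  qed
  then have "F z $ M - G z $ M = 0" for M
    using oprod_nonzero[of "($) (unit_i :: 'n qspace)"] unit_i(2) by (metis mult_eq_0_iff)
  then show ?thesis by (simp add: vec_eq_iff)
qed

lemma stem_of_induced:
  fixes F :: "'n::{finite,linorder} cspace \<Rightarrow> 'n stem_val"
  assumes D: "invariant D" and F: "stem_function D F"
    and f: "\<And>x. x \<in> circularization D \<Longrightarrow> f x = induced D F x"
    and z: "z \<in> D"
  shows "stem_of D f z = F z"
proof -
  have *: "stem_function D (stem_of D f) \<and> (\<forall>x\<in>circularization D. f x = induced D (stem_of D f) x)"
    unfolding stem_of_def by (rule someI[where x = F]) (use F f in auto)
  show ?thesis
    by (rule stem_unique[OF D _ F _ z]) (use * f in auto)
qed

lemma sum_axis_nth: "(\<Sum>H\<in>UNIV. axis (sym_diff K H) (v H) $ M) = (v (sym_diff K M) :: quat)"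
  for K M :: "'n::finite set"
proof -
  have *: "M = sym_diff K H \<longleftrightarrow> H = sym_diff K M" for H by blast
  have "(\<Sum>H\<in>UNIV. axis (sym_diff K H) (v H) $ M) = (\<Sum>H\<in>UNIV. if H = sym_diff K M then v H else 0)"
    by (simp add: axis_def *)
  then show ?thesis by simp
qed

lemma stem_prod_nth:
  "stem_prod F G z $ M =
    (\<Sum>K\<in>UNIV. (- 1) ^ card (sym_diff K M \<inter> K) * (F z $ K * G z $ sym_diff K M))"
proof -
  have "stem_prod F G z = (\<Sum>K\<in>UNIV. \<Sum>H\<in>UNIV. axis (sym_diff K H) ((- 1) ^ card (H \<inter> K) * (F z $ K * G z $ H)))"
    unfolding stem_prod_def by (rule sum.swap)
  then show ?thesis by (simp only: sum_component sum_axis_nth)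
qed

lemma stem_function_stem_prod:
  assumes "stem_function D F" "stem_function D G"
  shows "stem_function D (stem_prod F G)"
proof (rule stem_functionI)
  show "continuous_on D (\<lambda>z. stem_prod F G z $ K)" for K
    unfolding stem_prod_nth by (intro continuous_intros stem_function_continuous assms)
  fix z h M assume z: "z \<in> D"
  note c = stem_function_conj_at[OF assms(1) z] stem_function_conj_at[OF assms(2) z]
  show "stem_prod F G (conj_at h z) $ M = (if h \<in> M then - stem_prod F G z $ M else stem_prod F G z $ M)"
  proof (cases "h \<in> M")
    case True
    then show ?thesis unfolding stem_prod_nth
      by (simp add: sum_negf[symmetric] del: sum_negf) (intro sum.cong refl, auto simp: c)
  next
    case False
    then show ?thesis unfolding stem_prod_nth by simp (intro sum.cong refl, auto simp: c)
  qed
qed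

lemma slice_prod_induced:
  fixes F G :: "'n::{finite,linorder} cspace \<Rightarrow> 'n stem_val"
  assumes D: "invariant D" and F: "stem_function D F" and G: "stem_function D G"
    and f: "\<And>x. x \<in> circularization D \<Longrightarrow> f x = induced D F x"
    and g: "\<And>x. x \<in> circularization D \<Longrightarrow> g x = induced D G x"
  shows "slice_prod D f g = induced D (stem_prod F G)"
  unfolding slice_prod_def
  by (rule induced_cong)
     (simp add: stem_prod_def stem_of_induced[OF D F f] stem_of_induced[OF D G g])

text \<open>The stem function of x_K, obtained by expanding the product of the factors
  \<alpha>_k + e_k \<beta>_k.\<close>

definition monomial_stem :: "'n::finite set \<Rightarrow> 'n cspace \<Rightarrow> 'n stem_val"
  where "monomial_stem K z = (\<chi> L. if L \<subseteq> K then of_real ((\<Prod>l\<in>L. Im (z $ l)) * (\<Prod>k\<in>K - L. Re (z $ k))) else 0)"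

lemma monomial_stem_nth:
  "monomial_stem K z $ L = (if L \<subseteq> K then of_real ((\<Prod>l\<in>L. Im (z $ l)) * (\<Prod>k\<in>K - L. Re (z $ k))) else 0)"
  by (simp add: monomial_stem_def)

lemma stem_function_monomial_stem: "stem_function D (monomial_stem K)"
proof (rule stem_functionI)
  show "continuous_on D (\<lambda>z. monomial_stem K z $ L)" for L
    unfolding monomial_stem_nth by (cases "L \<subseteq> K") (auto intro!: continuous_intros)
  fix z :: "'a cspace" and h L
  have "(\<Prod>l\<in>L. Im (conj_at h z $ l)) = (\<Prod>l\<in>L. Im (z $ l)) * parity_sign {h} L"
    unfolding parity_sign_def prod.distrib[symmetric] by (rule prod.cong) auto
  moreover have "parity_sign {h} L = (if h \<in> L then - 1 else 1)"
    by (subst parity_sign_commute) (simp add: parity_sign_def)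
  moreover have "Re (conj_at h z $ k) = Re (z $ k)" for k by simp
  ultimately show "monomial_stem K (conj_at h z) $ L
      = (if h \<in> L then - monomial_stem K z $ L else monomial_stem K z $ L)"
    unfolding monomial_stem_nth by simp
qed

lemma stem_prod_monomial_insert:
  assumes "k \<notin> K"
  shows "stem_prod (monomial_stem {k}) (monomial_stem K) z = monomial_stem (insert k K) z"
proof (subst vec_eq_iff, intro allI)
  fix M
  let ?t = "\<lambda>L. (- 1) ^ card (sym_diff L M \<inter> L) * (monomial_stem {k} z $ L * monomial_stem K z $ sym_diff L M)"
  have "stem_prod (monomial_stem {k}) (monomial_stem K) z $ M = (\<Sum>L\<in>UNIV. ?t L)"
    by (rule stem_prod_nth)
  also have "\<dots> = (\<Sum>L\<in>{{}, {k}}. ?t L)"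
    by (rule sum.mono_neutral_right) (auto simp: monomial_stem_nth)
  also have "\<dots> = of_real (Re (z $ k)) * monomial_stem K z $ M
      + (- 1) ^ card (sym_diff {k} M \<inter> {k}) * (of_real (Im (z $ k)) * monomial_stem K z $ sym_diff {k} M)"
    by (simp add: monomial_stem_nth)
  also have "\<dots> = monomial_stem (insert k K) z $ M"
  proof (cases "k \<in> M")
    case True
    then have s: "sym_diff {k} M = M - {k}" by blast
    have "(\<Prod>l\<in>M. Im (z $ l)) = Im (z $ k) * (\<Prod>l\<in>M - {k}. Im (z $ l))"
      using True by (simp add: prod.remove)
    moreover have "insert k K - M = K - (M - {k})" using True assms by auto
    moreover have "M \<subseteq> insert k K \<longleftrightarrow> M - {k} \<subseteq> K" using True by auto
    moreover have "(M - {k}) \<inter> {k} = {}" "\<not> M \<subseteq> K" using True assms by auto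
    ultimately show ?thesis by (simp add: s monomial_stem_nth mult_ac)
  next
    case False
    then have s: "sym_diff {k} M = insert k M" by blast
    have n: "\<not> insert k M \<subseteq> K" using assms by auto
    have "insert k K - M = insert k (K - M)" using False by auto
    moreover have "M \<subseteq> insert k K \<longleftrightarrow> M \<subseteq> K" using False by auto
    ultimately show ?thesis using assms by (simp add: s n monomial_stem_nth mult_ac)
  qed
  finally show "stem_prod (monomial_stem {k}) (monomial_stem K) z $ M = monomial_stem (insert k K) z $ M" .
qed

lemma coord_eq_induced: "coord D j = induced D (monomial_stem {j})"
proof -
  have "axis {} (of_real (Re (z $ j))) + axis {j} (of_real (Im (z $ j))) = monomial_stem {j} z" for z :: "'a cspace"
    by (auto simp: vec_eq_iff axis_def monomial_stem_nth subset_singleton_iff)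
  then show ?thesis by (simp add: coord_def)
qed

lemma coord_prod_eq_induced:
  fixes D :: "'n::{finite,linorder} cspace set"
  assumes D: "invariant D" and x: "x \<in> circularization D"
  shows "coord_prod D K x = induced D (monomial_stem K) x"
proof -
  have "foldr (\<lambda>k g. slice_prod D (coord D k) g) xs (\<lambda>_. 1) x = induced D (monomial_stem (set xs)) x"
    if "distinct xs" "x \<in> circularization D" for xs x
    using that
  proof (induction xs arbitrary: x)
    case Nil
    then obtain J z where z: "z \<in> D" "\<And>h. J $ h \<in> imag_units" "x = slice_point J z"
      by (auto simp: circularization_def)
    have "induced D (monomial_stem {}) x = (\<Sum>K\<in>UNIV. oprod (($) J) K * monomial_stem {} z $ K)"
      unfolding z(3) by (rule induced_slice_point[OF D stem_function_monomial_stem z(1,2)])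
    also have "\<dots> = (\<Sum>K\<in>{{}}. oprod (($) J) K * monomial_stem {} z $ K)"
      by (rule sum.mono_neutral_right) (auto simp: monomial_stem_nth)
    also have "\<dots> = 1" by (simp add: monomial_stem_nth oprod_def)
    finally show ?case by simp
  next
    case (Cons k xs)
    have "slice_prod D (coord D k) (foldr (\<lambda>k g. slice_prod D (coord D k) g) xs (\<lambda>_. 1))
        = induced D (stem_prod (monomial_stem {k}) (monomial_stem (set xs)))"
      using Cons by (intro slice_prod_induced[OF D] stem_function_monomial_stem) (auto simp: coord_eq_induced)
    also have "\<dots> = induced D (monomial_stem (set (k # xs)))"
      using Cons.prems by (intro induced_cong) (simp add: stem_prod_monomial_insert)
    finally show ?case by simp
  qed
  from this[of "sorted_list_of_set K" x] x show ?thesis by (simp add: coord_prod_def)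
qed

text \<open>All signs are trivial: the sets L \<subseteq> K that index the first factor are
  disjoint from the index P \<union> (H - L) of the second.\<close>

lemma stem_prod_monomial_nth:
  assumes "K \<subseteq> H" "P \<inter> H = {}"
  shows "stem_prod (monomial_stem K) F z $ (P \<union> H) =
    (\<Sum>L\<in>Pow K. ((\<Prod>l\<in>L. Im (z $ l)) * (\<Prod>k\<in>K - L. Re (z $ k))) *\<^sub>R F z $ (P \<union> (H - L)))"
proof -
  let ?t = "\<lambda>L. (- 1) ^ card (sym_diff L (P \<union> H) \<inter> L) * (monomial_stem K z $ L * F z $ sym_diff L (P \<union> H))"
  have "stem_prod (monomial_stem K) F z $ (P \<union> H) = (\<Sum>L\<in>UNIV. ?t L)" by (rule stem_prod_nth)
  also have "\<dots> = (\<Sum>L\<in>Pow K. ?t L)"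
    by (rule sum.mono_neutral_right) (auto simp: monomial_stem_nth)
  also have "\<dots> = (\<Sum>L\<in>Pow K. ((\<Prod>l\<in>L. Im (z $ l)) * (\<Prod>k\<in>K - L. Re (z $ k))) *\<^sub>R F z $ (P \<union> (H - L)))"
  proof (rule sum.cong[OF refl])
    fix L assume L: "L \<in> Pow K"
    then have "sym_diff L (P \<union> H) = P \<union> (H - L)" "sym_diff L (P \<union> H) \<inter> L = {}" using assms by auto
    then show "?t L = ((\<Prod>l\<in>L. Im (z $ l)) * (\<Prod>k\<in>K - L. Re (z $ k))) *\<^sub>R F z $ (P \<union> (H - L))"
      using L by (simp only: card.empty) (simp add: monomial_stem_nth scaleR_conv_of_real)
  qed
  finally show ?thesis .
qed

lemma circularization_mono: "D \<subseteq> D' \<Longrightarrow> circularization D \<subseteq> circularization D'"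
  by (auto simp: circularization_def)

lemma continuous_on_slice_point: "continuous_on S (slice_point J)"
  unfolding slice_point_def by (intro continuous_intros)

lemma closure_circularization_nonreal_part:
  assumes "open D"
  shows "circularization D \<subseteq> closure (circularization (nonreal_part H D))"
proof
  fix x assume "x \<in> circularization D"
  then obtain J z where z: "z \<in> D" "\<And>h. J $ h \<in> imag_units" "x = slice_point J z"
    by (auto simp: circularization_def)
  have "slice_point J ` closure (nonreal_part H D) \<subseteq> closure (circularization (nonreal_part H D))"
  proof (rule image_closure_subset[OF continuous_on_slice_point closed_closure])
    show "slice_point J ` nonreal_part H D \<subseteq> closure (circularization (nonreal_part H D))"
      using z(2) by (auto intro!: subsetD[OF closure_subset] slice_point_in_circularization)
  qed
  then show "x \<in> closure (circularization (nonreal_part H D))"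
    using closure_nonreal_part[OF assms, of H] z by auto
qed

definition imag_part :: "quat \<Rightarrow> quat" where "imag_part q = q - of_real (qre q)"

lemma imag_part_sel [simp]:
  "qre (imag_part q) = 0" "qi (imag_part q) = qi q" "qj (imag_part q) = qj q" "qk (imag_part q) = qk q"
  by (simp_all add: imag_part_def of_real_def)

lemma Im_upper: "Im (upper q) = norm (imag_part q)"
  by (simp add: upper_def norm_quat_eq)

lemma Re_upper: "Re (upper q) = qre q"
  by (simp add: upper_def)

definition upper_point :: "'n::finite qspace \<Rightarrow> 'n cspace"
  where "upper_point x = (\<chi> h. upper (x $ h))"

definition upper_unit :: "quat \<Rightarrow> quat"
  where "upper_unit q = (if imag_part q = 0 then Quat 0 1 0 0 else sgn (imag_part q))"

lemma upper_unit: "upper_unit q \<in> imag_units"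
  "q = of_real (Re (upper q)) + upper_unit q * of_real (Im (upper q))"
proof -
  show "upper_unit q \<in> imag_units"
    by (auto simp: upper_unit_def imag_units_iff norm_sgn norm_quat_eq[of "Quat _ _ _ _"] sgn_div_norm)
  have "upper_unit q * of_real (Im (upper q)) = imag_part q"
    by (auto simp: upper_unit_def Im_upper of_real_def sgn_div_norm)
  then show "q = of_real (Re (upper q)) + upper_unit q * of_real (Im (upper q))"
    by (simp add: imag_part_def Re_upper)
qed

lemma slice_point_upper: "slice_point (\<chi> h. upper_unit (x $ h)) (upper_point x) = x"
  by (simp add: slice_point_def upper_point_def vec_eq_iff upper_unit(2)[symmetric])

lemma upper_point_slice_point:
  assumes "\<And>h. J $ h \<in> imag_units"
  obtains C where "upper_point (slice_point J z) = conj_set C z"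
proof -
  have "slice_point J z = slice_point (\<chi> h. upper_unit (slice_point J z $ h)) (upper_point (slice_point J z))"
    by (rule slice_point_upper[symmetric])
  from slice_point_eq_cases[OF assms _ this] show ?thesis
    using that upper_unit(1) by (metis vec_lambda_beta)
qed

lemma upper_point_in:
  assumes "invariant D" "x \<in> circularization D"
  shows "upper_point x \<in> D"
proof -
  obtain J z where z: "z \<in> D" "\<And>h. J $ h \<in> imag_units" "x = slice_point J z"
    using assms(2) by (auto simp: circularization_def)
  obtain C where "upper_point x = conj_set C z"
    unfolding z(3) by (rule upper_point_slice_point[OF z(2)])
  then show ?thesis using conj_set_in_invariant[OF assms(1) z(1)] by simp
qed

text \<open>The representation with all coordinates in the upper half plane depends continuously
  on x, apart from the units at real coordinates. There the sign of the imaginary part is 0, which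
  is correct because the coefficient vanishes.\<close>

lemma induced_eq_upper:
  fixes F :: "'n::{finite,linorder} cspace \<Rightarrow> 'n stem_val"
  assumes D: "invariant D" and F: "stem_function D F" and x: "x \<in> circularization D"
  shows "induced D F x = (\<Sum>K\<in>UNIV. oprod (\<lambda>h. sgn (imag_part (x $ h))) K * F (upper_point x) $ K)"
proof -
  have "induced D F x = (\<Sum>K\<in>UNIV. oprod (($) (\<chi> h. upper_unit (x $ h))) K * F (upper_point x) $ K)"
    using induced_slice_point[OF D F upper_point_in[OF D x], of "\<chi> h. upper_unit (x $ h)"]
    by (simp add: slice_point_upper upper_unit(1))
  also have "\<dots> = (\<Sum>K\<in>UNIV. oprod (\<lambda>h. sgn (imag_part (x $ h))) K * F (upper_point x) $ K)"
  proof (rule sum.cong[OF refl])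
    fix K
    show "oprod (($) (\<chi> h. upper_unit (x $ h))) K * F (upper_point x) $ K
        = oprod (\<lambda>h. sgn (imag_part (x $ h))) K * F (upper_point x) $ K"
    proof (cases "\<exists>h\<in>K. imag_part (x $ h) = 0")
      case True
      then have "F (upper_point x) $ K = 0"
        using stem_function_real_zero[OF F upper_point_in[OF D x]] by (auto simp: upper_point_def Im_upper)
      then show ?thesis by simp
    next
      case False
      then have "oprod (($) (\<chi> h. upper_unit (x $ h))) K = oprod (\<lambda>h. sgn (imag_part (x $ h))) K"
        by (intro oprod_cong) (auto simp: upper_unit_def)
      then show ?thesis by simp
    qed
  qed
  finally show ?thesis .
qed

lemma continuous_on_imag_part: "continuous_on S f \<Longrightarrow> continuous_on S (\<lambda>x. imag_part (f x))"
  unfolding imag_part_def by (intro continuous_intros)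

lemma continuous_on_upper_point: "continuous_on S upper_point"
  unfolding upper_point_def
  by (intro continuous_on_vec_lambda continuous_on_compose2[OF continuous_on_upper[of UNIV]] continuous_intros) auto

text \<open>The units are discontinuous only at real coordinates. Since they are bounded and the
  coefficient tends to 0 there, each term is continuous.\<close>

lemma continuous_on_induced:
  fixes F :: "'n::{finite,linorder} cspace \<Rightarrow> 'n stem_val"
  assumes D: "invariant D" and F: "stem_function D F"
  shows "continuous_on (circularization D) (induced D F)"
proof -
  let ?T = "\<lambda>K x. oprod (\<lambda>h. sgn (imag_part (x $ h))) K * F (upper_point x) $ K"
  have cF: "continuous_on (circularization D) (\<lambda>x. F (upper_point x) $ K)" for K
    by (rule continuous_on_compose2[OF stem_function_continuous[OF F] continuous_on_upper_point])
       (use upper_point_in[OF D] in auto)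
  have "continuous_on (circularization D) (?T K)" for K
    unfolding continuous_on_def
  proof
    fix x assume x: "x \<in> circularization D"
    have limF: "((\<lambda>x. F (upper_point x) $ K) \<longlongrightarrow> F (upper_point x) $ K) (at x within circularization D)"
      using cF[of K] x by (auto simp: continuous_on_def)
    show "(?T K \<longlongrightarrow> ?T K x) (at x within circularization D)"
    proof (cases "\<exists>h\<in>K. imag_part (x $ h) = 0")
      case True
      then have z: "F (upper_point x) $ K = 0"
        using stem_function_real_zero[OF F upper_point_in[OF D x]] by (auto simp: upper_point_def Im_upper)
      have lim0: "((\<lambda>x. norm (F (upper_point x) $ K)) \<longlongrightarrow> 0) (at x within circularization D)"
        using tendsto_norm_zero[OF limF[unfolded z]] .
      have le: "norm (?T K y) \<le> norm (F (upper_point y) $ K)" for y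
      proof -
        have "norm (oprod (\<lambda>h. sgn (imag_part (y $ h))) K) \<le> 1"
          by (rule norm_oprod_le_1) (simp add: norm_sgn)
        then show ?thesis by (simp add: norm_mult mult_left_le_one_le)
      qed
      have "(?T K \<longlongrightarrow> 0) (at x within circularization D)"
        by (rule Lim_null_comparison[OF always_eventually lim0]) (use le in blast)
      then show ?thesis by (simp add: z)
    next
      case False
      have "((\<lambda>x. imag_part (x $ h)) \<longlongrightarrow> imag_part (x $ h)) (at x within circularization D)" for h
      proof -
        have "continuous_on (circularization D) (\<lambda>x. imag_part (x $ h))"
          by (intro continuous_on_imag_part continuous_intros)
        then show ?thesis using x unfolding continuous_on_def by (rule bspec)
      qed
      then show ?thesis using False by (intro tendsto_mult limF tendsto_oprod tendsto_sgn) auto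
    qed
  qed
  then have "continuous_on (circularization D) (\<lambda>x. \<Sum>K\<in>UNIV. ?T K x)"
    by (intro continuous_on_sum)
  then show ?thesis
    by (rule continuous_on_cong[THEN iffD1, OF refl, rotated]) (simp add: induced_eq_upper[OF D F])
qed

lemma stem_J_nth: "stem_J h w $ M = (- 1) ^ card (sym_diff M {h} \<inter> {h}) * w $ sym_diff M {h}"
proof -
  have *: "sym_diff K {h} = sym_diff {h} K" for K by blast
  have "stem_J h w $ M = (\<Sum>K\<in>UNIV. axis (sym_diff {h} K) ((- 1) ^ card (K \<inter> {h}) * w $ K) $ M)"
    unfolding stem_J_def sum_component by (intro sum.cong refl) (simp only: *)
  then show ?thesis by (simp only: sum_axis_nth *[of M])
qed

text \<open>In the complex direction j, the vanishing of dbar is the Cauchy-Riemann system for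
  the coefficients at K and K \<union> {j}.\<close>

lemma holomorphic_in_of_stem_holomorphic:
  fixes F :: "'n::finite cspace \<Rightarrow> 'n stem_val"
  assumes D: "open D" and F: "stem_holomorphic D F"
  shows "holomorphic_in D j F"
  unfolding holomorphic_in_def
proof (intro allI impI)
  fix z K and b :: quat assume jK: "j \<notin> K"
  have "complex_slice F z j K b field_differentiable at w" if w: "w \<in> {w. upd z j w \<in> D}" for w
  proof -
    let ?z = "upd z j w"
    have zD: "?z \<in> D" using w by simp
    obtain F' where "\<forall>z\<in>D. (F has_derivative blinfun_apply (F' z)) (at z)"
      using F by (auto simp: stem_holomorphic_def C1_on_def)
    then have F': "(F has_derivative blinfun_apply (F' ?z)) (at ?z)" using zD by blast
    define L where "L = blinfun_apply (F' ?z)"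
    have L: "linear L" unfolding L_def by (rule bounded_linear.linear[OF blinfun.bounded_linear_right])
    have line: "vector_derivative (\<lambda>t. F (?z + t *\<^sub>R v)) (at 0) = L v" for v
    proof (rule vector_derivative_at)
      have "((\<lambda>t. ?z + t *\<^sub>R v) has_derivative (\<lambda>t. t *\<^sub>R v)) (at 0)"
        by (auto intro!: derivative_eq_intros)
      moreover have "(F has_derivative L) (at (?z + 0 *\<^sub>R v))" using F' by (simp add: L_def)
      ultimately have "((\<lambda>t. F (?z + t *\<^sub>R v)) has_derivative (\<lambda>t. L (t *\<^sub>R v))) (at 0)"
        by (rule has_derivative_compose)
      then show "((\<lambda>t. F (?z + t *\<^sub>R v)) has_vector_derivative L v) (at 0)"
        by (simp add: has_vector_derivative_def linear_scale[OF L])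
    qed
    define p q where "p = L (axis j 1)" and "q = L (axis j \<i>)"
    have "dbar j F ?z = 0" using F zD by (auto simp: stem_holomorphic_def)
    then have pq: "p + stem_J j q = 0"
      unfolding dbar_def line p_def q_def by simp
    have pK: "p $ K = q $ insert j K"
    proof -
      have "sym_diff K {j} = insert j K" using jK by blast
      then have "stem_J j q $ K = - q $ insert j K" by (simp add: stem_J_nth)
      moreover have "p $ K + stem_J j q $ K = 0" using pq by (metis vector_add_component zero_index)
      ultimately show ?thesis by simp
    qed
    have pjK: "q $ K = - p $ insert j K"
    proof -
      have "sym_diff (insert j K) {j} = K" using jK by blast
      then have "stem_J j q $ insert j K = q $ K" using jK by (simp add: stem_J_nth)
      moreover have "p $ insert j K + stem_J j q $ insert j K = 0" using pq by (metis vector_add_component zero_index)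
      ultimately show ?thesis by (simp add: eq_neg_iff_add_eq_0 add.commute)
    qed
    have ax: "L (axis j v) = Re v *\<^sub>R p + Im v *\<^sub>R q" for v
    proof -
      have "axis j v = Re v *\<^sub>R axis j 1 + Im v *\<^sub>R axis j \<i>"
        by (simp add: vec_eq_iff axis_def complex_eq_iff)
      then show ?thesis by (simp add: p_def q_def linear_add[OF L] linear_scale[OF L])
    qed
    have "((\<lambda>v. upd z j v) has_derivative axis j) (at w)"
    proof -
      have lin: "bounded_linear (axis j :: complex \<Rightarrow> 'n cspace)"
        unfolding linear_conv_bounded_linear[symmetric]
        by (rule linearI) (simp_all add: vec_eq_iff axis_def)
      have *: "(\<lambda>v. upd z j v) = (\<lambda>v. upd z j 0 + axis j v)"
        by (simp add: fun_eq_iff vec_eq_iff axis_def)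
      show ?thesis
        by (subst *, rule has_derivative_eq_rhs,
            rule has_derivative_add[OF has_derivative_const bounded_linear_imp_has_derivative[OF lin]]) simp
    qed
    moreover have "(F has_derivative L) (at ?z)" using F' by (simp add: L_def)
    ultimately have dF: "((\<lambda>v. F (upd z j v)) has_derivative (\<lambda>v. L (axis j v))) (at w)"
      by (rule has_derivative_compose)
    have comp: "((\<lambda>v. F (upd z j v) $ M \<bullet> b) has_derivative (\<lambda>v. L (axis j v) $ M \<bullet> b)) (at w)" for M
      by (rule bounded_linear.has_derivative[OF bounded_linear_compose[OF bounded_linear_inner_left bounded_linear_vec_nth] dF])
    let ?d = "Complex (p $ K \<bullet> b) (p $ insert j K \<bullet> b)"
    have "(complex_slice F z j K b has_derivative
        (\<lambda>v. of_real (L (axis j v) $ K \<bullet> b) + \<i> * of_real (L (axis j v) $ insert j K \<bullet> b))) (at w)"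
      unfolding complex_slice_def Complex_eq
      by (intro has_derivative_add has_derivative_mult_right has_derivative_of_real comp)
    moreover have "(\<lambda>v. of_real (L (axis j v) $ K \<bullet> b) + \<i> * of_real (L (axis j v) $ insert j K \<bullet> b))
        = (*) ?d"
      unfolding ax
      by (simp add: fun_eq_iff complex_eq_iff inner_add_left pK pjK algebra_simps)
    ultimately have "(complex_slice F z j K b has_field_derivative ?d) (at w)"
      by (simp add: has_field_derivative_def)
    then show ?thesis by (auto simp: field_differentiable_def)
  qed
  then show "complex_slice F z j K b holomorphic_on {w. upd z j w \<in> D}"
    unfolding holomorphic_on_def by (blast intro: field_differentiable_at_within)
qed

section \<open>Spherical components and the mean value formula\<close>

lemma invariant_nonreal_part: "invariant D \<Longrightarrow> invariant (nonreal_part H D)"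
  by (auto simp: invariant_def nonreal_part_def split: if_splits)

lemma stem_function_subset: "stem_function D F \<Longrightarrow> D' \<subseteq> D \<Longrightarrow> stem_function D' F"
  unfolding stem_function_def by (blast intro: continuous_on_subset)

text \<open>The stem function of the spherical component, where G Q stands for the extension of
  the quotient of F by the product of the \<beta>_h with h \<in> Q.\<close>

definition component_stem ::
    "('n set \<Rightarrow> 'n cspace \<Rightarrow> 'n stem_val) \<Rightarrow> 'n::finite set \<Rightarrow> 'n set \<Rightarrow> 'n cspace \<Rightarrow> 'n stem_val"
  where "component_stem G H K z = (\<chi> P. if P \<inter> H = {}
    then \<Sum>L\<in>Pow K. (\<Prod>k\<in>K - L. Re (z $ k)) *\<^sub>R G (H - L) z $ P else 0)"

lemma component_stem_nth:
  "component_stem G H K z $ P = (if P \<inter> H = {}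
    then \<Sum>L\<in>Pow K. (\<Prod>k\<in>K - L. Re (z $ k)) *\<^sub>R G (H - L) z $ P else 0)"
  by (simp add: component_stem_def)

lemma stem_function_component_stem:
  assumes G: "\<And>Q. Q \<subseteq> H \<Longrightarrow> stem_function D (G Q)"
  shows "stem_function D (component_stem G H K)"
proof (rule stem_functionI)
  show "continuous_on D (\<lambda>z. component_stem G H K z $ P)" for P
    unfolding component_stem_nth
    by (cases "P \<inter> H = {}") (auto intro!: continuous_intros stem_function_continuous G)
  fix z h P assume z: "z \<in> D"
  have Re: "Re (conj_at h z $ k) = Re (z $ k)" for k by simp
  have "G (H - L) (conj_at h z) $ P = (if h \<in> P then - G (H - L) z $ P else G (H - L) z $ P)" for L
    by (rule stem_function_conj_at[OF G z]) auto
  then show "component_stem G H K (conj_at h z) $ P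
      = (if h \<in> P then - component_stem G H K z $ P else component_stem G H K z $ P)"
    unfolding component_stem_nth Re by (simp add: sum_negf)
qed

definition is_quotient_family ::
    "'n::finite cspace set \<Rightarrow> 'n set \<Rightarrow> ('n cspace \<Rightarrow> 'n stem_val) \<Rightarrow> ('n set \<Rightarrow> 'n cspace \<Rightarrow> 'n stem_val) \<Rightarrow> bool"
  where "is_quotient_family D H F G \<longleftrightarrow> (\<forall>Q\<subseteq>H. stem_function D (G Q) \<and>
    (\<forall>z\<in>D. \<forall>P. P \<inter> Q = {} \<longrightarrow> (\<Prod>h\<in>Q. Im (z $ h)) *\<^sub>R G Q z $ P = F z $ (P \<union> Q)))"

lemma quotient_family_exists:
  fixes F :: "'n::finite cspace \<Rightarrow> 'n stem_val"
  assumes "open D" "invariant D" "stem_function D F" "\<And>j. holomorphic_in D j F"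
  obtains G where "is_quotient_family D H F G"
proof -
  have "\<exists>G. stem_function D G \<and>
      (\<forall>z\<in>D. \<forall>P. P \<inter> Q = {} \<longrightarrow> (\<Prod>h\<in>Q. Im (z $ h)) *\<^sub>R G z $ P = F z $ (P \<union> Q))" for Q
    using iterated_division[OF assms(1,2) finite[of Q] assms(3), of "{}"] assms(4) by auto
  then have "\<exists>G. is_quotient_family D H F G" unfolding is_quotient_family_def by metis
  then show ?thesis using that by blast
qed

lemma quotient_family_nonreal:
  assumes "is_quotient_family D H F G" "Q \<subseteq> H" "z \<in> nonreal_part H D" "P \<inter> Q = {}"
  shows "G Q z $ P = inverse (\<Prod>h\<in>Q. Im (z $ h)) *\<^sub>R F z $ (P \<union> Q)"
proof -
  have "(\<Prod>h\<in>Q. Im (z $ h)) \<noteq> 0"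
    using assms(2,3) by (auto simp: nonreal_part_def)
  moreover have "(\<Prod>h\<in>Q. Im (z $ h)) *\<^sub>R G Q z $ P = F z $ (P \<union> Q)"
    using assms by (auto simp: is_quotient_family_def nonreal_part_def)
  ultimately show ?thesis by (metis scaleR_scaleR left_inverse scaleR_one)
qed

lemma spherical_derivative_monomial:
  fixes F :: "'n::{finite,linorder} cspace \<Rightarrow> 'n stem_val"
  assumes D: "invariant D" and F: "stem_function D F"
    and f: "\<And>x. x \<in> circularization D \<Longrightarrow> f x = induced D F x"
    and G: "is_quotient_family D H F G" and K: "K \<subseteq> H"
    and x: "x \<in> circularization (nonreal_part H D)"
  shows "spherical_derivative D H (slice_prod D (coord_prod D K) f) x = induced D (component_stem G H K) x"
proof -
  let ?D = "nonreal_part H D" and ?S = "component_stem G H K"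
  let ?T = "\<lambda>z. inverse (\<Prod>h\<in>H. Im (z $ h)) *\<^sub>R (\<Sum>P\<in>Pow (- H). axis P
      (stem_of D (slice_prod D (coord_prod D K) f) z $ (P \<union> H)))"
  have S: "stem_function D ?S"
    using G by (intro stem_function_component_stem) (auto simp: is_quotient_family_def)
  have sp: "slice_prod D (coord_prod D K) f = induced D (stem_prod (monomial_stem K) F)"
    by (rule slice_prod_induced[OF D stem_function_monomial_stem F coord_prod_eq_induced[OF D] f])
  have st: "stem_of D (slice_prod D (coord_prod D K) f) z = stem_prod (monomial_stem K) F z" if "z \<in> D" for z
    using stem_of_induced[OF D stem_function_stem_prod[OF stem_function_monomial_stem F] _ that, of "slice_prod D (coord_prod D K) f" K]
    by (simp add: sp)
  have eq: "?T z = ?S z" if z: "z \<in> ?D" for z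
  proof (subst vec_eq_iff, intro allI)
    fix P
    have zD: "z \<in> D" using z by (simp add: nonreal_part_def)
    have "?T z $ P = inverse (\<Prod>h\<in>H. Im (z $ h)) *\<^sub>R
        (\<Sum>P'\<in>Pow (- H). if P' = P then stem_prod (monomial_stem K) F z $ (P' \<union> H) else 0)"
      by (simp add: st[OF zD] axis_def eq_commute[of P])
    also have "\<dots> = (if P \<inter> H = {} then inverse (\<Prod>h\<in>H. Im (z $ h)) *\<^sub>R
        stem_prod (monomial_stem K) F z $ (P \<union> H) else 0)"
      by (simp add: sum.delta') (auto simp: subset_iff)
    also have "\<dots> = ?S z $ P"
    proof (cases "P \<inter> H = {}")
      case True
      have "inverse (\<Prod>h\<in>H. Im (z $ h)) *\<^sub>R (((\<Prod>l\<in>L. Im (z $ l)) * (\<Prod>k\<in>K - L. Re (z $ k))) *\<^sub>R F z $ (P \<union> (H - L)))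
          = (\<Prod>k\<in>K - L. Re (z $ k)) *\<^sub>R G (H - L) z $ P" if L: "L \<in> Pow K" for L
      proof -
        have LH: "L \<subseteq> H" using L K by blast
        have "G (H - L) z $ P = inverse (\<Prod>h\<in>H - L. Im (z $ h)) *\<^sub>R F z $ (P \<union> (H - L))"
          using True by (intro quotient_family_nonreal[OF G _ z]) auto
        moreover have "(\<Prod>h\<in>H. Im (z $ h)) = (\<Prod>h\<in>H - L. Im (z $ h)) * (\<Prod>h\<in>L. Im (z $ h))"
          by (rule prod.subset_diff[OF LH]) simp
        moreover have "(\<Prod>h\<in>L. Im (z $ h)) \<noteq> 0" using z LH by (auto simp: nonreal_part_def)
        ultimately show ?thesis by (simp add: field_simps)
      qed
      then show ?thesis
        unfolding component_stem_nth stem_prod_monomial_nth[OF K True]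
        using True by (simp add: scaleR_sum_right)
    qed (simp add: component_stem_nth)
    finally show "?T z $ P = ?S z $ P" .
  qed
  obtain J z where z: "z \<in> ?D" "\<And>h. J $ h \<in> imag_units" "x = slice_point J z"
    using x by (auto simp: circularization_def)
  have "spherical_derivative D H (slice_prod D (coord_prod D K) f) x = induced ?D ?S x"
    unfolding spherical_derivative_def using induced_cong[of ?D ?T ?S] eq by simp
  also have "\<dots> = (\<Sum>P\<in>UNIV. oprod (($) J) P * ?S z $ P)"
    unfolding z(3) by (rule induced_slice_point[OF invariant_nonreal_part[OF D]
        stem_function_subset[OF S nonreal_part_subset] z(1,2)])
  also have "\<dots> = induced D ?S x"
    unfolding z(3) using z(1) nonreal_part_subset
    by (intro induced_slice_point[OF D S _ z(2), symmetric]) auto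
  finally show ?thesis .
qed

text \<open>The right-hand side is a continuous extension of the spherical derivative, and
  density of the points with nonreal coordinates makes it the only one.\<close>

lemma spherical_component_eq:
  fixes F :: "'n::{finite,linorder} cspace \<Rightarrow> 'n stem_val"
  assumes D: "open D" "invariant D" and F: "stem_function D F"
    and f: "\<And>x. x \<in> circularization D \<Longrightarrow> f x = induced D F x"
    and G: "is_quotient_family D H F G" and K: "K \<subseteq> H"
    and x: "x \<in> circularization D"
  shows "spherical_component D H K f x = induced D (component_stem G H K) x"
proof -
  let ?C = "circularization D" and ?C' = "circularization (nonreal_part H D)"
  let ?g = "restrict (induced D (component_stem G H K)) ?C"
  have S: "stem_function D (component_stem G H K)"
    using G by (intro stem_function_component_stem) (auto simp: is_quotient_family_def)
  have sub: "?C' \<subseteq> ?C" by (rule circularization_mono[OF nonreal_part_subset])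
  have cont: "continuous_on ?C ?g"
    using continuous_on_induced[OF D(2) S] by (simp cong: continuous_on_cong)
  have agree: "?g x = spherical_derivative D H (slice_prod D (coord_prod D K) f) x" if "x \<in> ?C'" for x
    using spherical_derivative_monomial[OF D(2) F f G K that] that sub by auto
  have "spherical_component D H K f = ?g"
    unfolding spherical_component_def
  proof (rule the_equality, intro conjI ballI)
    show "?g \<in> extensional ?C" by simp
    show "continuous_on ?C ?g" by (rule cont)
    show "?g x = spherical_derivative D H (slice_prod D (coord_prod D K) f) x" if "x \<in> ?C'" for x
      by (rule agree[OF that])
  next
    fix g assume g: "g \<in> extensional ?C \<and> continuous_on ?C g \<and>
      (\<forall>x\<in>?C'. g x = spherical_derivative D H (slice_prod D (coord_prod D K) f) x)"
    show "g = ?g"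
    proof (rule extensionalityI)
      show "g \<in> extensional ?C" "?g \<in> extensional ?C" using g by auto
      fix x assume x: "x \<in> ?C"
      show "g x = ?g x"
        by (rule continuous_eq_on_dense[OF _ cont sub closure_circularization_nonreal_part[OF D(1)] _ x])
           (use g agree in auto)
    qed
  qed
  then show ?thesis using x by simp
qed

text \<open>For a fixed Q = H - L, the sum over K is the expansion of the product of the
  \<alpha>_h - a_h with h \<in> Q.\<close>

lemma sum_component_stem:
  fixes z :: "'n::finite cspace" and a :: "'n \<Rightarrow> real"
  assumes P: "P \<inter> H = {}"
  shows "(\<Sum>K\<in>Pow H. ((- 1) ^ card (H - K) * (\<Prod>h\<in>H - K. a h)) *\<^sub>R component_stem G H K z $ P)
    = (\<Sum>Q\<in>Pow H. (\<Prod>h\<in>Q. Re (z $ h) - a h) *\<^sub>R G Q z $ P)"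
proof -
  have "(\<Sum>K\<in>Pow H. ((- 1) ^ card (H - K) * (\<Prod>h\<in>H - K. a h)) *\<^sub>R component_stem G H K z $ P)
    = (\<Sum>K\<in>Pow H. \<Sum>L\<in>Pow K. ((\<Prod>h\<in>H - K. - a h) * (\<Prod>k\<in>K - L. Re (z $ k))) *\<^sub>R G (H - L) z $ P)"
    using P by (simp add: component_stem_nth scaleR_sum_right prod_uminus)
  also have "\<dots> = (\<Sum>(K, L)\<in>Sigma (Pow H) Pow.
      ((\<Prod>h\<in>H - K. - a h) * (\<Prod>k\<in>K - L. Re (z $ k))) *\<^sub>R G (H - L) z $ P)"
    by (rule sum.Sigma) (auto intro: finite_subset)
  also have "\<dots> = (\<Sum>(Q, X)\<in>Sigma (Pow H) Pow.
      ((\<Prod>h\<in>X. Re (z $ h)) * (\<Prod>h\<in>Q - X. - a h)) *\<^sub>R G Q z $ P)"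
  proof (rule sum.reindex_bij_witness[where
        i = "\<lambda>(Q, X). ((H - Q) \<union> X, H - Q)" and j = "\<lambda>(K, L). (H - L, K - L)"], goal_cases)
    case (5 p)
    then obtain K L where p: "p = (K, L)" "K \<subseteq> H" "L \<subseteq> K" by auto
    then have "H - L - (K - L) = H - K" by auto
    then show ?case by (simp add: p mult.commute)
  qed auto
  also have "\<dots> = (\<Sum>Q\<in>Pow H. \<Sum>X\<in>Pow Q.
      ((\<Prod>h\<in>X. Re (z $ h)) * (\<Prod>h\<in>Q - X. - a h)) *\<^sub>R G Q z $ P)"
    by (rule sum.Sigma[symmetric]) (auto intro: finite_subset)
  also have "\<dots> = (\<Sum>Q\<in>Pow H. (\<Prod>h\<in>Q. Re (z $ h) - a h) *\<^sub>R G Q z $ P)"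
  proof (rule sum.cong[OF refl])
    fix Q
    have "(\<Prod>h\<in>Q. Re (z $ h) + - a h) = (\<Sum>X\<in>Pow Q. (\<Prod>h\<in>X. Re (z $ h)) * (\<Prod>h\<in>Q - X. - a h))"
      by (rule prod_add) simp
    then show "(\<Sum>X\<in>Pow Q. ((\<Prod>h\<in>X. Re (z $ h)) * (\<Prod>h\<in>Q - X. - a h)) *\<^sub>R G Q z $ P)
        = (\<Prod>h\<in>Q. Re (z $ h) - a h) *\<^sub>R G Q z $ P"
      by (simp add: scaleR_sum_left)
  qed
  finally show ?thesis .
qed

text \<open>At points with nonreal coordinates the sum of the components is the function from
  iterated_mean_value, hence by density it is this function everywhere.\<close>

lemma sum_component_stem_mean_value:
  fixes F :: "'n::finite cspace \<Rightarrow> 'n stem_val" and a r :: "'n \<Rightarrow> real"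
  assumes D: "open D" "invariant D" and F: "stem_function D F" and hol: "\<And>j. holomorphic_in D j F"
    and r: "\<And>i. r i \<ge> 0" and G: "is_quotient_family D H F G"
    and P: "P \<inter> H = {}" and disc: "polydisc a r H z \<subseteq> D"
  shows "(\<Sum>K\<in>Pow H. ((- 1) ^ card (H - K) * (\<Prod>h\<in>H - K. a h)) *\<^sub>R
      (LINT l|PiM H (\<lambda>_. sphere_prob). component_stem G H K (on_spheres a r H z l) $ P))
    = F (centre a H z) $ P"
proof -
  obtain A where A: "stem_function D A"
    and A_nonreal: "\<forall>z\<in>nonreal_part H D. \<forall>K. K \<inter> H = {} \<longrightarrow> A z $ K =
      (\<Sum>Q\<in>Pow H. (\<Prod>h\<in>Q. (Re (z $ h) - a h) / Im (z $ h)) *\<^sub>R F z $ (K \<union> Q))"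
    and A_mean: "\<forall>z K. K \<inter> H = {} \<longrightarrow> polydisc a r H z \<subseteq> D \<longrightarrow>
      (LINT l|PiM H (\<lambda>_. sphere_prob). A (on_spheres a r H z l) $ K) = F (centre a H z) $ K"
  proof -
    have "\<forall>j\<in>H \<union> {}. holomorphic_in D j F" using hol by blast
    from iterated_mean_value[where a = a and r = r, OF D r finite[of H] F this Int_empty_right]
    show ?thesis by (elim exE conjE) (rule that)
  qed
  have GS: "\<And>Q. Q \<subseteq> H \<Longrightarrow> stem_function D (G Q)" using G by (auto simp: is_quotient_family_def)
  have eq: "(\<Sum>Q\<in>Pow H. (\<Prod>h\<in>Q. Re (z $ h) - a h) *\<^sub>R G Q z $ P) = A z $ P" if "z \<in> D" for z
  proof (rule continuous_eq_on_dense[OF _ stem_function_continuous[OF A] nonreal_part_subset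
        closure_nonreal_part[OF D(1), of H] _ that])
    show "continuous_on D (\<lambda>z. \<Sum>Q\<in>Pow H. (\<Prod>h\<in>Q. Re (z $ h) - a h) *\<^sub>R G Q z $ P)"
      by (intro continuous_intros stem_function_continuous GS) auto
    fix z assume z: "z \<in> nonreal_part H D"
    show "(\<Sum>Q\<in>Pow H. (\<Prod>h\<in>Q. Re (z $ h) - a h) *\<^sub>R G Q z $ P) = A z $ P"
      unfolding A_nonreal[rule_format, OF z P]
    proof (rule sum.cong[OF refl])
      fix Q assume Q: "Q \<in> Pow H"
      then have "G Q z $ P = inverse (\<Prod>h\<in>Q. Im (z $ h)) *\<^sub>R F z $ (P \<union> Q)"
        using P by (intro quotient_family_nonreal[OF G _ z]) auto
      then show "(\<Prod>h\<in>Q. Re (z $ h) - a h) *\<^sub>R G Q z $ P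
          = (\<Prod>h\<in>Q. (Re (z $ h) - a h) / Im (z $ h)) *\<^sub>R F z $ (P \<union> Q)"
        by (simp add: prod_dividef) (simp add: divide_inverse)
    qed
  qed
  let ?M = "PiM H (\<lambda>_. sphere_prob)"
  have int: "integrable ?M (\<lambda>l. component_stem G H K (on_spheres a r H z l) $ P)" for K
    by (rule integrable_on_spheres[OF stem_function_continuous[OF stem_function_component_stem[OF GS]] disc r])
  have "(\<Sum>K\<in>Pow H. ((- 1) ^ card (H - K) * (\<Prod>h\<in>H - K. a h)) *\<^sub>R
      (LINT l|?M. component_stem G H K (on_spheres a r H z l) $ P))
    = (LINT l|?M. (\<Sum>K\<in>Pow H. ((- 1) ^ card (H - K) * (\<Prod>h\<in>H - K. a h)) *\<^sub>R
        component_stem G H K (on_spheres a r H z l) $ P))"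
    by (subst Bochner_Integration.integral_sum) (auto intro!: int integrable_scaleR_right)
  also have "\<dots> = (LINT l|?M. A (on_spheres a r H z l) $ P)"
  proof (intro Bochner_Integration.integral_cong refl)
    fix l assume "l \<in> space ?M"
    then have "on_spheres a r H z l \<in> D"
      using on_spheres_in_polydisc[where a = a and r = r and z = z and H = H, OF r] disc by blast
    then show "(\<Sum>K\<in>Pow H. ((- 1) ^ card (H - K) * (\<Prod>h\<in>H - K. a h)) *\<^sub>R
        component_stem G H K (on_spheres a r H z l) $ P) = A (on_spheres a r H z l) $ P"
      by (simp only: sum_component_stem[OF P] eq)
  qed
  also have "\<dots> = F (centre a H z) $ P" using A_mean P disc by blast
  finally show ?thesis .
qed

lemma slice_point_mem_circularization:
  assumes D: "invariant D" and J: "\<And>h. J $ h \<in> imag_units" and x: "slice_point J z \<in> circularization D"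
  shows "z \<in> D"
proof -
  obtain J' z' where z': "z' \<in> D" "\<And>h. J' $ h \<in> imag_units" "slice_point J z = slice_point J' z'"
    using x by (auto simp: circularization_def)
  obtain C where "z = conj_set C z'" using slice_point_eq_cases[OF z'(2) J z'(3)[symmetric]] by blast
  then show ?thesis using conj_set_in_invariant[OF D z'(1)] by simp
qed

lemma norm_of_real_plus_imag_unit:
  assumes "J \<in> imag_units"
  shows "norm (of_real x + J * of_real y) = norm (Complex x y)"
proof -
  have J: "qre J = 0" "qi J * qi J + qj J * qj J + qk J * qk J = 1"
    using assms by (auto simp: imag_units_iff norm_quat_eq power2_eq_square)
  have "(y * qi J)\<^sup>2 + (y * qj J)\<^sup>2 + (y * qk J)\<^sup>2 = y\<^sup>2 * (qi J * qi J + qj J * qj J + qk J * qk J)"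
    by (simp add: power2_eq_square algebra_simps)
  then show ?thesis using J
    by (simp add: norm_quat_eq of_real_def cmod_def add.assoc)
qed

theorem proposition4p10:
  fixes D :: "'n::{finite,linorder} cspace set"
    and f :: "'n qspace \<Rightarrow> quat"
    and a :: "'n qspace"
    and r :: "'n \<Rightarrow> real"
    and H :: "'n set"
  assumes "open D"
    and "invariant D"
    and "slice_regular D f"
    and "a \<in> circularization D"
    and "\<forall>i. r i \<ge> 0"
    and "{x. \<forall>i. x $ i \<in> cball (a $ i) (r i)} \<subseteq> circularization D"
    and "\<forall>h\<in>H. a $ h \<in> \<real>"
  shows "f a = (\<Sum>K\<in>Pow H. (- 1) ^ card (H - K) * oprod (($) a) (H - K) *
    (LINT l | PiM H (\<lambda>_. sphere_prob).
      spherical_component D H K f (\<chi> i. if i \<in> H then a $ i + r i *\<^sub>R l i else a $ i)))"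
proof -
  note D = assms(1,2)
  have r: "\<And>i. r i \<ge> 0" using assms(5) by blast
  obtain F where F: "stem_holomorphic D F" and f: "\<And>x. x \<in> circularization D \<Longrightarrow> f x = induced D F x"
    using assms(3) by (auto simp: slice_regular_def)
  have sF: "stem_function D F" using F by (simp add: stem_holomorphic_def)
  have hol: "\<And>j. holomorphic_in D j F" by (rule holomorphic_in_of_stem_holomorphic[OF D(1) F])
  obtain G where G: "is_quotient_family D H F G" by (rule quotient_family_exists[OF D sF hol])
  obtain J z where z: "z \<in> D" and J: "\<And>h. J $ h \<in> imag_units" and a: "a = slice_point J z"
    using assms(4) by (auto simp: circularization_def)
  define \<alpha> where "\<alpha> = (\<lambda>h. Re (z $ h))"
  have a_nth: "a $ h = of_real (Re (z $ h)) + J $ h * of_real (Im (z $ h))" for h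
    by (simp add: a slice_point_def)
  have real: "Im (z $ h) = 0" if h: "h \<in> H" for h
  proof -
    obtain c where c: "a $ h = of_real c" using assms(7) h by (auto elim: Reals_cases)
    have "of_real (Re (z $ h)) + J $ h * of_real (Im (z $ h)) = of_real c + J $ h * of_real 0"
      using c a_nth[of h] by simp
    from imag_unit_decomposition_unique(2)[OF J J this] show ?thesis by auto
  qed
  have aH: "a $ h = of_real (\<alpha> h)" if "h \<in> H" for h
    using real[OF that] by (simp add: a_nth \<alpha>_def)
  have zH: "z $ h = of_real (\<alpha> h)" if "h \<in> H" for h
    using real[OF that] by (simp add: \<alpha>_def complex_eq_iff)
  have disc: "polydisc \<alpha> r H z \<subseteq> D"
  proof
    fix z' assume z': "z' \<in> polydisc \<alpha> r H z"
    have "slice_point J z' $ i \<in> cball (a $ i) (r i)" for i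
    proof (cases "i \<in> H")
      case True
      have "a $ i - slice_point J z' $ i
          = of_real (Re (of_real (\<alpha> i) - z' $ i)) + J $ i * of_real (Im (of_real (\<alpha> i) - z' $ i))"
        by (simp add: aH[OF True] slice_point_def)
      then have "norm (a $ i - slice_point J z' $ i) = norm (of_real (\<alpha> i) - z' $ i)"
        by (simp only: norm_of_real_plus_imag_unit[OF J] complex_surj)
      moreover have "z' $ i \<in> cball (of_real (\<alpha> i)) (r i)"
        using z' True unfolding polydisc_def by (auto dest: spec[of _ i])
      ultimately show ?thesis by (simp add: dist_norm)
    next
      case False
      then have "z' $ i = z $ i" using z' unfolding polydisc_def by (auto dest: spec[of _ i])
      then show ?thesis using r by (simp add: a slice_point_def)
    qed
    then have "slice_point J z' \<in> circularization D" using assms(6) by blast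
    then show "z' \<in> D" by (rule slice_point_mem_circularization[OF D(2) J])
  qed
  let ?M = "PiM H (\<lambda>_. sphere_prob)"
  let ?S = "component_stem G H"
  let ?w = "on_spheres \<alpha> r H z"
  let ?x = "\<lambda>l. \<chi> i. if i \<in> H then a $ i + r i *\<^sub>R l i else a $ i"
  have GS: "\<And>Q. Q \<subseteq> H \<Longrightarrow> stem_function D (G Q)" using G by (auto simp: is_quotient_family_def)
  have S: "stem_function D (?S K)" for K by (rule stem_function_component_stem[OF GS])
  have comp: "spherical_component D H K f (?x l) = (\<Sum>P\<in>UNIV. oprod (($) J) P * ?S K (?w l) $ P)"
    if K: "K \<subseteq> H" and l: "l \<in> space ?M" for K l
  proof -
    \<comment> \<open>Coordinates in H need the unit of the integration variable. It drops out of
      the value, since the coefficients at sets meeting H vanish.\<close>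
    define J' where "J' = (\<chi> i. if i \<in> H then upper_unit (l i) else J $ i)"
    have J': "J' $ h \<in> imag_units" for h by (simp add: J'_def J upper_unit(1))
    have w: "?w l \<in> D" using on_spheres_in_polydisc[where a = \<alpha> and r = r and z = z, OF r l] disc by blast
    have x: "?x l = slice_point J' (?w l)"
    proof (subst vec_eq_iff, intro allI)
      fix i
      show "?x l $ i = slice_point J' (?w l) $ i"
      proof (cases "i \<in> H")
        case True
        have "slice_point J' (?w l) $ i
            = of_real (\<alpha> i) + r i *\<^sub>R (of_real (Re (upper (l i))) + upper_unit (l i) * of_real (Im (upper (l i))))"
          using True by (simp add: slice_point_def on_spheres_def J'_def of_real_def algebra_simps)
        then show ?thesis using True by (simp add: aH upper_unit(2)[symmetric])
      next
        case False
        then show ?thesis by (simp add: slice_point_def on_spheres_def J'_def a)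
      qed
    qed
    have xC: "?x l \<in> circularization D"
      unfolding x by (rule slice_point_in_circularization[OF w J'])
    have "spherical_component D H K f (?x l) = induced D (?S K) (?x l)"
      by (rule spherical_component_eq[OF D sF f G K xC])
    also have "\<dots> = (\<Sum>P\<in>UNIV. oprod (($) J') P * ?S K (?w l) $ P)"
      unfolding x by (rule induced_slice_point[OF D(2) S w J'])
    also have "\<dots> = (\<Sum>P\<in>UNIV. oprod (($) J) P * ?S K (?w l) $ P)"
    proof (rule sum.cong[OF refl])
      fix P
      show "oprod (($) J') P * ?S K (?w l) $ P = oprod (($) J) P * ?S K (?w l) $ P"
      proof (cases "P \<inter> H = {}")
        case True
        then have "oprod (($) J') P = oprod (($) J) P" by (intro oprod_cong) (auto simp: J'_def)
        then show ?thesis by simp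
      qed (simp add: component_stem_nth)
    qed
    finally show ?thesis .
  qed
  \<comment> \<open>The weights are real because the a_h with h \<in> H are; hence they commute
    with the units and act on each coefficient separately.\<close>
  define c where "c = (\<lambda>K. (- 1) ^ card (H - K) * (\<Prod>h\<in>H - K. \<alpha> h))"
  define I where "I = (\<lambda>K P. LINT l|?M. ?S K (?w l) $ P)"
  have int: "integrable ?M (\<lambda>l. ?S K (?w l) $ P)" for K P
    by (rule integrable_on_spheres[OF stem_function_continuous[OF S] disc r])
  have summand: "(- 1) ^ card (H - K) * oprod (($) a) (H - K) *
      (LINT l|?M. spherical_component D H K f (?x l))
      = (\<Sum>P\<in>UNIV. oprod (($) J) P * (c K *\<^sub>R I K P))" if K: "K \<in> Pow H" for K
  proof -
    have "oprod (($) a) (H - K) = oprod (\<lambda>h. of_real (\<alpha> h)) (H - K)"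
      by (rule oprod_cong) (simp add: aH)
    then have "(- 1) ^ card (H - K) * oprod (($) a) (H - K) = of_real (c K)"
      by (simp add: oprod_of_real c_def)
    moreover have "(LINT l|?M. spherical_component D H K f (?x l)) = (\<Sum>P\<in>UNIV. oprod (($) J) P * I K P)"
    proof -
      have "(LINT l|?M. spherical_component D H K f (?x l))
          = (LINT l|?M. (\<Sum>P\<in>UNIV. oprod (($) J) P * ?S K (?w l) $ P))"
        using K by (intro Bochner_Integration.integral_cong refl comp) auto
      also have "\<dots> = (\<Sum>P\<in>UNIV. LINT l|?M. oprod (($) J) P * ?S K (?w l) $ P)"
        by (rule Bochner_Integration.integral_sum) (intro integrable_mult_right int)
      also have "\<dots> = (\<Sum>P\<in>UNIV. oprod (($) J) P * I K P)"
        unfolding I_def by (intro sum.cong refl Bochner_Integration.integral_mult_right int)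
      finally show ?thesis .
    qed
    ultimately show ?thesis
      by (simp add: of_real_def scaleR_sum_right)
  qed
  have "(\<Sum>K\<in>Pow H. (- 1) ^ card (H - K) * oprod (($) a) (H - K) *
      (LINT l|?M. spherical_component D H K f (?x l)))
      = (\<Sum>K\<in>Pow H. \<Sum>P\<in>UNIV. oprod (($) J) P * (c K *\<^sub>R I K P))"
    by (rule sum.cong[OF refl summand])
  also have "\<dots> = (\<Sum>P\<in>UNIV. oprod (($) J) P * (\<Sum>K\<in>Pow H. c K *\<^sub>R I K P))"
    by (subst sum.swap) (simp only: sum_distrib_left)
  also have "\<dots> = (\<Sum>P\<in>UNIV. oprod (($) J) P * F z $ P)"
  proof (rule sum.cong[OF refl])
    fix P
    have "(\<Sum>K\<in>Pow H. c K *\<^sub>R I K P) = F z $ P"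
    proof (cases "P \<inter> H = {}")
      case True
      have "centre \<alpha> H z = z" by (simp add: centre_def vec_eq_iff zH)
      with sum_component_stem_mean_value[OF D sF hol r G True disc] show ?thesis
        by (simp add: c_def I_def)
    next
      case False
      then have "I K P = 0" for K by (simp add: I_def component_stem_nth)
      moreover have "F z $ P = 0" using False real stem_function_real_zero[OF sF z] by blast
      ultimately show ?thesis by simp
    qed
    then show "oprod (($) J) P * (\<Sum>K\<in>Pow H. c K *\<^sub>R I K P) = oprod (($) J) P * F z $ P" by simp
  qed
  also have "\<dots> = induced D F a"
    unfolding a by (rule induced_slice_point[OF D(2) sF z J, symmetric])
  also have "\<dots> = f a" using f[OF assms(4)] by simp
  finally show ?thesis by simp
qed

end
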